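(* Let $\underline Z_n=\boldsymbol X_n\underline\theta_0+\underline e_n$ with $\underline\theta_0\in\mathbb R^r$, where the fixed design matrices $\boldsymbol X_n\in\mathbb R^{n\times r}$ satisfy Assumption D and $\{e_t\}$ is a stationary mean zero Gaussian time series with spectral density $f_0$ satisfying Assumption F. Let $0<\tau_0<\min_\omega f_0(\omega)\le\max_\omega f_0(\omega)<\tau_1<\infty$, and let the prior be as in the context, satisfying Assumptions P, G and K. Put $\boldsymbol D_{n,0}=\boldsymbol D_n(f_0)$, $\boldsymbol S_n=\tilde{\boldsymbol X}_n^T\boldsymbol D_{n,0}^{-1}\tilde{\boldsymbol X}_n$ and $\underline G_n=\boldsymbol S_n^{-1/2}\tilde{\boldsymbol X}_n^T\boldsymbol D_{n,0}^{-1}(\tilde{\underline Z}_n-\tilde{\boldsymbol X}_n\underline\theta_0)$. Then $$\log\frac{p_W^n(\underline Z_n|\underline\theta,f)}{p_W^n(\underline Z_n|\underline\theta_0,f)}=(\underline\theta-\underline\theta_0)^T\boldsymbol S_n^{1/2}\underline G_n-\tfrac12(\underline\theta-\underline\theta_0)^T\boldsymbol S_n(\underline\theta-\underline\theta_0)+R_n(\underline\theta,f),$$ where $(\underline G_n)$ is a tight sequence of random vectors under $P_W^n(\cdot|\underline\theta_0,f_0)$, and the remainder satisfies, as $n\to\infty$, in $P_W^n(\cdot|\underline\theta_0,f_0)$-probability, $$\sup_{(\underline\theta,f)\in\Theta_n\times\mathcal H_n}\frac{|R_n(\underline\theta,f)|}{1+(\underline\theta-\underline\theta_0)^T\boldsymbol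 S_n(\underline\theta-\underline\theta_0)}\to0,$$ where $\Theta_n=\{\underline\theta\in\mathbb R^r:(\underline\theta-\underline\theta_0)^T\boldsymbol S_n(\underline\theta-\underline\theta_0)\le\sqrt{\lambda_{\min}(\boldsymbol S_n)}\}$ and $\mathcal H_n=\{f\in\mathcal C_{\tau_0,\tau_1}:\|f-f_0\|_\infty\le1/\log n\}$.
   Context: Notation. $r$ is fixed. $\lambda_j=2\pi j/n$ are the Fourier frequencies, $N=\lfloor (n-1)/2\rfloor$. The orthogonal matrix $\boldsymbol F_n\in\mathbb R^{n\times n}$ has rows $\mathbf e_0,\mathbf c_1,\mathbf s_1,\dots,\mathbf c_N,\mathbf s_N$ (and additionally $\mathbf e_{n/2}$ as last row if $n$ is even), where $\mathbf e_j=n^{-1/2}(e_j,e_j^2,\dots,e_j^n)^T$ with $e_j=\exp(-2\pi i j/n)$, $\mathbf c_j=\sqrt2\,\mathrm{Re}\,\mathbf e_j$, $\mathbf s_j=\sqrt2\,\mathrm{Im}\,\mathbf e_j$. Put $\tilde{\underline Z}_n=\boldsymbol F_n\underline Z_n$, $\tilde{\underline z}_n=\boldsymbol F_n\underline z_n$, $\tilde{\boldsymbol X}_n=\boldsymbol F_n\boldsymbol X_n$. For a spectral density $f$, $\boldsymbol D_n=\boldsymbol D_n(f)=2\pi\,\mathrm{diag}(f(0),f(\lambda_1),f(\lambda_1),\dots,f(\lambda_N),f(\lambda_N))$ for $n$ odd, with an additional last diagonal entry $2\pi f(\lambda_{n/2})$ for $n$ even. For a symmetric positive definite matrix, the power $1/2$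 denotes its unique symmetric positive definite square root. Whittle's likelihood $P_W^n(\cdot|\underline\theta,f)$ is the distribution of $\underline Z_n$ with Lebesgue density $$p_W^n(\underline z_n|\underline\theta,f)=\frac1{\sqrt{(2\pi)^n|\boldsymbol D_n|}}\exp\Big(-\tfrac12(\tilde{\underline z}_n-\tilde{\boldsymbol X}_n\underline\theta)^T\boldsymbol D_n^{-1}(\tilde{\underline z}_n-\tilde{\boldsymbol X}_n\underline\theta)\Big).$$ Assumption D: $\boldsymbol X_n$ has full rank for $n$ sufficiently large and $0<\liminf_n\frac1n\lambda_{\min}(\boldsymbol X_n^T\boldsymbol X_n)\le\limsup_n\frac1n\lambda_{\max}(\boldsymbol X_n^T\boldsymbol X_n)<\infty$. Assumption F: $f_0$ is uniformly bounded and uniformly bounded away from $0$, and the autocovariance function $\gamma_0(h)=\int_0^{2\pi}f_0(\omega)e^{ih\omega}d\omega$ satisfies $\sum_{h\ge0}|\gamma_0(h)|h^a<\infty$ for some $1<a\le2$. Prior. $\underline\theta$ and $f$ are a priori independent with joint prior $P(d\underline\theta)P_{\tau_0,\tau_1}(df)$. For $0<\tau_0<\tau_1<\infty$ let $\mathcal C_{\tau_0,\tau_1}=\{f\in\mathcal C^1([0,\pi]):\|f^{-1}\|_\infty\le\tau_0^{-1},\ \|f\|_L\le\tau_1\}$, with $\|f\|_L=\|f\|_\infty+\sup_{\omega_1\ne\omega_2}|f(\omega_1)-f(\omega_2)|/|\omega_1-\omega_2|$. The Bernstein-Gamma prior $P(df)$ is the law of $f(\omega)=\sum_{j=1}^k\Phi(I_{j,k})\,b(\omega/\pi|j,k-j+1)$,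 $0\le\omega\le\pi$, where $I_{j,k}=((j-1)\pi/k,j\pi/k]$, $b(\cdot|j,l)$ is the $\mathrm{Beta}(j,l)$ density on $[0,1]$, $k\in\mathbb N$ has probability mass function $p(k)$, and independently $\Phi\sim\mathrm{GP}(\alpha,\beta)$ is a Gamma process on $[0,\pi]$ with $\alpha,\beta:[0,\pi]\to(0,\infty)$ (the completely random measure with Lévy measure $\alpha(x)s^{-1}e^{-\beta(x)s}\,ds\,dx$ on $[0,\pi]\times(0,\infty)$). $P_{\tau_0,\tau_1}(F)=P(F\cap\mathcal C_{\tau_0,\tau_1})/P(\mathcal C_{\tau_0,\tau_1})$. Assumption P: the prior $P(d\underline\theta)$ satisfies $E\|\underline\theta\|^\nu<\infty$ for some $\nu>0$ and has a Lebesgue density $g$ on $\mathbb R^r$ with $g\le C$ for some $C>0$, which is continuous and strictly positive in an open neighbourhood of $\underline\theta_0$. Assumption G: there are positive constants $g_0,g_1$ with $g_0\le\alpha(x),\beta(x)\le g_1$ for all $x\in[0,\pi]$ outside a Lebesgue null set. Assumption K: there are positive constants $A_1,A_2,\kappa_1,\kappa_2$ with $A_1\exp(-\kappa_1j\log j)\le p(j)\le A_2\exp(-\kappa_2j)$ for all $j\in\mathbb N$. *)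

theory Defs
  imports "HOL-Probability.Probability"
begin

text \<open>
  Vectors in \<open>\<real>\<^sup>n\<close> with varying \<open>n\<close> are functions \<open>nat \<Rightarrow> real\<close> read on the indices \<open>1..n\<close>;
  Lebesgue measure on \<open>\<real>\<^sup>n\<close> is the product measure on \<open>{1..n}\<close>.  The parameter space
  \<open>\<real>\<^sup>r\<close>, whose dimension is fixed, is \<open>real ^ 'r\<close>.  The sequence of design matrices is
  \<open>X :: nat \<Rightarrow> nat \<Rightarrow> real ^ 'r\<close>, where \<open>X n t\<close> is the \<open>t\<close>-th row of the \<open>n \<times> r\<close> matrix.
\<close>

definition eigenvalues :: "real ^ 'r ^ 'r \<Rightarrow> real set" where
  "eigenvalues A = {l. \<exists>v. v \<noteq> 0 \<and> A *v v = l *\<^sub>R v}"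

definition lambda_min :: "real ^ 'r ^ 'r \<Rightarrow> real" where
  "lambda_min A = Min (eigenvalues A)"

definition lambda_max :: "real ^ 'r ^ 'r \<Rightarrow> real" where
  "lambda_max A = Max (eigenvalues A)"

definition sym_pos_def :: "real ^ 'r ^ 'r \<Rightarrow> bool" where
  "sym_pos_def A \<longleftrightarrow> transpose A = A \<and> (\<forall>v. v \<noteq> 0 \<longrightarrow> v \<bullet> (A *v v) > 0)"

text \<open>Meaningful for symmetric positive definite arguments only.\<close>

definition mat_sqrt :: "real ^ 'r ^ 'r \<Rightarrow> real ^ 'r ^ 'r" where
  "mat_sqrt A = (THE B. sym_pos_def B \<and> B ** B = A)"

definition fourier_freq :: "nat \<Rightarrow> nat \<Rightarrow> real" where
  "fourier_freq n j = 2 * pi * real j / real n"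

definition fourier_vec :: "nat \<Rightarrow> nat \<Rightarrow> nat \<Rightarrow> complex" where
  "fourier_vec n j t = exp (- \<i> * complex_of_real (fourier_freq n j)) ^ t / complex_of_real (sqrt (real n))"

text \<open>
  The rows \<open>1, \<dots>, n\<close> of \<open>F\<^sub>n\<close> are \<open>e\<^sub>0, c\<^sub>1, s\<^sub>1, \<dots>, c\<^sub>N, s\<^sub>N\<close> and, for even \<open>n\<close>,
  finally \<open>e\<^sub>n\<^sub>/\<^sub>2\<close>.  Row \<open>m\<close> thus belongs to the Fourier frequency with index \<open>m div 2\<close>.
  Both \<open>e\<^sub>0\<close> and \<open>e\<^sub>n\<^sub>/\<^sub>2\<close> are real vectors.
\<close>

definition fourier_mat :: "nat \<Rightarrow> nat \<Rightarrow> nat \<Rightarrow> real" where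
  "fourier_mat n m t =
    (if m = 1 \<or> (even n \<and> m = n) then Re (fourier_vec n (m div 2) t)
     else if even m then sqrt 2 * Re (fourier_vec n (m div 2) t)
     else sqrt 2 * Im (fourier_vec n (m div 2) t))"

definition fourier_data :: "nat \<Rightarrow> (nat \<Rightarrow> real) \<Rightarrow> nat \<Rightarrow> real" where
  "fourier_data n z m = (\<Sum>t=1..n. fourier_mat n m t * z t)"

definition fourier_design :: "(nat \<Rightarrow> nat \<Rightarrow> real ^ 'r) \<Rightarrow> nat \<Rightarrow> nat \<Rightarrow> real ^ 'r" where
  "fourier_design X n m = (\<Sum>t=1..n. fourier_mat n m t *\<^sub>R X n t)"

text \<open>The \<open>m\<close>-th diagonal entry of the diagonal matrix \<open>D\<^sub>n(f)\<close>.\<close>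

definition D_entry :: "nat \<Rightarrow> (real \<Rightarrow> real) \<Rightarrow> nat \<Rightarrow> real" where
  "D_entry n f m = 2 * pi * f (fourier_freq n (m div 2))"

definition whittle_density ::
    "(nat \<Rightarrow> nat \<Rightarrow> real ^ 'r) \<Rightarrow> nat \<Rightarrow> real ^ 'r \<Rightarrow> (real \<Rightarrow> real) \<Rightarrow> (nat \<Rightarrow> real) \<Rightarrow> real" where
  "whittle_density X n \<theta> f z =
     1 / sqrt ((2 * pi) ^ n * (\<Prod>m=1..n. D_entry n f m)) *
     exp (- (1 / 2) * (\<Sum>m=1..n. (fourier_data n z m - fourier_design X n m \<bullet> \<theta>)\<^sup>2 / D_entry n f m))"

definition whittle_measure ::
    "(nat \<Rightarrow> nat \<Rightarrow> real ^ 'r) \<Rightarrow> nat \<Rightarrow> real ^ 'r \<Rightarrow> (real \<Rightarrow> real) \<Rightarrow> (nat \<Rightarrow> real) measure" where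
  "whittle_measure X n \<theta> f =
     density (Pi\<^sub>M {1..n} (\<lambda>_. lborel)) (\<lambda>z. ennreal (whittle_density X n \<theta> f z))"

definition S_mat :: "(nat \<Rightarrow> nat \<Rightarrow> real ^ 'r) \<Rightarrow> (real \<Rightarrow> real) \<Rightarrow> nat \<Rightarrow> real ^ 'r ^ 'r" where
  "S_mat X f0 n =
     (\<chi> i j. \<Sum>m=1..n. fourier_design X n m $ i * fourier_design X n m $ j / D_entry n f0 m)"

definition G_vec ::
    "(nat \<Rightarrow> nat \<Rightarrow> real ^ 'r) \<Rightarrow> real ^ 'r \<Rightarrow> (real \<Rightarrow> real) \<Rightarrow> nat \<Rightarrow> (nat \<Rightarrow> real) \<Rightarrow> real ^ 'r" where
  "G_vec X \<theta>0 f0 n z =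
     matrix_inv (mat_sqrt (S_mat X f0 n)) *v
     (\<Sum>m=1..n. ((fourier_data n z m - fourier_design X n m \<bullet> \<theta>0) / D_entry n f0 m)
                 *\<^sub>R fourier_design X n m)"

definition autocov :: "(real \<Rightarrow> real) \<Rightarrow> int \<Rightarrow> complex" where
  "autocov f h = (LINT \<omega>:{0..2*pi}|lborel.
     complex_of_real (f \<omega>) * exp (\<i> * of_int h * complex_of_real \<omega>))"

text \<open>Degenerate Gaussian variables, i.e. almost surely constant ones, are included.\<close>

definition gaussian_rv :: "'w measure \<Rightarrow> ('w \<Rightarrow> real) \<Rightarrow> bool" where
  "gaussian_rv M Y \<longleftrightarrow> Y \<in> borel_measurable M \<and>
     ((\<exists>\<mu> \<sigma>. \<sigma> > 0 \<and> distributed M lborel Y (normal_density \<mu> \<sigma>)) \<or> (\<exists>\<mu>. AE w in M. Y w = \<mu>))"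

definition gaussian_process :: "'w measure \<Rightarrow> (int \<Rightarrow> 'w \<Rightarrow> real) \<Rightarrow> bool" where
  "gaussian_process M e \<longleftrightarrow> prob_space M \<and>
     (\<forall>I c. finite I \<longrightarrow> gaussian_rv M (\<lambda>w. \<Sum>t\<in>I. c t * e t w))"

text \<open>
  The covariance condition makes the autocovariances depend on the lag only; for a
  mean zero Gaussian process this is (strict) stationarity.
\<close>

definition stationary_gaussian_series ::
    "'w measure \<Rightarrow> (int \<Rightarrow> 'w \<Rightarrow> real) \<Rightarrow> (real \<Rightarrow> real) \<Rightarrow> bool" where
  "stationary_gaussian_series M e f \<longleftrightarrow>
     gaussian_process M e \<and>
     (\<forall>t. (LINT w|M. e t w) = 0) \<and>
     set_integrable lborel {0..2*pi} f \<and> (\<forall>\<omega>\<in>{0..2*pi}. f \<omega> \<ge> 0) \<and>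
     (\<forall>t h. complex_of_real (LINT w|M. e t w * e (t + h) w) = autocov f h)"

definition assumption_F :: "(real \<Rightarrow> real) \<Rightarrow> bool" where
  "assumption_F f0 \<longleftrightarrow>
     (\<exists>c C. c > 0 \<and> (\<forall>\<omega>\<in>{0..2*pi}. c \<le> f0 \<omega> \<and> f0 \<omega> \<le> C)) \<and>
     (\<exists>a::real. 1 < a \<and> a \<le> 2 \<and>
        summable (\<lambda>h::nat. cmod (autocov f0 (int h)) * real h powr a))"

definition gram_mat :: "(nat \<Rightarrow> nat \<Rightarrow> real ^ 'r) \<Rightarrow> nat \<Rightarrow> real ^ 'r ^ 'r" where
  "gram_mat X n = (\<chi> i j. \<Sum>t=1..n. X n t $ i * X n t $ j)"

text \<open>Full rank is expressed as the row space of the \<open>n \<times> r\<close> matrix having dimension \<open>r\<close>.\<close>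

definition assumption_D :: "(nat \<Rightarrow> nat \<Rightarrow> real ^ 'r) \<Rightarrow> bool" where
  "assumption_D X \<longleftrightarrow>
     (\<forall>\<^sub>F n in sequentially. dim (X n ` {1..n}) = CARD('r)) \<and>
     0 < liminf (\<lambda>n. ereal (lambda_min (gram_mat X n) / real n)) \<and>
     liminf (\<lambda>n. ereal (lambda_min (gram_mat X n) / real n))
       \<le> limsup (\<lambda>n. ereal (lambda_max (gram_mat X n) / real n)) \<and>
     limsup (\<lambda>n. ereal (lambda_max (gram_mat X n) / real n)) < \<infinity>"

text \<open>Functions on \<open>[0,\<pi>]\<close> are represented by extensional functions.\<close>

definition sup_norm :: "(real \<Rightarrow> real) \<Rightarrow> real" where
  "sup_norm f = (SUP \<omega>\<in>{0..pi}. \<bar>f \<omega>\<bar>)"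

definition lip_norm :: "(real \<Rightarrow> real) \<Rightarrow> real" where
  "lip_norm f = sup_norm f +
     (SUP (x, y)\<in>{(x, y). x \<in> {0..pi} \<and> y \<in> {0..pi} \<and> x \<noteq> y}. \<bar>f x - f y\<bar> / \<bar>x - y\<bar>)"

definition C1_functions :: "(real \<Rightarrow> real) set" where
  "C1_functions = {f \<in> extensional {0..pi}. \<exists>f'. continuous_on {0..pi} f' \<and>
     (\<forall>x\<in>{0..pi}. (f has_real_derivative f' x) (at x within {0..pi}))}"

text \<open>
  Spectral densities are nonnegative, and the condition on \<open>f\<^sup>-\<^sup>1\<close> excludes zeros; the
  explicit positivity prevents the convention \<open>1 / 0 = 0\<close> from admitting them.
  The suprema are finite since \<open>f\<close> is continuously differentiable on a compact interval.
\<close>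

definition C_class :: "real \<Rightarrow> real \<Rightarrow> (real \<Rightarrow> real) set" where
  "C_class \<tau>0 \<tau>1 = {f \<in> C1_functions. (\<forall>\<omega>\<in>{0..pi}. f \<omega> > 0) \<and>
     sup_norm (\<lambda>\<omega>. 1 / f \<omega>) \<le> 1 / \<tau>0 \<and> lip_norm f \<le> \<tau>1}"

text \<open>
  A completely random measure with Levy measure \<open>\<nu>\<close> (no fixed atoms, no deterministic
  part): independent values on disjoint sets, and Laplace exponent
  \<open>- log E exp(-t \<Phi>(A)) = \<integral>\<^sub>A \<integral> (1 - exp(-t s)) \<nu>(dx, ds)\<close>.
\<close>

definition completely_random_measure ::
    "'v measure \<Rightarrow> 'x measure \<Rightarrow> ('x \<times> real) measure \<Rightarrow> ('v \<Rightarrow> 'x measure) \<Rightarrow> bool" where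
  "completely_random_measure M S \<nu> \<Phi> \<longleftrightarrow>
     prob_space M \<and>
     (\<forall>w\<in>space M. finite_measure (\<Phi> w) \<and> sets (\<Phi> w) = sets S) \<and>
     (\<forall>A\<in>sets S. (\<lambda>w. measure (\<Phi> w) A) \<in> borel_measurable M) \<and>
     (\<forall>A::nat \<Rightarrow> 'x set. range A \<subseteq> sets S \<and> disjoint_family A \<longrightarrow>
        prob_space.indep_vars M (\<lambda>_. borel) (\<lambda>i w. measure (\<Phi> w) (A i)) UNIV) \<and>
     (\<forall>A\<in>sets S. \<forall>t>0.
        ennreal (- ln (LINT w|M. exp (- t * measure (\<Phi> w) A))) =
        (\<integral>\<^sup>+(x, s). indicator A x * ennreal (1 - exp (- t * s)) \<partial>\<nu>))"

definition gamma_levy_measure :: "(real \<Rightarrow> real) \<Rightarrow> (real \<Rightarrow> real) \<Rightarrow> (real \<times> real) measure" where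
  "gamma_levy_measure \<alpha> \<beta> =
     density (restrict_space lborel {0..pi} \<Otimes>\<^sub>M restrict_space lborel {0<..})
       (\<lambda>(x, s). ennreal (\<alpha> x * (1 / s) * exp (- \<beta> x * s)))"

definition gamma_process ::
    "'v measure \<Rightarrow> ('v \<Rightarrow> real measure) \<Rightarrow> (real \<Rightarrow> real) \<Rightarrow> (real \<Rightarrow> real) \<Rightarrow> bool" where
  "gamma_process M \<Phi> \<alpha> \<beta> \<longleftrightarrow>
     \<alpha> \<in> borel_measurable (restrict_space borel {0..pi}) \<and>
     \<beta> \<in> borel_measurable (restrict_space borel {0..pi}) \<and>
     (\<forall>x\<in>{0..pi}. \<alpha> x > 0 \<and> \<beta> x > 0) \<and>
     completely_random_measure M (restrict_space borel {0..pi}) (gamma_levy_measure \<alpha> \<beta>) \<Phi>"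

text \<open>
  The \<open>Beta(j,l)\<close> density for positive integers \<open>j\<close>, \<open>l\<close>.  Natural-number powers are used because
  \<open>0 ^ 0 = 1\<close>, as required at the end points, whereas \<open>0 powr 0 = 0\<close>.
\<close>

definition beta_dens :: "nat \<Rightarrow> nat \<Rightarrow> real \<Rightarrow> real" where
  "beta_dens j l x = x ^ (j - 1) * (1 - x) ^ (l - 1) / Beta (real j) (real l)"

definition bernstein_function :: "real measure \<Rightarrow> nat \<Rightarrow> real \<Rightarrow> real" where
  "bernstein_function \<phi> k = (\<lambda>\<omega>\<in>{0..pi}. \<Sum>j=1..k.
     measure \<phi> {(real j - 1) * pi / real k <.. real j * pi / real k} * beta_dens j (k - j + 1) (\<omega> / pi))"

text \<open>\<open>C([0,\<pi>])\<close> with the trace of the product sigma-algebra, i.e. its Borel sigma-algebra.\<close>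

definition cont_space :: "(real \<Rightarrow> real) measure" where
  "cont_space = restrict_space (Pi\<^sub>M {0..pi} (\<lambda>_. borel)) {f. continuous_on {0..pi} f}"

text \<open>Independence of \<open>\<Phi>\<close> and \<open>k\<close> is encoded by the product measure.\<close>

definition bernstein_gamma_prior ::
    "'v measure \<Rightarrow> ('v \<Rightarrow> real measure) \<Rightarrow> nat pmf \<Rightarrow> (real \<Rightarrow> real) measure" where
  "bernstein_gamma_prior M \<Phi> p =
     distr (M \<Otimes>\<^sub>M measure_pmf p) cont_space (\<lambda>(w, k). bernstein_function (\<Phi> w) k)"

definition truncated_prior ::
    "'v measure \<Rightarrow> ('v \<Rightarrow> real measure) \<Rightarrow> nat pmf \<Rightarrow> real \<Rightarrow> real \<Rightarrow> (real \<Rightarrow> real) measure" where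
  "truncated_prior M \<Phi> p \<tau>0 \<tau>1 = uniform_measure (bernstein_gamma_prior M \<Phi> p) (C_class \<tau>0 \<tau>1)"

definition assumption_P :: "(real ^ 'r) measure \<Rightarrow> real ^ 'r \<Rightarrow> bool" where
  "assumption_P P \<theta>0 \<longleftrightarrow>
     prob_space P \<and>
     (\<exists>\<nu>>0. integrable P (\<lambda>\<theta>. norm \<theta> powr \<nu>)) \<and>
     (\<exists>g. g \<in> borel_measurable borel \<and> (\<forall>\<theta>. g \<theta> \<ge> 0) \<and>
        P = density lborel (\<lambda>\<theta>. ennreal (g \<theta>)) \<and>
        (\<exists>C>0. \<forall>\<theta>. g \<theta> \<le> C) \<and>
        (\<exists>U. open U \<and> \<theta>0 \<in> U \<and> continuous_on U g \<and> (\<forall>\<theta>\<in>U. g \<theta> > 0)))"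

definition assumption_G :: "(real \<Rightarrow> real) \<Rightarrow> (real \<Rightarrow> real) \<Rightarrow> bool" where
  "assumption_G \<alpha> \<beta> \<longleftrightarrow>
     (\<exists>g0 g1. g0 > 0 \<and> g1 > 0 \<and>
        (AE x in lborel. x \<in> {0..pi} \<longrightarrow>
           g0 \<le> \<alpha> x \<and> \<alpha> x \<le> g1 \<and> g0 \<le> \<beta> x \<and> \<beta> x \<le> g1))"

definition assumption_K :: "nat pmf \<Rightarrow> bool" where
  "assumption_K p \<longleftrightarrow>
     (\<exists>A1 A2 \<kappa>1 \<kappa>2. A1 > 0 \<and> A2 > 0 \<and> \<kappa>1 > 0 \<and> \<kappa>2 > 0 \<and>
        (\<forall>j\<ge>1. A1 * exp (- \<kappa>1 * real j * ln (real j)) \<le> pmf p j \<and>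
                pmf p j \<le> A2 * exp (- \<kappa>2 * real j)))"

definition Theta_set :: "(nat \<Rightarrow> nat \<Rightarrow> real ^ 'r) \<Rightarrow> real ^ 'r \<Rightarrow> (real \<Rightarrow> real) \<Rightarrow> nat \<Rightarrow> (real ^ 'r) set" where
  "Theta_set X \<theta>0 f0 n =
     {\<theta>. (\<theta> - \<theta>0) \<bullet> (S_mat X f0 n *v (\<theta> - \<theta>0)) \<le> sqrt (lambda_min (S_mat X f0 n))}"

definition H_set :: "real \<Rightarrow> real \<Rightarrow> (real \<Rightarrow> real) \<Rightarrow> nat \<Rightarrow> (real \<Rightarrow> real) set" where
  "H_set \<tau>0 \<tau>1 f0 n =
     {f \<in> C_class \<tau>0 \<tau>1. sup_norm (\<lambda>\<omega>. f \<omega> - f0 \<omega>) \<le> 1 / ln (real n)}"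

definition tight_seq ::
    "(nat \<Rightarrow> 'w measure) \<Rightarrow> (nat \<Rightarrow> 'w \<Rightarrow> 'b::{topological_space}) \<Rightarrow> bool" where
  "tight_seq P Y \<longleftrightarrow>
     (\<forall>n. prob_space (P n) \<and> Y n \<in> borel_measurable (P n)) \<and>
     (\<forall>\<epsilon>>0. \<exists>K. compact K \<and> (\<forall>n. measure (P n) {w \<in> space (P n). Y n w \<notin> K} \<le> \<epsilon>))"

definition tends_to_zero_in_prob ::
    "(nat \<Rightarrow> 'w measure) \<Rightarrow> (nat \<Rightarrow> 'w \<Rightarrow> ennreal) \<Rightarrow> bool" where
  "tends_to_zero_in_prob P Y \<longleftrightarrow>
     (\<forall>n. prob_space (P n) \<and> Y n \<in> borel_measurable (P n)) \<and>
     (\<forall>\<epsilon>::real. \<epsilon> > 0 \<longrightarrow>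
        (\<lambda>n. measure (P n) {w \<in> space (P n). Y n w > ennreal \<epsilon>}) \<longlonglongrightarrow> 0)"

end

theory Submission
  imports Defs "HOL-Real_Asymp.Real_Asymp"
begin

text \<open>
  Under \<open>P\<^sub>W\<^sup>n(\<cdot>|\<theta>\<^sub>0,f\<^sub>0)\<close> the centred Fourier data \<open>y\<^sub>m\<close> are independent centred Gaussian
  variables with variances \<open>D\<^sub>m(f\<^sub>0)\<close>, because the real Fourier matrix is orthogonal.  With
  \<open>h = \<theta> - \<theta>\<^sub>0\<close>, \<open>x\<^sub>m\<close> the rows of the transformed design and
  \<open>w\<^sub>m(f) = 1 / D\<^sub>m(f) - 1 / D\<^sub>m(f\<^sub>0)\<close>, the remainder is
  \<open>h \<bullet> \<Sum>\<^sub>m w\<^sub>m(f) y\<^sub>m x\<^sub>m - 1/2 \<Sum>\<^sub>m w\<^sub>m(f) (x\<^sub>m \<bullet> h)\<^sup>2\<close>.  The quadratic part is at most a multiple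
  of \<open>(h \<bullet> S\<^sub>n h) / log n\<close>.

  The linear part is controlled uniformly in \<open>f\<close> by second moments alone.  The weights satisfy
  \<open>|w\<^sub>m| \<le> A\<close> with \<open>A\<close> of order \<open>1 / log n\<close> and \<open>|w\<^sub>m\<^sub>+\<^sub>1 - w\<^sub>m| \<le> \<Delta>\<close> with \<open>\<Delta>\<close> of order \<open>1 / n\<close>.
  Summation by parts inside blocks of length \<open>L\<close> therefore bounds
  \<open>\<parallel>\<Sum>\<^sub>m w\<^sub>m y\<^sub>m x\<^sub>m\<parallel>\<^sup>2\<close> by a statistic that does not depend on \<open>f\<close> and whose expectation is of
  order \<open>n (A\<^sup>2 n / L + \<Delta>\<^sup>2 n L)\<close>.  For \<open>L\<close> of order \<open>n / log n\<close> this is \<open>o(n)\<close>, and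
  \<open>S\<^sub>n\<close> is bounded below by a multiple of \<open>n\<close>.
\<close>

section \<open>Symmetric matrices\<close>

lemma symmetric_matrix_inner:
  fixes A :: "real ^ 'n ^ 'n"
  assumes "transpose A = A"
  shows "x \<bullet> (A *v y) = (A *v x) \<bullet> y"
  using dot_lmul_matrix[of x A y] transpose_matrix_vector[of A x] assms by simp

lemma symmetric_matrixI:
  fixes A :: "real ^ 'n ^ 'n"
  assumes "\<And>x y. x \<bullet> (A *v y) = (A *v x) \<bullet> y"
  shows "transpose A = A"
proof -
  have "x \<bullet> (transpose A *v y) = x \<bullet> (A *v y)" for x y
    by (metis assms dot_lmul_matrix transpose_matrix_vector inner_commute)
  then have "transpose A *v y = A *v y" for y
    using vector_eq_ldot by blast
  then show ?thesis
    unfolding matrix_eq by blast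
qed

text \<open>The quadratic form attains a maximum on the unit sphere of \<open>W\<close>, and the
  maximiser is an eigenvector: otherwise a move along the residual
  \<open>A *v v - l *\<^sub>R v\<close> would exceed the maximum. Allowing an invariant
  \<open>W\<close> lets the result be reapplied on the orthogonal complement of eigenvectors already
  found.\<close>

lemma rayleigh_quotient_max:
  fixes A :: "real ^ 'n ^ 'n"
  assumes sym: "transpose A = A" and W: "subspace W" "W \<noteq> {0}"
    and inv: "\<And>w. w \<in> W \<Longrightarrow> A *v w \<in> W"
  obtains v l where "v \<in> W" "norm v = 1" "A *v v = l *\<^sub>R v"
    "\<And>w. w \<in> W \<Longrightarrow> w \<bullet> (A *v w) \<le> l * (w \<bullet> w)"
proof -
  obtain w0 where w0: "w0 \<in> W" "w0 \<noteq> 0"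
    using W subspace_0 by blast
  have ne: "W \<inter> sphere 0 1 \<noteq> {}"
    using w0 W(1) by (intro ex_in_conv[THEN iffD1] exI[of _ "w0 /\<^sub>R norm w0"]) (auto intro: subspace_scale)
  have "compact (W \<inter> sphere 0 1)"
    using closed_subspace[OF W(1)] by (simp add: closed_Int_compact)
  moreover have "continuous_on (W \<inter> sphere 0 1) (\<lambda>w. w \<bullet> (A *v w))"
    by (intro continuous_intros linear_continuous_on_compose[OF continuous_on_id]) simp
  ultimately obtain v where v': "v \<in> W \<inter> sphere 0 1"
    and max': "\<forall>w\<in>W \<inter> sphere 0 1. w \<bullet> (A *v w) \<le> v \<bullet> (A *v v)"
    using continuous_attains_sup[OF _ ne] by blast
  have v: "v \<in> W" "norm v = 1"
    and max: "\<And>w. w \<in> W \<Longrightarrow> norm w = 1 \<Longrightarrow> w \<bullet> (A *v w) \<le> v \<bullet> (A *v v)"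
    using v' max' by auto
  define l where "l = v \<bullet> (A *v v)"
  have bound: "w \<bullet> (A *v w) \<le> l * (w \<bullet> w)" if "w \<in> W" for w
  proof (cases "w = 0")
    case False
    let ?u = "w /\<^sub>R norm w"
    have "?u \<bullet> (A *v ?u) \<le> l"
      unfolding l_def using False that W(1) by (intro max) (auto intro: subspace_scale)
    moreover have "?u \<bullet> (A *v ?u) = (w \<bullet> (A *v w)) / (w \<bullet> w)"
      by (simp add: matrix_vector_mult_scaleR dot_square_norm power2_eq_square divide_simps)
    ultimately show ?thesis
      using False by (simp add: divide_le_eq)
  qed simp
  define u where "u = A *v v - l *\<^sub>R v"
  define c where "c = u \<bullet> (A *v u) - l * (u \<bullet> u)"
  have u: "u \<in> W"
    unfolding u_def using v W inv by (intro subspace_diff subspace_scale) auto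
  have c: "c \<le> 0"
    using bound[OF u] by (simp add: c_def)
  have vv: "v \<bullet> v = 1"
    using v by (simp add: dot_square_norm)
  have "u = 0"
  proof (rule ccontr)
    assume "u \<noteq> 0"
    then have uu: "u \<bullet> u > 0" by simp
    \<comment> \<open>With this \<open>t\<close> one has \<open>t * c = t - u \<bullet> u\<close>,
      so \<open>2 * (u \<bullet> u) + t * c\<close> equals \<open>u \<bullet> u + t\<close>, which
      is positive. The denominator is at least 1 because \<open>c \<le> 0\<close>.\<close>
    define t where "t = (u \<bullet> u) / (1 - c)"
    have t: "t > 0" using uu c by (simp add: t_def)
    have "(v + t *\<^sub>R u) \<bullet> (A *v (v + t *\<^sub>R u)) \<le> l * ((v + t *\<^sub>R u) \<bullet> (v + t *\<^sub>R u))"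
      using v u W by (intro bound subspace_add subspace_scale) auto
    moreover have "v \<bullet> (A *v u) = u \<bullet> (A *v v)"
      by (simp add: symmetric_matrix_inner[OF sym, of v] inner_commute)
    moreover have "u \<bullet> (A *v v) = u \<bullet> u + l * (u \<bullet> v)"
      by (simp add: u_def algebra_simps)
    ultimately have "2 * t * (u \<bullet> u) + t\<^sup>2 * c \<le> 0"
      by (simp add: matrix_vector_right_distrib matrix_vector_mult_scaleR inner_add_left inner_add_right
          c_def l_def[symmetric] vv inner_commute algebra_simps power2_eq_square)
    then have "t * (2 * (u \<bullet> u) + t * c) \<le> 0"
      by (simp add: algebra_simps power2_eq_square)
    then have "2 * (u \<bullet> u) + t * c \<le> 0"
      using t by (simp add: mult_le_0_iff)
    moreover have "t * (1 - c) = u \<bullet> u" using c by (simp add: t_def)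
    ultimately show False using uu t by (simp add: algebra_simps)
  qed
  then show thesis
    using that[of v l] v bound by (simp add: u_def)
qed

text \<open>Eigenvectors for distinct eigenvalues of a symmetric matrix are orthogonal, hence
  independent. Finiteness is what makes the \<open>Min\<close> and \<open>Max\<close> in
  \<open>lambda_min\<close> and \<open>lambda_max\<close> bound the eigenvalues.\<close>

lemma finite_eigenvalues:
  fixes A :: "real ^ 'n ^ 'n"
  assumes sym: "transpose A = A"
  shows "finite (eigenvalues A)"
proof -
  have "\<forall>l\<in>eigenvalues A. \<exists>v. v \<noteq> 0 \<and> A *v v = l *\<^sub>R v"
    by (auto simp: eigenvalues_def)
  then obtain v where v: "\<And>l. l \<in> eigenvalues A \<Longrightarrow> v l \<noteq> 0 \<and> A *v v l = l *\<^sub>R v l"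
    by metis
  have orth: "v l \<bullet> v m = 0" if "l \<in> eigenvalues A" "m \<in> eigenvalues A" "l \<noteq> m" for l m
    using symmetric_matrix_inner[OF sym, of "v l" "v m"] v that by auto
  have inj: "inj_on v (eigenvalues A)"
    using orth v by (intro inj_onI) force
  have "pairwise orthogonal (v ` eigenvalues A)"
    using orth by (auto simp: pairwise_def orthogonal_def)
  moreover have "0 \<notin> v ` eigenvalues A"
    using v by force
  ultimately have "independent (v ` eigenvalues A)"
    by (rule pairwise_orthogonal_independent)
  then have "finite (v ` eigenvalues A)"
    using independent_bound by blast
  then show ?thesis
    using inj finite_imageD by blast
qed

lemma lambda_max_bound:
  fixes A :: "real ^ 'n ^ 'n"
  assumes sym: "transpose A = A"
  shows "w \<bullet> (A *v w) \<le> lambda_max A * (w \<bullet> w)"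
proof -
  obtain v l where v: "norm v = 1" "A *v v = l *\<^sub>R v"
    "\<And>w. w \<bullet> (A *v w) \<le> l * (w \<bullet> w)"
    using rayleigh_quotient_max[OF sym subspace_UNIV] UNIV_not_singleton by (metis UNIV_I)
  then have "l \<in> eigenvalues A"
    unfolding eigenvalues_def by (intro CollectI exI[of _ v]) auto
  then have "l \<le> lambda_max A"
    unfolding lambda_max_def using finite_eigenvalues[OF sym] by simp
  then show ?thesis
    using v(3)[of w] by (meson inner_ge_zero mult_right_mono order_trans)
qed

text \<open>The largest Rayleigh quotient of \<open>- A\<close> is minus the smallest one of
  \<open>A\<close>.\<close>

lemma lambda_min_bound:
  fixes A :: "real ^ 'n ^ 'n"
  assumes sym: "transpose A = A"
  shows "lambda_min A * (w \<bullet> w) \<le> w \<bullet> (A *v w)"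
proof -
  have neg: "(- A) *v x = - (A *v x)" for x
    by (simp add: vec_eq_iff matrix_vector_mult_def sum_negf)
  have sym': "transpose (- A) = - A"
    using sym by (simp add: transpose_def vec_eq_iff)
  obtain v l where v: "norm v = 1" "(- A) *v v = l *\<^sub>R v"
    "\<And>w. w \<bullet> ((- A) *v w) \<le> l * (w \<bullet> w)"
    using rayleigh_quotient_max[OF sym' subspace_UNIV] UNIV_not_singleton by (metis UNIV_I)
  have "A *v v = (- l) *\<^sub>R v"
    using v(2) unfolding neg by (metis minus_minus scaleR_minus_left)
  then have "- l \<in> eigenvalues A"
    using v(1) unfolding eigenvalues_def by (intro CollectI exI[of _ v]) auto
  then have "lambda_min A \<le> - l"
    unfolding lambda_min_def using finite_eigenvalues[OF sym] by simp
  then have "lambda_min A * (w \<bullet> w) \<le> - l * (w \<bullet> w)"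
    by (intro mult_right_mono) auto
  then show ?thesis
    using v(3)[of w] unfolding neg by simp
qed

text \<open>By symmetry the orthogonal complement of the eigenvectors found so far is invariant, and
  it is nonzero as long as there are fewer than \<open>CARD('n)\<close> of them, so it contains a
  further unit eigenvector.\<close>

lemma orthonormal_eigenvectors:
  fixes A :: "real ^ 'n ^ 'n"
  assumes sym: "transpose A = A" and "k \<le> CARD('n)"
  shows "\<exists>E. card E = k \<and> finite E \<and> pairwise orthogonal E \<and> (\<forall>v\<in>E. norm v = 1 \<and> (\<exists>l. A *v v = l *\<^sub>R v))"
  using assms(2)
proof (induction k)
  case 0
  show ?case by (intro exI[of _ "{}"]) auto
next
  case (Suc k)
  then obtain E where E: "card E = k" "finite E" "pairwise orthogonal E"
    "\<And>v. v \<in> E \<Longrightarrow> norm v = 1" "\<And>v. v \<in> E \<Longrightarrow> \<exists>l. A *v v = l *\<^sub>R v"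
    by auto
  define W where "W = {w. \<forall>v\<in>E. orthogonal v w}"
  have W: "subspace W"
    unfolding W_def by (auto simp: subspace_def orthogonal_def inner_add_right)
  have "dim (span E) < DIM(real ^ 'n)"
    using dim_le_card'[OF E(2)] E(1) Suc.prems by simp
  then obtain x where x: "x \<noteq> 0" "\<And>y. y \<in> span E \<Longrightarrow> orthogonal x y"
    using orthogonal_to_subspace_exists by (metis dim_span span_span)
  then have "x \<in> W"
    unfolding W_def using span_base by (auto simp: orthogonal_commute)
  then have "W \<noteq> {0}" using x by auto
  moreover have "A *v w \<in> W" if "w \<in> W" for w
    unfolding W_def
  proof (intro CollectI ballI)
    fix v assume v: "v \<in> E"
    then obtain l where "A *v v = l *\<^sub>R v" using E(5) by auto
    then show "orthogonal v (A *v w)"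
      using that v symmetric_matrix_inner[OF sym, of v w] by (simp add: W_def orthogonal_def)
  qed
  ultimately obtain v l where v: "v \<in> W" "norm v = 1" "A *v v = l *\<^sub>R v"
    using rayleigh_quotient_max[OF sym W] by metis
  have "v \<notin> E"
    using v by (auto simp: W_def orthogonal_def)
  moreover have "pairwise orthogonal (insert v E)"
    using E(3) v(1) by (auto simp: pairwise_insert W_def orthogonal_commute)
  ultimately show ?case
    using E v by (intro exI[of _ "insert v E"]) auto
qed

lemma spectral_decomposition:
  fixes A :: "real ^ 'n ^ 'n"
  assumes sym: "transpose A = A"
  obtains E l where "finite E" "\<And>v w. v \<in> E \<Longrightarrow> w \<in> E \<Longrightarrow> v \<bullet> w = (if v = w then 1 else 0)"
    "\<And>v. v \<in> E \<Longrightarrow> A *v v = l v *\<^sub>R v" "\<And>x. x = (\<Sum>v\<in>E. (v \<bullet> x) *\<^sub>R v)"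
proof -
  obtain E where E: "card E = CARD('n)" "finite E" "pairwise orthogonal E"
    "\<And>v. v \<in> E \<Longrightarrow> norm v = 1" "\<And>v. v \<in> E \<Longrightarrow> \<exists>l. A *v v = l *\<^sub>R v"
    using orthonormal_eigenvectors[OF sym, of "CARD('n)"] by auto
  have ip: "v \<bullet> w = (if v = w then 1 else 0)" if "v \<in> E" "w \<in> E" for v w
    using E(3,4) that by (auto simp: pairwise_def orthogonal_def dot_square_norm)
  obtain l where l: "\<And>v. v \<in> E \<Longrightarrow> A *v v = l v *\<^sub>R v"
    using E(5) by metis
  have "independent E"
    using E(3,4) by (intro pairwise_orthogonal_independent) force+
  then have span: "span E = UNIV"
    using E(1) by (simp add: dim_eq_full[symmetric] dim_eq_card_independent)
  have expand: "x = (\<Sum>v\<in>E. (v \<bullet> x) *\<^sub>R v)" for x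
  proof -
    \<comment> \<open>The error of the expansion is orthogonal to \<open>E\<close>, hence to the
      whole space and in particular to itself.\<close>
    let ?u = "x - (\<Sum>v\<in>E. (v \<bullet> x) *\<^sub>R v)"
    have "orthogonal ?u w" if "w \<in> E" for w
      using that E(2) by (simp add: orthogonal_def inner_diff_left inner_sum_left ip[OF _ that] if_distrib
          inner_commute[of x] sum.delta cong: if_cong)
    then have "orthogonal ?u y" if "y \<in> span E" for y
      using that orthogonal_to_span by blast
    then have "orthogonal ?u ?u" using span by simp
    then show ?thesis by (simp add: orthogonal_self)
  qed
  show thesis using that[OF E(2) ip l expand] by blast
qed

section \<open>Positive definite square roots: existence, uniqueness and inversion\<close>

lemma sym_pos_def_nonneg:
  fixes A :: "real ^ 'n ^ 'n"
  assumes "sym_pos_def A"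
  shows "0 \<le> v \<bullet> (A *v v)"
proof (cases "v = 0")
  case False
  then show ?thesis using assms by (simp add: sym_pos_def_def less_imp_le)
qed simp

text \<open>On an orthonormal eigenbasis the root multiplies each eigenvector by the square root of
  its eigenvalue; \<open>h\<close> is this linear map.\<close>

lemma sym_pos_def_sqrt_exists:
  fixes A :: "real ^ 'n ^ 'n"
  assumes A: "sym_pos_def A"
  shows "\<exists>B. sym_pos_def B \<and> B ** B = A"
proof -
  have sym: "transpose A = A" and pos: "\<And>v. v \<noteq> 0 \<Longrightarrow> v \<bullet> (A *v v) > 0"
    using A by (auto simp: sym_pos_def_def)
  obtain E l where E: "finite E" "\<And>v w. v \<in> E \<Longrightarrow> w \<in> E \<Longrightarrow> v \<bullet> w = (if v = w then 1 else 0)"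
    "\<And>v. v \<in> E \<Longrightarrow> A *v v = l v *\<^sub>R v" and ex: "\<And>x. x = (\<Sum>v\<in>E. (v \<bullet> x) *\<^sub>R v)"
    using spectral_decomposition[OF sym] by blast
  have l: "l v > 0" if "v \<in> E" for v
    using pos[of v] E(2)[OF that that] E(3)[OF that] by force
  define h where "h x = (\<Sum>v\<in>E. (sqrt (l v) * (v \<bullet> x)) *\<^sub>R v)" for x
  have lin: "linear h"
    unfolding h_def by (intro linearI) (simp_all add: inner_add_right algebra_simps sum.distrib scaleR_sum_right)
  have matrix_h: "matrix h *v x = h x" for x
    using matrix_vector_mul(2)[OF lin] by metis
  have hv: "v \<bullet> h x = sqrt (l v) * (v \<bullet> x)" if "v \<in> E" for v x
    using that E(1) by (simp add: h_def inner_sum_right E(2) if_distrib sum.delta' cong: if_cong)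
  have hip: "x \<bullet> h y = (\<Sum>v\<in>E. sqrt (l v) * (v \<bullet> x) * (v \<bullet> y))" for x y
    by (simp add: h_def inner_sum_right inner_commute mult.commute mult.left_commute)
  have "transpose (matrix h) = matrix h"
    by (rule symmetric_matrixI)
      (simp add: matrix_h inner_commute[of "h _"] hip mult.commute mult.left_commute)
  moreover have "x \<bullet> h x > 0" if "x \<noteq> 0" for x
  proof -
    have "\<exists>v\<in>E. v \<bullet> x \<noteq> 0"
      using ex[of x] that by (metis (no_types, lifting) scaleR_zero_left sum.neutral)
    then obtain w where "w \<in> E" "w \<bullet> x \<noteq> 0" by blast
    then show ?thesis
      unfolding hip mult.assoc using E(1) l
      by (intro sum_pos2[of _ w]) (auto simp: less_imp_le zero_less_mult_iff linorder_neq_iff)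
  qed
  moreover have "matrix h ** matrix h = A"
  proof -
    have "h (h x) = A *v x" for x
    proof -
      have "h (h x) = (\<Sum>v\<in>E. (sqrt (l v) * (sqrt (l v) * (v \<bullet> x))) *\<^sub>R v)"
        unfolding h_def[of "h x"] by (rule sum.cong) (simp_all add: hv)
      also have "\<dots> = (\<Sum>v\<in>E. (v \<bullet> x) *\<^sub>R (A *v v))"
        using l by (intro sum.cong refl) (simp add: E(3) less_imp_le flip: mult.assoc)
      also have "\<dots> = A *v (\<Sum>v\<in>E. (v \<bullet> x) *\<^sub>R v)"
        by (simp add: scaleR_matrix_vector_assoc[symmetric] matrix_vector_mult_scaleR vec.sum)
      also have "\<dots> = A *v x"
        by (rule arg_cong[where f = "\<lambda>y. A *v y", OF ex[of x, symmetric]])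
      finally show ?thesis .
    qed
    then show ?thesis
      by (simp add: matrix_eq matrix_vector_mul_assoc[symmetric] matrix_h)
  qed
  ultimately show ?thesis
    by (intro exI[of _ "matrix h"]) (simp add: sym_pos_def_def matrix_h)
qed

text \<open>The vectors \<open>D *v axis i 1\<close> are the columns of \<open>D\<close>. For
  positive definite \<open>B\<close> every summand is nonnegative, so a vanishing trace forces each
  column to vanish.\<close>

lemma trace_conjugate_symmetric:
  fixes D B :: "real ^ 'n ^ 'n"
  assumes "transpose D = D"
  shows "trace (D ** B ** D) = (\<Sum>i\<in>UNIV. (D *v axis i 1) \<bullet> (B *v (D *v axis i 1)))"
proof -
  have "(D ** B ** D) $ i $ i = (D *v axis i 1) \<bullet> (B *v (D *v axis i 1))" for i
  proof -
    have "(D ** B ** D) $ i $ i = axis i 1 \<bullet> ((D ** B ** D) *v axis i 1)"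
      by (simp add: inner_axis' matrix_vector_mul_component inner_axis)
    then show ?thesis
      by (simp add: matrix_vector_mul_assoc[symmetric] symmetric_matrix_inner[OF assms])
  qed
  then show ?thesis by (simp add: trace_def)
qed

text \<open>If \<open>B\<^sup>2 = C\<^sup>2\<close> then \<open>D = B - C\<close> satisfies \<open>BD + DC = 0\<close>, so the positive
  semidefinite matrices \<open>DBD\<close> and \<open>DCD\<close> have traces with sum zero.\<close>

lemma sym_pos_def_sqrt_unique:
  fixes B C :: "real ^ 'n ^ 'n"
  assumes B: "sym_pos_def B" and C: "sym_pos_def C" and eq: "B ** B = C ** C"
  shows "B = C"
proof -
  define D where "D = B - C"
  have sub: "(P - Q) ** R = P ** R - Q ** R" "R ** (P - Q) = R ** P - R ** Q" for P Q R :: "real ^ 'n ^ 'n"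
    by (simp_all add: vec_eq_iff matrix_matrix_mult_def algebra_simps sum_subtractf)
  have sym: "transpose D = D"
    using B C by (simp add: D_def sym_pos_def_def transpose_def vec_eq_iff)
  have "B ** D + D ** C = 0"
    by (simp add: D_def sub eq)
  moreover have DD0: "D ** 0 = 0"
    by (simp add: vec_eq_iff matrix_matrix_mult_def)
  ultimately have "D ** B ** D + D ** D ** C = 0"
    by (metis matrix_add_ldistrib matrix_mul_assoc DD0)
  \<comment> \<open>Cyclicity of the trace turns \<open>D ** D ** C\<close> into the conjugate form
    \<open>D ** C ** D\<close>.\<close>
  then have "trace (D ** B ** D) + trace (D ** C ** D) = 0"
    using trace_mul_sym[of D "D ** C"] trace_add[of "D ** B ** D" "D ** D ** C"]
    by (simp add: matrix_mul_assoc) (simp add: trace_def)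
  then have z: "(\<Sum>i\<in>UNIV. (D *v axis i 1) \<bullet> (B *v (D *v axis i 1)) + (D *v axis i 1) \<bullet> (C *v (D *v axis i 1))) = 0"
    unfolding trace_conjugate_symmetric[OF sym] sum.distrib .
  have nn: "v \<bullet> (B *v v) \<ge> 0" "v \<bullet> (C *v v) \<ge> 0" for v
    using sym_pos_def_nonneg B C by auto
  have "D *v axis i 1 = 0" for i
  proof (rule ccontr)
    assume ne: "D *v axis i 1 \<noteq> 0"
    have "(D *v axis i 1) \<bullet> (B *v (D *v axis i 1)) + (D *v axis i 1) \<bullet> (C *v (D *v axis i 1)) = 0"
      using z nn by (subst (asm) sum_nonneg_eq_0_iff) auto
    moreover have "(D *v axis i 1) \<bullet> (B *v (D *v axis i 1)) > 0"
      using B ne by (simp add: sym_pos_def_def)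
    ultimately show False using nn(2)[of "D *v axis i 1"] by simp
  qed
  then have "D = 0"
    by (simp add: vec_eq_iff matrix_vector_mul_component inner_axis)
  then show ?thesis by (simp add: D_def)
qed

lemma mat_sqrt:
  fixes A :: "real ^ 'n ^ 'n"
  assumes "sym_pos_def A"
  shows "sym_pos_def (mat_sqrt A)" "mat_sqrt A ** mat_sqrt A = A"
proof -
  have "\<exists>!B. sym_pos_def B \<and> B ** B = A"
    using sym_pos_def_sqrt_exists[OF assms] sym_pos_def_sqrt_unique by blast
  then have "sym_pos_def (mat_sqrt A) \<and> mat_sqrt A ** mat_sqrt A = A"
    unfolding mat_sqrt_def by (rule theI')
  then show "sym_pos_def (mat_sqrt A)" "mat_sqrt A ** mat_sqrt A = A" by auto
qed

lemma sym_pos_def_matrix_inv: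
  fixes A :: "real ^ 'n ^ 'n"
  assumes "sym_pos_def A"
  shows "A *v (matrix_inv A *v u) = u"
proof -
  have "\<forall>x. A *v x = 0 \<longrightarrow> x = 0"
    using assms by (force simp: sym_pos_def_def)
  then have "invertible A"
    using matrix_left_invertible_ker invertible_left_inverse by blast
  then have "A ** matrix_inv A = mat 1"
    unfolding invertible_def matrix_inv_def by (rule someI2_ex) simp
  then show ?thesis
    by (simp add: matrix_vector_mul_assoc)
qed

section \<open>The real Fourier matrix\<close>

text \<open>This keeps the lower bound of index ranges \<open>{1..n}\<close> from being rewritten to
  \<open>Suc 0\<close>.\<close>

declare One_nat_def [simp del]

text \<open>A full geometric sum over powers of an n-th root of unity, which vanishes unless the
  root is 1. The index \<open>k\<close> is an integer because differences of frequency indices are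
  inserted for it.\<close>

lemma sum_cis_frequency:
  fixes k :: int
  assumes "n > 0"
  shows "(\<Sum>t=1..n. cis (2 * pi * of_int k * real t / real n)) = (if int n dvd k then of_nat n else 0)"
proof -
  define z where "z = cis (2 * pi * of_int k / real n)"
  have pow: "cis (2 * pi * of_int k * real t / real n) = z ^ t" for t
    by (simp add: z_def Complex.DeMoivre mult_ac)
  have z1: "z ^ n = 1"
    using assms cis_multiple_2pi[of "of_int k"] by (simp add: z_def Complex.DeMoivre)
  have "(\<Sum>t=1..n. z ^ t) = z * (\<Sum>t<n. z ^ t)"
    by (simp add: One_nat_def sum.atLeast1_atMost_eq sum_distrib_left)
  moreover have "z = 1 \<longleftrightarrow> int n dvd k"
  proof
    assume "z = 1"
    then have "cos (2 * pi * of_int k / real n) = 1"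
      by (simp add: z_def complex_eq_iff)
    then obtain i :: int where "2 * pi * of_int k / real n = of_int i * 2 * pi"
      using cos_one_2pi_int by blast
    then have "real_of_int k = of_int (i * int n)"
      using assms by (simp add: field_simps)
    then show "int n dvd k" by (simp only: of_int_eq_iff) simp
  next
    assume "int n dvd k"
    then obtain i where "k = int n * i" by (auto simp: dvd_def)
    then have "2 * pi * of_int k / real n = 2 * pi * of_int i"
      using assms by simp
    then have "z = cis (2 * pi * of_int i)"
      unfolding z_def by (rule arg_cong)
    then show "z = 1"
      using cis_multiple_2pi[OF Ints_of_int] by metis
  qed
  moreover have "(\<Sum>t<n. z ^ t) = 0" if "z \<noteq> 1"
    using that z1 by (simp add: sum_gp_strict)
  ultimately show ?thesis
    by (auto simp: pow)
qed

lemma sum_cos_frequency: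
  fixes k :: int
  assumes "n > 0"
  shows "(\<Sum>t=1..n. cos (2 * pi * of_int k * real t / real n)) = (if int n dvd k then real n else 0)"
  using arg_cong[OF sum_cis_frequency[OF assms, of k], of Re] by (simp split: if_splits)

lemma sum_sin_frequency:
  fixes k :: int
  assumes "n > 0"
  shows "(\<Sum>t=1..n. sin (2 * pi * of_int k * real t / real n)) = 0"
  using arg_cong[OF sum_cis_frequency[OF assms, of k], of Im] by (simp split: if_splits)

section \<open>Discrete orthogonality relations at the Fourier frequencies\<close>

lemma fourier_freq_combine:
  "fourier_freq n j * real t - fourier_freq n k * real t = 2 * pi * of_int (int j - int k) * real t / real n"
  "fourier_freq n j * real t + fourier_freq n k * real t = 2 * pi * of_int (int j + int k) * real t / real n"
  by (simp_all add: fourier_freq_def algebra_simps diff_divide_distrib add_divide_distrib)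

text \<open>Indices up to \<open>n / 2\<close> have a difference smaller than \<open>n\<close> in
  absolute value and a sum of at most \<open>n\<close>, so 0 and \<open>n\<close> are the only
  multiples of \<open>n\<close> that can occur.\<close>

lemma frequency_index_dvd:
  assumes "n > 0" "2 * j \<le> n" "2 * k \<le> n"
  shows "int n dvd int j - int k \<longleftrightarrow> j = k"
    "int n dvd int j + int k \<longleftrightarrow> j = k \<and> (j = 0 \<or> 2 * j = n)"
proof -
  show "int n dvd int j - int k \<longleftrightarrow> j = k"
  proof
    assume "int n dvd int j - int k"
    moreover have "\<bar>int j - int k\<bar> < int n" using assms by linarith
    ultimately show "j = k"
      by (metis dvd_imp_le_int eq_iff_diff_eq_0 nat_int not_le abs_of_nat)
  qed simp
  show "int n dvd int j + int k \<longleftrightarrow> j = k \<and> (j = 0 \<or> 2 * j = n)"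
  proof
    assume "int n dvd int j + int k"
    then have "n dvd j + k" by (metis int_dvd_int_iff of_nat_add)
    then have "j + k = 0 \<or> n \<le> j + k" using dvd_imp_le by blast
    then show "j = k \<and> (j = 0 \<or> 2 * j = n)" using assms by linarith
  qed (auto simp flip: of_nat_add mult_2)
qed

text \<open>At the frequencies 0 and \<open>pi\<close> both divisibility conditions hold and the sum
  doubles; this is why the corresponding rows of the Fourier matrix carry no factor
  \<open>sqrt 2\<close>.\<close>

lemma sum_cos_cos_frequency:
  assumes "n > 0" "2 * j \<le> n" "2 * k \<le> n"
  shows "(\<Sum>t=1..n. cos (fourier_freq n j * real t) * cos (fourier_freq n k * real t)) =
    (if j = k then if j = 0 \<or> 2 * j = n then real n else real n / 2 else 0)"
  unfolding cos_times_cos fourier_freq_combine sum_divide_distrib[symmetric] sum.distrib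
    sum_cos_frequency[OF assms(1)] frequency_index_dvd[OF assms]
  by simp

lemma sum_sin_sin_frequency:
  assumes "n > 0" "2 * j \<le> n" "2 * k \<le> n"
  shows "(\<Sum>t=1..n. sin (fourier_freq n j * real t) * sin (fourier_freq n k * real t)) =
    (if j = k \<and> j \<noteq> 0 \<and> 2 * j \<noteq> n then real n / 2 else 0)"
  unfolding sin_times_sin fourier_freq_combine sum_divide_distrib[symmetric] sum_subtractf
    sum_cos_frequency[OF assms(1)] frequency_index_dvd[OF assms]
  by simp

lemma sum_sin_cos_frequency:
  assumes "n > 0"
  shows "(\<Sum>t=1..n. sin (fourier_freq n j * real t) * cos (fourier_freq n k * real t)) = 0"
  unfolding sin_times_cos fourier_freq_combine sum_divide_distrib[symmetric] sum.distrib
    sum_sin_frequency[OF assms(1)]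
  by simp

lemma fourier_mat_altdef:
  "fourier_mat n m t =
    (if m = 1 \<or> (even n \<and> m = n) then cos (fourier_freq n (m div 2) * real t) / sqrt n
     else if even m then sqrt 2 * cos (fourier_freq n (m div 2) * real t) / sqrt n
     else - sqrt 2 * sin (fourier_freq n (m div 2) * real t) / sqrt n)"
proof -
  have "fourier_vec n j t = cis (- (fourier_freq n j * real t)) / complex_of_real (sqrt n)" for j
  proof -
    have "exp (- \<i> * complex_of_real (fourier_freq n j)) = cis (- fourier_freq n j)"
      by (simp add: cis_conv_exp)
    then show ?thesis
      by (simp add: fourier_vec_def Complex.DeMoivre mult.commute)
  qed
  then show ?thesis
    by (simp add: fourier_mat_def Re_divide_of_real Im_divide_of_real)
qed

lemma fourier_mat_rows_orthonormal:
  assumes "m \<in> {1..n}" "l \<in> {1..n}"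
  shows "(\<Sum>t=1..n. fourier_mat n m t * fourier_mat n l t) = (if m = l then 1 else 0)"
proof -
  have n: "n > 0" using assms by auto
  \<comment> \<open>\<open>S\<close> marks the rows of frequency 0 and \<open>pi\<close>, which lack
    the factor \<open>sqrt 2\<close>, and \<open>C\<close> marks all cosine rows. Among the cosine
    rows, and likewise among the sine rows, \<open>m div 2\<close> determines \<open>m\<close>, so
    orthogonality of rows reduces to that of frequencies.\<close>
  define S where "S m \<longleftrightarrow> m = 1 \<or> (even n \<and> m = n)" for m :: nat
  define C where "C m \<longleftrightarrow> m = 1 \<or> even m" for m :: nat
  define a where "a m = (if S m then 1 / sqrt n else if C m then sqrt 2 / sqrt n else - sqrt 2 / sqrt n)" for m
  have F: "fourier_mat n m t = a m * (if C m then cos (fourier_freq n (m div 2) * real t)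
      else sin (fourier_freq n (m div 2) * real t))" for m t
    unfolding fourier_mat_altdef a_def S_def C_def by auto
  have le: "2 * (i div 2) \<le> n" if "i \<in> {1..n}" for i
    using that by auto
  have special: "S i \<longleftrightarrow> i div 2 = 0 \<or> 2 * (i div 2) = n" if "C i" "i \<in> {1..n}" for i
    using that unfolding S_def C_def atLeastAtMost_iff by presburger
  have nonspecial: "i div 2 \<noteq> 0 \<and> 2 * (i div 2) \<noteq> n \<and> \<not> S i" if "\<not> C i" "i \<in> {1..n}" for i
    using that unfolding S_def C_def atLeastAtMost_iff by presburger
  have eq: "m div 2 = l div 2 \<longleftrightarrow> m = l" if "C m = C l"
    using that assms unfolding C_def atLeastAtMost_iff by presburger
  have a2: "a i * a i = (if S i then 1 / n else 2 / n)" for i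
    using n by (simp add: a_def)
  consider "C m" "C l" | "C m" "\<not> C l" | "\<not> C m" "C l" | "\<not> C m" "\<not> C l" by blast
  then show ?thesis
  proof cases
    case 1
    have "(\<Sum>t=1..n. fourier_mat n m t * fourier_mat n l t) = a m * a l *
       (\<Sum>t=1..n. cos (fourier_freq n (m div 2) * real t) * cos (fourier_freq n (l div 2) * real t))"
      unfolding F sum_distrib_left using 1 by (intro sum.cong) auto
    then show ?thesis
      using 1 n assms le eq special a2[of l] by (simp add: sum_cos_cos_frequency)
  next
    case 2
    have "(\<Sum>t=1..n. fourier_mat n m t * fourier_mat n l t) = a m * a l *
       (\<Sum>t=1..n. sin (fourier_freq n (l div 2) * real t) * cos (fourier_freq n (m div 2) * real t))"
      unfolding F sum_distrib_left using 2 by (intro sum.cong) auto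
    then show ?thesis
      using 2 n by (auto simp: sum_sin_cos_frequency)
  next
    case 3
    have "(\<Sum>t=1..n. fourier_mat n m t * fourier_mat n l t) = a m * a l *
       (\<Sum>t=1..n. sin (fourier_freq n (m div 2) * real t) * cos (fourier_freq n (l div 2) * real t))"
      unfolding F sum_distrib_left using 3 by (intro sum.cong) auto
    then show ?thesis
      using 3 n by (auto simp: sum_sin_cos_frequency)
  next
    case 4
    have "(\<Sum>t=1..n. fourier_mat n m t * fourier_mat n l t) = a m * a l *
       (\<Sum>t=1..n. sin (fourier_freq n (m div 2) * real t) * sin (fourier_freq n (l div 2) * real t))"
      unfolding F sum_distrib_left using 4 by (intro sum.cong) auto
    then show ?thesis
      using 4 n assms le eq nonspecial a2[of l] by (simp add: sum_sin_sin_frequency)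
  qed
qed

text \<open>With \<open>Q = F\<^sup>T F\<close> the squared Hilbert-Schmidt norm of \<open>I - Q\<close> is
  \<open>n - 2 tr(Q) + tr(Q\<^sup>2) = n - 2 n + n = 0\<close>.\<close>

lemma orthonormal_rows_imp_columns:
  fixes F :: "nat \<Rightarrow> nat \<Rightarrow> real"
  assumes rows: "\<And>m l. m \<in> {1..n} \<Longrightarrow> l \<in> {1..n} \<Longrightarrow> (\<Sum>t=1..n. F m t * F l t) = (if m = l then 1 else 0)"
    and ts: "t \<in> {1..n}" "s \<in> {1..n}"
  shows "(\<Sum>m=1..n. F m t * F m s) = (if t = s then 1 else 0)"
proof -
  define Q where "Q t s = (\<Sum>m=1..n. F m t * F m s)" for t s
  define d where "d t s = (if t = s then 1 else 0 :: real)" for t s :: nat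
  have tr: "(\<Sum>t=1..n. Q t t) = real n"
    unfolding Q_def by (subst sum.swap) (simp add: rows del: One_nat_def)
  have "(\<Sum>t=1..n. \<Sum>s=1..n. (Q t s)\<^sup>2) =
      (\<Sum>t=1..n. \<Sum>s=1..n. \<Sum>m=1..n. \<Sum>l=1..n. (F m t * F l t) * (F m s * F l s))"
    unfolding Q_def power2_eq_square sum_product by (simp add: mult_ac)
  \<comment> \<open>Exchanging the sums turns the squared entries of \<open>F\<^sup>T F\<close> into
    those of \<open>F F\<^sup>T\<close>, which is the identity by hypothesis.\<close>
  also have "\<dots> = (\<Sum>m=1..n. \<Sum>l=1..n. \<Sum>t=1..n. \<Sum>s=1..n. (F m t * F l t) * (F m s * F l s))"
  proof -
    have "(\<Sum>t=1..n. \<Sum>s=1..n. \<Sum>m=1..n. \<Sum>l=1..n. (F m t * F l t) * (F m s * F l s)) =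
        (\<Sum>t=1..n. \<Sum>m=1..n. \<Sum>s=1..n. \<Sum>l=1..n. (F m t * F l t) * (F m s * F l s))"
      by (intro sum.cong refl sum.swap)
    also have "\<dots> = (\<Sum>m=1..n. \<Sum>t=1..n. \<Sum>s=1..n. \<Sum>l=1..n. (F m t * F l t) * (F m s * F l s))"
      by (rule sum.swap)
    also have "\<dots> = (\<Sum>m=1..n. \<Sum>t=1..n. \<Sum>l=1..n. \<Sum>s=1..n. (F m t * F l t) * (F m s * F l s))"
      by (intro sum.cong refl sum.swap)
    also have "\<dots> = (\<Sum>m=1..n. \<Sum>l=1..n. \<Sum>t=1..n. \<Sum>s=1..n. (F m t * F l t) * (F m s * F l s))"
      by (intro sum.cong refl sum.swap)
    finally show ?thesis .
  qed
  also have "\<dots> = (\<Sum>m=1..n. \<Sum>l=1..n. (d m l)\<^sup>2)"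
    unfolding sum_product[symmetric] d_def using rows by (intro sum.cong refl) (simp add: power2_eq_square)
  also have "\<dots> = real n"
    by (simp add: d_def if_distrib[of "\<lambda>x. x\<^sup>2"] cong: if_cong)
  finally have sq: "(\<Sum>t=1..n. \<Sum>s=1..n. (Q t s)\<^sup>2) = real n" .
  have "(\<Sum>t=1..n. \<Sum>s=1..n. (d t s - Q t s)\<^sup>2) =
      (\<Sum>t=1..n. \<Sum>s=1..n. (d t s)\<^sup>2 - 2 * (d t s * Q t s) + (Q t s)\<^sup>2)"
    by (simp add: power2_diff algebra_simps)
  also have "\<dots> = (\<Sum>t=1..n. \<Sum>s=1..n. (d t s)\<^sup>2) - 2 * (\<Sum>t=1..n. \<Sum>s=1..n. d t s * Q t s) + real n"
    by (simp add: sum.distrib sum_subtractf sum_distrib_left[symmetric] sq)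
  also have "\<dots> = 0"
    using tr by (simp add: d_def if_distrib[of "\<lambda>x. x\<^sup>2"] if_distrib[of "\<lambda>x. x * _"] cong: if_cong)
  finally have "(\<Sum>t=1..n. \<Sum>s=1..n. (d t s - Q t s)\<^sup>2) = 0" .
  then have "(\<Sum>s=1..n. (d t s - Q t s)\<^sup>2) = 0"
    using ts by (subst (asm) sum_nonneg_eq_0_iff) (auto intro: sum_nonneg)
  then have "(d t s - Q t s)\<^sup>2 = 0"
    using ts by (subst (asm) sum_nonneg_eq_0_iff) auto
  then show ?thesis
    by (simp add: d_def Q_def split: if_splits)
qed

text \<open>The matrix is square, so its orthonormal rows entail orthonormal columns, and these give
  Parseval's identity.\<close>

lemma fourier_mat_parseval:
  fixes x y :: "nat \<Rightarrow> real"
  shows "(\<Sum>m=1..n. (\<Sum>t=1..n. fourier_mat n m t * x t) * (\<Sum>t=1..n. fourier_mat n m t * y t)) = (\<Sum>t=1..n. x t * y t)"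
proof -
  have "(\<Sum>m=1..n. (\<Sum>t=1..n. fourier_mat n m t * x t) * (\<Sum>t=1..n. fourier_mat n m t * y t)) =
     (\<Sum>m=1..n. \<Sum>t=1..n. \<Sum>s=1..n. x t * y s * (fourier_mat n m t * fourier_mat n m s))"
    unfolding sum_product by (simp add: mult_ac)
  also have "\<dots> = (\<Sum>t=1..n. \<Sum>s=1..n. \<Sum>m=1..n. x t * y s * (fourier_mat n m t * fourier_mat n m s))"
    by (subst sum.swap) (intro sum.cong refl sum.swap)
  also have "\<dots> = (\<Sum>t=1..n. \<Sum>s=1..n. x t * y s * (if t = s then 1 else 0))"
    unfolding sum_distrib_left[symmetric]
    by (intro sum.cong refl arg_cong2[where f = "\<lambda>a b. a * b"] orthonormal_rows_imp_columns[OF fourier_mat_rows_orthonormal])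
  also have "\<dots> = (\<Sum>t=1..n. x t * y t)"
    by (simp add: if_distrib cong: if_cong)
  finally show ?thesis .
qed

section \<open>Orthogonal changes of variables\<close>

text \<open>The product measure is determined by its values on boxes, where the claim is translation
  invariance in each coordinate. The shift is restricted to \<open>I\<close> because points of the
  product space are extensional.\<close>

lemma nn_integral_PiM_lborel_translate:
  fixes c :: "nat \<Rightarrow> real"
  assumes "finite I" and g: "g \<in> borel_measurable (Pi\<^sub>M I (\<lambda>_. lborel))"
  shows "(\<integral>\<^sup>+x. g (\<lambda>i\<in>I. x i + c i) \<partial>Pi\<^sub>M I (\<lambda>_. lborel)) = (\<integral>\<^sup>+x. g x \<partial>Pi\<^sub>M I (\<lambda>_. lborel))"
proof -
  let ?M = "Pi\<^sub>M I (\<lambda>_. lborel :: real measure)"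
  let ?s = "\<lambda>x. \<lambda>i\<in>I. x i + c i"
  interpret product_sigma_finite "\<lambda>_. lborel :: real measure" by unfold_locales
  have s[measurable]: "?s \<in> measurable ?M ?M"
    by measurable
  have "distr ?M ?M ?s = ?M"
  proof (rule PiM_eqI[OF assms(1)])
    fix A :: "nat \<Rightarrow> real set"
    assume A: "\<And>i. i \<in> I \<Longrightarrow> A i \<in> sets lborel"
    define B where "B i = (\<lambda>x. c i + x) -` A i" for i
    have B: "B i \<in> sets lborel" "emeasure lborel (B i) = emeasure lborel (A i)" if "i \<in> I" for i
    proof -
      show "B i \<in> sets lborel"
        using measurable_sets[of "\<lambda>x. c i + x" borel borel "A i"] A[OF that] by (simp add: B_def)
      have "emeasure lborel (A i) = emeasure (distr lborel borel ((+) (c i))) (A i)"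
        by (simp only: lborel_distr_plus)
      also have "\<dots> = emeasure lborel (B i)"
        using A[OF that] by (subst emeasure_distr) (auto simp: B_def)
      finally show "emeasure lborel (B i) = emeasure lborel (A i)" by simp
    qed
    have "?s -` (Pi\<^sub>E I A) \<inter> space ?M = Pi\<^sub>E I B"
      by (auto simp: space_PiM B_def PiE_iff add.commute)
    then have "emeasure (distr ?M ?M ?s) (Pi\<^sub>E I A) = emeasure ?M (Pi\<^sub>E I B)"
      using A assms(1) by (subst emeasure_distr) (auto intro!: sets_PiM_I_finite)
    also have "\<dots> = (\<Prod>i\<in>I. emeasure lborel (A i))"
      using B assms(1) by (subst emeasure_PiM) (auto intro!: prod.cong)
    finally show "emeasure (distr ?M ?M ?s) (Pi\<^sub>E I A) = (\<Prod>i\<in>I. emeasure lborel (A i))" .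
  qed simp
  then have "(\<integral>\<^sup>+x. g x \<partial>?M) = (\<integral>\<^sup>+x. g x \<partial>distr ?M ?M ?s)" by simp
  also have "\<dots> = (\<integral>\<^sup>+x. g (?s x) \<partial>?M)"
    using g by (intro nn_integral_distr) simp_all
  finally show ?thesis by simp
qed

lemma prod_std_normal_density:
  fixes x :: "'i \<Rightarrow> real"
  assumes "finite I"
  shows "(\<Prod>i\<in>I. std_normal_density (x i)) = (1 / sqrt (2 * pi)) ^ card I * exp (- (\<Sum>i\<in>I. (x i)\<^sup>2) / 2)"
proof -
  have "- (\<Sum>i\<in>I. (x i)\<^sup>2) / 2 = (\<Sum>i\<in>I. - (x i)\<^sup>2 / 2)"
    by (simp add: sum_negf sum_divide_distrib)
  then show ?thesis
    by (simp add: std_normal_density_def prod_dividef exp_sum[OF assms] power_divide)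
qed

text \<open>The standard Gaussian density \<open>f\<close> is invariant under \<open>F\<close> and \<open>-1\<close>.  Inserting
  \<open>\<integral> f = 1\<close> and using translation invariance and Fubini's theorem,
  \<open>\<integral> g (F y) dy = \<integral>\<integral> f x g (F y + x) dx dy = \<integral> g x \<integral> f (x - F y) dy dx = \<integral> g x dx\<close>.\<close>

lemma nn_integral_PiM_lborel_orthogonal:
  fixes F :: "nat \<Rightarrow> nat \<Rightarrow> real"
  assumes rows: "\<And>m l. m \<in> {1..n} \<Longrightarrow> l \<in> {1..n} \<Longrightarrow> (\<Sum>t=1..n. F m t * F l t) = (if m = l then 1 else 0)"
    and g: "g \<in> borel_measurable (Pi\<^sub>M {1..n} (\<lambda>_. lborel))"
  shows "(\<integral>\<^sup>+x. g (\<lambda>m\<in>{1..n}. \<Sum>t=1..n. F m t * x t) \<partial>Pi\<^sub>M {1..n} (\<lambda>_. lborel)) =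
    (\<integral>\<^sup>+x. g x \<partial>Pi\<^sub>M {1..n} (\<lambda>_. lborel))"
proof -
  let ?I = "{1..n}"
  let ?M = "Pi\<^sub>M ?I (\<lambda>_. lborel :: real measure)"
  note g[measurable]
  interpret product_sigma_finite "\<lambda>_. lborel :: real measure" by unfold_locales
  interpret pair_sigma_finite ?M ?M
    by (intro pair_sigma_finite.intro sigma_finite) simp_all
  define T where "T x m = (\<Sum>t=1..n. F m t * x t)" for x m
  \<comment> \<open>\<open>U\<close> is the transposed map; orthonormality of the rows makes it a
    right inverse of \<open>T\<close>.\<close>
  define U where "U x t = (\<Sum>m=1..n. F m t * x m)" for x t
  define f :: "(nat \<Rightarrow> real) \<Rightarrow> ennreal" where "f x = (\<Prod>i\<in>?I. ennreal (std_normal_density (x i)))" for x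
  have f_alt: "f x = ennreal ((1 / sqrt (2 * pi)) ^ n * exp (- (\<Sum>i\<in>?I. (x i)\<^sup>2) / 2))" for x
    using prod_std_normal_density[of ?I x] by (simp add: f_def prod_ennreal)
  have T_cong: "T x = T y" if "\<And>i. i \<in> ?I \<Longrightarrow> x i = y i" for x y
    unfolding T_def using that by (intro ext sum.cong) auto
  have f_cong: "f x = f y" if "\<And>i. i \<in> ?I \<Longrightarrow> x i = y i" for x y
    unfolding f_def using that by (intro prod.cong) auto
  have T_add: "T (\<lambda>i. x i + y i) m = T x m + T y m" for x y m
    by (simp add: T_def sum.distrib algebra_simps)
  have T_diff: "T (\<lambda>i. x i - y i) m = T x m - T y m" for x y m
    by (simp add: T_def sum_subtractf algebra_simps)
  have TU: "T (U x) m = x m" if "m \<in> ?I" for x m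
  proof -
    have "T (U x) m = (\<Sum>t=1..n. \<Sum>l=1..n. x l * (F m t * F l t))"
      by (simp add: T_def U_def sum_distrib_left mult_ac)
    also have "\<dots> = (\<Sum>l=1..n. x l * (\<Sum>t=1..n. F m t * F l t))"
      by (subst sum.swap) (simp add: sum_distrib_left)
    also have "\<dots> = (\<Sum>l=1..n. x l * (if m = l then 1 else 0))"
      using that by (intro sum.cong refl) (simp add: rows)
    also have "\<dots> = x m"
      using that by (simp add: if_distrib cong: if_cong)
    finally show ?thesis .
  qed
  have norm_T: "(\<Sum>m=1..n. (T x m)\<^sup>2) = (\<Sum>t=1..n. (x t)\<^sup>2)" for x
  proof -
    have "(\<Sum>m=1..n. (T x m)\<^sup>2) = (\<Sum>m=1..n. \<Sum>t=1..n. \<Sum>s=1..n. x t * x s * (F m t * F m s))"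
      unfolding T_def power2_eq_square sum_product by (simp add: mult_ac)
    also have "\<dots> = (\<Sum>t=1..n. \<Sum>s=1..n. \<Sum>m=1..n. x t * x s * (F m t * F m s))"
      by (subst sum.swap) (intro sum.cong refl sum.swap)
    also have "\<dots> = (\<Sum>t=1..n. \<Sum>s=1..n. x t * x s * (if t = s then 1 else 0))"
      unfolding sum_distrib_left[symmetric]
      by (intro sum.cong refl arg_cong2[where f = "\<lambda>a b. a * b"] orthonormal_rows_imp_columns[OF rows])
    also have "\<dots> = (\<Sum>t=1..n. x t * x t)"
      by (simp add: if_distrib cong: if_cong)
    finally show ?thesis by (simp add: power2_eq_square)
  qed
  have f_T: "f (T x) = f x" for x
    unfolding f_alt norm_T ..
  have f_minus: "f (\<lambda>i. - x i) = f x" for x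
    unfolding f_alt by simp
  have [measurable]: "(\<lambda>x. T x m) \<in> borel_measurable ?M" if "m \<in> ?I" for m
    unfolding T_def by measurable
  have f_meas[measurable]: "f \<in> borel_measurable ?M"
    unfolding f_def by measurable
  have [measurable]: "(\<lambda>p. T (snd p) m) \<in> borel_measurable (?M \<Otimes>\<^sub>M ?M)" for m
    unfolding T_def by (intro borel_measurable_sum borel_measurable_times) measurable
  have int_f: "(\<integral>\<^sup>+x. f x \<partial>?M) = 1"
  proof -
    have "(\<integral>\<^sup>+x. ennreal (std_normal_density x) \<partial>lborel) = 1"
      by (subst nn_integral_eq_integral) auto
    then show ?thesis
      unfolding f_def by (subst product_nn_integral_prod) auto
  qed
  have "(\<integral>\<^sup>+y. g (restrict (T y) ?I) \<partial>?M) = (\<integral>\<^sup>+x. f x * (\<integral>\<^sup>+y. g (restrict (T y) ?I) \<partial>?M) \<partial>?M)"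
    using int_f by (simp add: nn_integral_multc)
  also have "\<dots> = (\<integral>\<^sup>+x. f x * (\<integral>\<^sup>+y. g (\<lambda>m\<in>?I. T y m + x m) \<partial>?M) \<partial>?M)"
  proof (rule nn_integral_cong)
    fix x
    \<comment> \<open>As \<open>x\<close> agrees with \<open>T (U x)\<close> on the index set,
      adding \<open>x\<close> after \<open>T\<close> amounts to translating \<open>y\<close> by
      \<open>U x\<close> before \<open>T\<close>.\<close>
    have "(\<integral>\<^sup>+y. g (restrict (T y) ?I) \<partial>?M) = (\<integral>\<^sup>+y. g (restrict (T (\<lambda>i\<in>?I. y i + U x i)) ?I) \<partial>?M)"
      by (rule nn_integral_PiM_lborel_translate[symmetric, where g = "\<lambda>y. g (restrict (T y) ?I)"]) simp_all
    also have "\<dots> = (\<integral>\<^sup>+y. g (\<lambda>m\<in>?I. T y m + x m) \<partial>?M)"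
    proof (rule arg_cong[where f = "nn_integral ?M"], rule ext)
      fix y
      have "T (\<lambda>i\<in>?I. y i + U x i) = T (\<lambda>i. y i + U x i)"
        by (rule T_cong) simp
      then have "restrict (T (\<lambda>i\<in>?I. y i + U x i)) ?I = (\<lambda>m\<in>?I. T y m + x m)"
        by (intro restrict_ext) (simp add: T_add TU)
      then show "g (restrict (T (\<lambda>i\<in>?I. y i + U x i)) ?I) = g (\<lambda>m\<in>?I. T y m + x m)" by simp
    qed
    finally show "f x * (\<integral>\<^sup>+y. g (restrict (T y) ?I) \<partial>?M) = f x * (\<integral>\<^sup>+y. g (\<lambda>m\<in>?I. T y m + x m) \<partial>?M)"
      by simp
  qed
  also have "\<dots> = (\<integral>\<^sup>+x. (\<integral>\<^sup>+y. f x * g (\<lambda>m\<in>?I. T y m + x m) \<partial>?M) \<partial>?M)"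
    by (intro nn_integral_cong nn_integral_cmult[symmetric]) measurable
  also have "\<dots> = (\<integral>\<^sup>+y. (\<integral>\<^sup>+x. f x * g (\<lambda>m\<in>?I. T y m + x m) \<partial>?M) \<partial>?M)"
    by (rule Fubini'[symmetric]) measurable
  also have "\<dots> = (\<integral>\<^sup>+y. (\<integral>\<^sup>+x. f (\<lambda>i. x i - T y i) * g x \<partial>?M) \<partial>?M)"
  proof (rule nn_integral_cong)
    fix y
    let ?h = "\<lambda>x. f (\<lambda>i. x i - T y i) * g x"
    have [measurable]: "(\<lambda>x. f (\<lambda>i. x i - T y i)) \<in> borel_measurable ?M"
      unfolding f_def by measurable
    have "(\<integral>\<^sup>+x. ?h x \<partial>?M) = (\<integral>\<^sup>+x. ?h (\<lambda>i\<in>?I. x i + T y i) \<partial>?M)"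
      by (rule nn_integral_PiM_lborel_translate[symmetric]) simp_all
    also have "\<dots> = (\<integral>\<^sup>+x. f x * g (\<lambda>m\<in>?I. T y m + x m) \<partial>?M)"
    proof (rule arg_cong[where f = "nn_integral ?M"], rule ext)
      fix x
      have "f (\<lambda>i. (\<lambda>i\<in>?I. x i + T y i) i - T y i) = f x"
        by (rule f_cong) simp
      then show "?h (\<lambda>i\<in>?I. x i + T y i) = f x * g (\<lambda>m\<in>?I. T y m + x m)"
        by (simp add: add.commute)
    qed
    finally show "(\<integral>\<^sup>+x. f x * g (\<lambda>m\<in>?I. T y m + x m) \<partial>?M) = (\<integral>\<^sup>+x. ?h x \<partial>?M)" by simp
  qed
  also have "\<dots> = (\<integral>\<^sup>+x. (\<integral>\<^sup>+y. f (\<lambda>i. x i - T y i) * g x \<partial>?M) \<partial>?M)"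
  proof -
    have [measurable]: "(\<lambda>p. f (\<lambda>i. fst p i - T (snd p) i)) \<in> borel_measurable (?M \<Otimes>\<^sub>M ?M)"
      unfolding f_def by measurable
    show ?thesis
      by (rule Fubini') (simp add: case_prod_unfold)
  qed
  also have "\<dots> = (\<integral>\<^sup>+x. g x \<partial>?M)"
  proof (rule nn_integral_cong)
    fix x
    \<comment> \<open>Rotation invariance and evenness of \<open>f\<close> turn
      \<open>f (x - T y)\<close> into \<open>f (y - U x)\<close>, a translate in \<open>y\<close> of
      a density with integral 1.\<close>
    have eq: "f (\<lambda>i. x i - T y i) = f (\<lambda>i\<in>?I. y i + - U x i)" for y
    proof -
      have "f (\<lambda>i. x i - T y i) = f (T (\<lambda>i. U x i - y i))"
        by (rule f_cong) (simp add: T_diff TU)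
      also have "\<dots> = f (\<lambda>i. - (\<lambda>i. y i - U x i) i)"
        by (simp add: f_T)
      also have "\<dots> = f (\<lambda>i. y i - U x i)"
        by (rule f_minus)
      also have "\<dots> = f (\<lambda>i\<in>?I. y i + - U x i)"
        by (rule f_cong) simp
      finally show ?thesis .
    qed
    have "(\<integral>\<^sup>+y. f (\<lambda>i\<in>?I. y i + - U x i) \<partial>?M) = 1"
      using nn_integral_PiM_lborel_translate[OF _ f_meas] int_f by (simp del: add_uminus_conv_diff)
    then have "(\<integral>\<^sup>+y. f (\<lambda>i. x i - T y i) \<partial>?M) = 1"
      by (simp add: eq)
    moreover have "(\<lambda>y. f (\<lambda>i. x i - T y i)) \<in> borel_measurable ?M"
      unfolding f_def by measurable
    ultimately show "(\<integral>\<^sup>+y. f (\<lambda>i. x i - T y i) * g x \<partial>?M) = g x"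
      by (simp add: nn_integral_multc)
  qed
  finally show ?thesis unfolding T_def[abs_def] .
qed

section \<open>Moments under the Whittle likelihood\<close>

text \<open>These are the \<open>y\<^sub>m\<close> of the outline; they have mean zero when the data
  follow the Whittle likelihood with the same \<open>\<theta>\<close>.\<close>

definition centered_data ::
    "(nat \<Rightarrow> nat \<Rightarrow> real ^ 'r) \<Rightarrow> nat \<Rightarrow> real ^ 'r \<Rightarrow> (nat \<Rightarrow> real) \<Rightarrow> nat \<Rightarrow> real" where
  "centered_data X n \<theta> z m = fourier_data n z m - fourier_design X n m \<bullet> \<theta>"

lemma fourier_data_measurable[measurable]:
  "(\<lambda>z. fourier_data n z m) \<in> borel_measurable (Pi\<^sub>M {1..n} (\<lambda>_. lborel))"
  unfolding fourier_data_def by measurable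

lemma centered_data_measurable[measurable]:
  "(\<lambda>z. centered_data X n \<theta> z m) \<in> borel_measurable (Pi\<^sub>M {1..n} (\<lambda>_. lborel))"
  unfolding centered_data_def by measurable

lemma whittle_density_measurable[measurable]:
  "whittle_density X n \<theta> f \<in> borel_measurable (Pi\<^sub>M {1..n} (\<lambda>_. lborel))"
  unfolding whittle_density_def[abs_def] by measurable

lemma sets_whittle_measure: "sets (whittle_measure X n \<theta> f) = sets (Pi\<^sub>M {1..n} (\<lambda>_. lborel))"
  by (simp add: whittle_measure_def)

lemma whittle_measurable_cong:
  "measurable (whittle_measure X n \<theta> f) N = measurable (Pi\<^sub>M {1..n} (\<lambda>_. lborel)) N"
  by (rule measurable_cong_sets[OF sets_whittle_measure refl])

lemma sqrt_prod: "sqrt (\<Prod>i\<in>I. f i) = (\<Prod>i\<in>I. sqrt (f i))"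
  by (induction I rule: infinite_finite_induct) (simp_all add: real_sqrt_mult)

text \<open>The covariance is diagonal in Fourier coordinates, so the density factors over them;
  independence of the Fourier data rests on this form.\<close>

lemma whittle_density_altdef:
  assumes D: "\<forall>m\<in>{1..n}. D_entry n f m > 0"
  shows "whittle_density X n \<theta> f z =
    (\<Prod>m=1..n. normal_density (fourier_design X n m \<bullet> \<theta>) (sqrt (D_entry n f m)) (fourier_data n z m))"
proof -
  have "(\<Prod>m=1..n. normal_density (fourier_design X n m \<bullet> \<theta>) (sqrt (D_entry n f m)) (fourier_data n z m)) =
     (\<Prod>m=1..n. 1 / sqrt (2 * pi * D_entry n f m) *
       exp (- (fourier_data n z m - fourier_design X n m \<bullet> \<theta>)\<^sup>2 / (2 * D_entry n f m)))"
    using D by (intro prod.cong refl) (simp add: normal_density_def less_imp_le)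
  also have "\<dots> = (\<Prod>m=1..n. 1 / sqrt (2 * pi * D_entry n f m)) *
      exp (\<Sum>m=1..n. - (fourier_data n z m - fourier_design X n m \<bullet> \<theta>)\<^sup>2 / (2 * D_entry n f m))"
    by (simp only: prod.distrib exp_sum[OF finite_atLeastAtMost])
  also have "(\<Prod>m=1..n. 1 / sqrt (2 * pi * D_entry n f m)) = 1 / sqrt (\<Prod>m=1..n. 2 * pi * D_entry n f m)"
    by (simp add: prod_dividef sqrt_prod)
  also have "(\<Prod>m=1..n. 2 * pi * D_entry n f m) = (2 * pi) ^ n * (\<Prod>m=1..n. D_entry n f m)"
    by (simp add: prod.distrib power_mult_distrib)
  also have "(\<Sum>m=1..n. - (fourier_data n z m - fourier_design X n m \<bullet> \<theta>)\<^sup>2 / (2 * D_entry n f m)) =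
     - (1 / 2) * (\<Sum>m=1..n. (fourier_data n z m - fourier_design X n m \<bullet> \<theta>)\<^sup>2 / D_entry n f m)"
    by (simp add: sum_distrib_left)
  finally show ?thesis by (simp only: whittle_density_def)
qed

text \<open>An orthogonal map preserves Lebesgue measure, so the Fourier data have the product
  density itself, without a Jacobian factor.\<close>

lemma distr_whittle_measure:
  assumes D: "\<forall>m\<in>{1..n}. D_entry n f m > 0"
  shows "distr (whittle_measure X n \<theta> f) (Pi\<^sub>M {1..n} (\<lambda>_. lborel)) (\<lambda>z. restrict (fourier_data n z) {1..n}) =
    density (Pi\<^sub>M {1..n} (\<lambda>_. lborel))
      (\<lambda>w. ennreal (\<Prod>m=1..n. normal_density (fourier_design X n m \<bullet> \<theta>) (sqrt (D_entry n f m)) (w m)))"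
    (is "distr ?W ?M ?T = density ?M (\<lambda>w. ennreal (?p w))")
proof (rule measure_eqI)
  have T[measurable]: "?T \<in> measurable ?M ?M"
    by measurable
  have p[measurable]: "?p \<in> borel_measurable ?M"
    by measurable
  fix A
  assume "A \<in> sets (distr ?W ?M ?T)"
  then have A[measurable]: "A \<in> sets ?M" by simp
  let ?g = "\<lambda>w. ennreal (?p w) * indicator A w"
  have "emeasure (distr ?W ?M ?T) A = (\<integral>\<^sup>+z. ennreal (whittle_density X n \<theta> f z) * indicator (?T -` A \<inter> space ?M) z \<partial>?M)"
    unfolding whittle_measure_def
    by (subst emeasure_distr) (auto intro!: emeasure_density)
  also have "\<dots> = (\<integral>\<^sup>+z. ?g (\<lambda>m\<in>{1..n}. \<Sum>t=1..n. fourier_mat n m t * z t) \<partial>?M)"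
  proof (rule nn_integral_cong)
    fix z assume z: "z \<in> space ?M"
    have "?p (\<lambda>m\<in>{1..n}. \<Sum>t=1..n. fourier_mat n m t * z t) = whittle_density X n \<theta> f z"
      unfolding whittle_density_altdef[OF D] fourier_data_def by (intro prod.cong refl) (simp)
    then show "ennreal (whittle_density X n \<theta> f z) * indicator (?T -` A \<inter> space ?M) z =
        ?g (\<lambda>m\<in>{1..n}. \<Sum>t=1..n. fourier_mat n m t * z t)"
      using z by (simp add: indicator_def fourier_data_def[abs_def])
  qed
  also have "\<dots> = (\<integral>\<^sup>+w. ?g w \<partial>?M)"
    by (rule nn_integral_PiM_lborel_orthogonal[OF fourier_mat_rows_orthonormal]) (assumption+, measurable)
  also have "\<dots> = emeasure (density ?M (\<lambda>w. ennreal (?p w))) A"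
    by (rule emeasure_density[symmetric]) measurable
  finally show "emeasure (distr ?W ?M ?T) A = emeasure (density ?M (\<lambda>w. ennreal (?p w))) A" .
qed simp

text \<open>The integrand factors over the coordinates, which leaves normal moments of order 0, 1
  and 2 on the line.\<close>

lemma gaussian_product_moments:
  fixes \<mu> \<sigma> :: "nat \<Rightarrow> real"
  assumes I: "finite I" and \<sigma>: "\<And>m. m \<in> I \<Longrightarrow> \<sigma> m > 0"
  defines "N \<equiv> density (Pi\<^sub>M I (\<lambda>_. lborel)) (\<lambda>w. ennreal (\<Prod>m\<in>I. normal_density (\<mu> m) (\<sigma> m) (w m)))"
  shows "prob_space N"
    and "i \<in> I \<Longrightarrow> j \<in> I \<Longrightarrow> has_bochner_integral N (\<lambda>w. (w i - \<mu> i) * (w j - \<mu> j)) (if i = j then (\<sigma> i)\<^sup>2 else 0)"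
proof -
  let ?M = "Pi\<^sub>M I (\<lambda>_. lborel :: real measure)"
  interpret product_sigma_finite "\<lambda>_. lborel :: real measure" by unfold_locales
  have p[measurable]: "(\<lambda>w. \<Prod>m\<in>I. normal_density (\<mu> m) (\<sigma> m) (w m)) \<in> borel_measurable ?M"
    by measurable
  show "prob_space N"
  proof
    have 1: "(\<integral>\<^sup>+x. ennreal (normal_density (\<mu> m) (\<sigma> m) x) \<partial>lborel) = 1" if "m \<in> I" for m
      using \<sigma>[OF that] by (subst nn_integral_eq_integral) auto
    have "emeasure N (space N) = (\<integral>\<^sup>+w. (\<Prod>m\<in>I. ennreal (normal_density (\<mu> m) (\<sigma> m) (w m))) \<partial>?M)"
      unfolding N_def by (subst emeasure_density) (auto intro!: nn_integral_cong simp: prod_ennreal)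
    also have "\<dots> = (\<Prod>m\<in>I. (\<integral>\<^sup>+x. ennreal (normal_density (\<mu> m) (\<sigma> m) x) \<partial>lborel))"
      using I by (intro product_nn_integral_prod) auto
    also have "\<dots> = 1"
      using 1 by simp
    finally show "emeasure N (space N) = 1" .
  qed
  assume ij: "i \<in> I" "j \<in> I"
  \<comment> \<open>\<open>h m\<close> collects the density and the factors that belong to
    coordinate \<open>m\<close>, two of them when \<open>m = i = j\<close>; \<open>v m\<close> is
    its integral. For \<open>i \<noteq> j\<close> the first moment at \<open>i\<close> is 0 and
    annihilates the product.\<close>
  define h where "h m x = normal_density (\<mu> m) (\<sigma> m) x *
      ((if m = i then x - \<mu> m else 1) * (if m = j then x - \<mu> m else 1))" for m x
  define v where "v m = (if m = i then if m = j then (\<sigma> m)\<^sup>2 else 0 else if m = j then 0 else 1)" for m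
  have h: "has_bochner_integral lborel (h m) (v m)" if "m \<in> I" for m
  proof -
    note s = \<sigma>[OF that]
    have e0: "has_bochner_integral lborel (\<lambda>x. normal_density (\<mu> m) (\<sigma> m) x) 1"
      using normal_moment_even[OF s, of "\<mu> m" 0] by simp
    have e1: "has_bochner_integral lborel (\<lambda>x. normal_density (\<mu> m) (\<sigma> m) x * (x - \<mu> m)) 0"
      using normal_moment_odd[OF s, of "\<mu> m" 0] by simp
    have e2: "has_bochner_integral lborel (\<lambda>x. normal_density (\<mu> m) (\<sigma> m) x * ((x - \<mu> m) * (x - \<mu> m))) ((\<sigma> m)\<^sup>2)"
      using normal_moment_even[OF s, of "\<mu> m" 1] by (simp add: fact_numeral power2_eq_square)
    show ?thesis
      unfolding h_def v_def using e0 e1 e2 by (cases "m = i"; cases "m = j") simp_all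
  qed
  have prod_h: "(\<Prod>m\<in>I. h m (w m)) = (\<Prod>m\<in>I. normal_density (\<mu> m) (\<sigma> m) (w m)) * ((w i - \<mu> i) * (w j - \<mu> j))" for w
    unfolding h_def prod.distrib using ij I by simp
  have "integrable ?M (\<lambda>w. \<Prod>m\<in>I. h m (w m))"
    using h I by (intro product_integrable_prod) (auto intro: integrable.intros)
  moreover have "(\<integral>w. (\<Prod>m\<in>I. h m (w m)) \<partial>?M) = (\<Prod>m\<in>I. v m)"
    using h I by (subst product_integral_prod) (auto intro: integrable.intros intro!: prod.cong dest: has_bochner_integral_integral_eq)
  ultimately have "has_bochner_integral ?M (\<lambda>w. \<Prod>m\<in>I. h m (w m)) (\<Prod>m\<in>I. v m)"
    by (simp add: has_bochner_integral_iff)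
  moreover have "(\<Prod>m\<in>I. v m) = (if i = j then (\<sigma> i)\<^sup>2 else 0)"
  proof (cases "i = j")
    case True
    then have "v = (\<lambda>m. if m = i then (\<sigma> m)\<^sup>2 else 1)"
      by (auto simp: v_def)
    then show ?thesis using ij I True by simp
  next
    case False
    then have "v i = 0" by (simp add: v_def)
    then show ?thesis using ij I False by auto
  qed
  ultimately have "has_bochner_integral ?M (\<lambda>w. (\<Prod>m\<in>I. normal_density (\<mu> m) (\<sigma> m) (w m)) *\<^sub>R ((w i - \<mu> i) * (w j - \<mu> j)))
      (if i = j then (\<sigma> i)\<^sup>2 else 0)"
    by (simp add: prod_h)
  then show "has_bochner_integral N (\<lambda>w. (w i - \<mu> i) * (w j - \<mu> j)) (if i = j then (\<sigma> i)\<^sup>2 else 0)"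
    unfolding N_def using ij by (intro has_bochner_integral_density) (auto intro!: prod_nonneg)
qed

lemma prob_space_whittle_measure:
  assumes D: "\<forall>m\<in>{1..n}. D_entry n f m > 0"
  shows "prob_space (whittle_measure X n \<theta> f)"
proof -
  have "prob_space (distr (whittle_measure X n \<theta> f) (Pi\<^sub>M {1..n} (\<lambda>_. lborel)) (\<lambda>z. restrict (fourier_data n z) {1..n}))"
    unfolding distr_whittle_measure[OF D] using D by (intro gaussian_product_moments) auto
  then show ?thesis
    by (rule prob_space_distrD[rotated]) (simp add: whittle_measurable_cong)
qed

lemma whittle_covariance:
  assumes D: "\<forall>m\<in>{1..n}. D_entry n f m > 0" and ij: "i \<in> {1..n}" "j \<in> {1..n}"
  shows "has_bochner_integral (whittle_measure X n \<theta> f)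
    (\<lambda>z. centered_data X n \<theta> z i * centered_data X n \<theta> z j) (if i = j then D_entry n f i else 0)"
proof -
  let ?M = "Pi\<^sub>M {1..n} (\<lambda>_. lborel :: real measure)"
  let ?g = "\<lambda>w. (w i - fourier_design X n i \<bullet> \<theta>) * (w j - fourier_design X n j \<bullet> \<theta>)"
  have "has_bochner_integral (distr (whittle_measure X n \<theta> f) ?M (\<lambda>z. restrict (fourier_data n z) {1..n})) ?g
      (if i = j then (sqrt (D_entry n f i))\<^sup>2 else 0)"
    unfolding distr_whittle_measure[OF D] using D ij by (intro gaussian_product_moments) auto
  then have "has_bochner_integral (whittle_measure X n \<theta> f) (\<lambda>z. ?g (restrict (fourier_data n z) {1..n}))
      (if i = j then (sqrt (D_entry n f i))\<^sup>2 else 0)"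
    using ij by (simp add: has_bochner_integral_iff integrable_distr_eq integral_distr whittle_measurable_cong)
  then show ?thesis
    using ij D by (cases "i = j") (simp_all add: centered_data_def less_imp_le)
qed

text \<open>Cross terms vanish because distinct Fourier data are uncorrelated. Vector coefficients
  \<open>b\<close> make the identity applicable both to \<open>G_vec\<close> and to block sums of
  the weighted design.\<close>

lemma whittle_second_moment:
  fixes b :: "nat \<Rightarrow> 'v :: euclidean_space"
  assumes D: "\<forall>m\<in>{1..n}. D_entry n f m > 0" and A: "A \<subseteq> {1..n}"
  shows "has_bochner_integral (whittle_measure X n \<theta> f)
    (\<lambda>z. (norm (\<Sum>m\<in>A. centered_data X n \<theta> z m *\<^sub>R b m))\<^sup>2) (\<Sum>m\<in>A. D_entry n f m * (norm (b m))\<^sup>2)"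
proof -
  have fin: "finite A" using A finite_subset by blast
  have "(norm (\<Sum>m\<in>A. centered_data X n \<theta> z m *\<^sub>R b m))\<^sup>2 =
      (\<Sum>i\<in>A. \<Sum>j\<in>A. (b i \<bullet> b j) * (centered_data X n \<theta> z i * centered_data X n \<theta> z j))" for z
    unfolding power2_norm_eq_inner inner_sum_left inner_sum_right by (simp add: mult_ac inner_commute)
  moreover have "has_bochner_integral (whittle_measure X n \<theta> f)
     (\<lambda>z. \<Sum>i\<in>A. \<Sum>j\<in>A. (b i \<bullet> b j) * (centered_data X n \<theta> z i * centered_data X n \<theta> z j))
     (\<Sum>i\<in>A. \<Sum>j\<in>A. (b i \<bullet> b j) * (if i = j then D_entry n f i else 0))"
    using A by (intro has_bochner_integral_sum has_bochner_integral_mult_right whittle_covariance D) auto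
  moreover have "(\<Sum>i\<in>A. \<Sum>j\<in>A. (b i \<bullet> b j) * (if i = j then D_entry n f i else 0)) =
      (\<Sum>m\<in>A. D_entry n f m * (norm (b m))\<^sup>2)"
    using fin by (simp add: if_distrib power2_norm_eq_inner mult.commute cong: if_cong)
  ultimately show ?thesis by simp
qed

section \<open>The design and the class of spectral densities\<close>

lemma S_mat_mult: "S_mat X f n *v k = (\<Sum>m=1..n. ((fourier_design X n m \<bullet> k) / D_entry n f m) *\<^sub>R fourier_design X n m)"
proof -
  have "(S_mat X f n *v k) $ i = (\<Sum>m=1..n. ((fourier_design X n m \<bullet> k) / D_entry n f m) *\<^sub>R fourier_design X n m) $ i" for i
  proof -
    have "(S_mat X f n *v k) $ i =
        (\<Sum>j\<in>UNIV. \<Sum>m=1..n. fourier_design X n m $ j * k $ j / D_entry n f m * fourier_design X n m $ i)"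
      by (simp add: matrix_vector_mult_def S_mat_def sum_distrib_left mult_ac)
    also have "\<dots> = (\<Sum>m=1..n. \<Sum>j\<in>UNIV. fourier_design X n m $ j * k $ j / D_entry n f m * fourier_design X n m $ i)"
      by (rule sum.swap)
    also have "\<dots> = (\<Sum>m=1..n. ((fourier_design X n m \<bullet> k) / D_entry n f m) *\<^sub>R fourier_design X n m) $ i"
      by (simp add: inner_vec_def sum_divide_distrib sum_distrib_right)
    finally show ?thesis .
  qed
  then show ?thesis by (simp add: vec_eq_iff)
qed

lemma inner_S_mat:
  "h \<bullet> (S_mat X f n *v k) = (\<Sum>m=1..n. (fourier_design X n m \<bullet> h) * (fourier_design X n m \<bullet> k) / D_entry n f m)"
  unfolding S_mat_mult inner_sum_right by (simp add: inner_commute mult_ac)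

lemma inner_gram_mat: "h \<bullet> (gram_mat X n *v k) = (\<Sum>t=1..n. (X n t \<bullet> h) * (X n t \<bullet> k))"
proof -
  have "(gram_mat X n *v k) = (\<Sum>t=1..n. (X n t \<bullet> k) *\<^sub>R X n t)"
  proof -
    have "(gram_mat X n *v k) $ i = (\<Sum>t=1..n. (X n t \<bullet> k) *\<^sub>R X n t) $ i" for i
    proof -
      have "(gram_mat X n *v k) $ i = (\<Sum>j\<in>UNIV. \<Sum>t=1..n. X n t $ j * k $ j * X n t $ i)"
        by (simp add: matrix_vector_mult_def gram_mat_def sum_distrib_left mult_ac)
      also have "\<dots> = (\<Sum>t=1..n. \<Sum>j\<in>UNIV. X n t $ j * k $ j * X n t $ i)"
        by (rule sum.swap)
      also have "\<dots> = (\<Sum>t=1..n. (X n t \<bullet> k) *\<^sub>R X n t) $ i"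
        by (simp add: inner_vec_def sum_distrib_right)
      finally show ?thesis .
    qed
    then show ?thesis by (simp add: vec_eq_iff)
  qed
  then show ?thesis
    by (simp add: inner_sum_right inner_commute mult_ac)
qed

lemma transpose_S_mat: "transpose (S_mat X f n) = S_mat X f n"
  by (simp add: transpose_def S_mat_def mult_ac)

lemma transpose_gram_mat: "transpose (gram_mat X n) = gram_mat X n"
  by (simp add: transpose_def gram_mat_def mult_ac)

text \<open>Through this identity the bounds of Assumption D on the Gram matrix reach the Fourier
  transformed design.\<close>

lemma fourier_design_parseval:
  "(\<Sum>m=1..n. (fourier_design X n m \<bullet> h)\<^sup>2) = h \<bullet> (gram_mat X n *v h)"
proof -
  have "(\<Sum>m=1..n. (fourier_design X n m \<bullet> h)\<^sup>2) =
      (\<Sum>m=1..n. (\<Sum>t=1..n. fourier_mat n m t * (X n t \<bullet> h)) * (\<Sum>t=1..n. fourier_mat n m t * (X n t \<bullet> h)))"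
    by (simp add: fourier_design_def inner_sum_left power2_eq_square)
  also have "\<dots> = h \<bullet> (gram_mat X n *v h)"
    unfolding fourier_mat_parseval inner_gram_mat ..
  finally show ?thesis .
qed

text \<open>The right-hand side is the trace of the Gram matrix: each norm is expanded in the
  standard basis and Parseval's identity is applied in every coordinate.\<close>

lemma sum_norm_fourier_design:
  "(\<Sum>m=1..n. (norm (fourier_design X n m))\<^sup>2) = (\<Sum>b\<in>Basis. b \<bullet> (gram_mat X n *v b))"
proof -
  have "(\<Sum>m=1..n. (norm (fourier_design X n m))\<^sup>2) = (\<Sum>m=1..n. \<Sum>b\<in>Basis. (fourier_design X n m \<bullet> b)\<^sup>2)"
    unfolding power2_norm_eq_inner by (subst euclidean_inner) (simp add: power2_eq_square)
  also have "\<dots> = (\<Sum>b\<in>Basis. \<Sum>m=1..n. (fourier_design X n m \<bullet> b)\<^sup>2)"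
    by (rule sum.swap)
  finally show ?thesis by (simp only: fourier_design_parseval)
qed

text \<open>The conditions on liminf and limsup of the extreme eigenvalues become two-sided bounds
  on the quadratic form for all large \<open>n\<close>.\<close>

lemma assumption_D_bounds:
  fixes X :: "nat \<Rightarrow> nat \<Rightarrow> real ^ 'r"
  assumes "assumption_D X"
  obtains c C where "c > 0" "C > 0"
    "\<forall>\<^sub>F n in sequentially. \<forall>h. c * real n * (h \<bullet> h) \<le> h \<bullet> (gram_mat X n *v h) \<and>
       h \<bullet> (gram_mat X n *v h) \<le> C * real n * (h \<bullet> h)"
proof -
  have "0 < liminf (\<lambda>n. ereal (lambda_min (gram_mat X n) / real n))"
    "limsup (\<lambda>n. ereal (lambda_max (gram_mat X n) / real n)) < \<infinity>"
    using assms by (auto simp: assumption_D_def)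
  then obtain c' C' where c': "0 < ereal c'" "ereal c' < liminf (\<lambda>n. ereal (lambda_min (gram_mat X n) / real n))"
    and C': "limsup (\<lambda>n. ereal (lambda_max (gram_mat X n) / real n)) < ereal C'"
    using ereal_dense2[of 0] ereal_dense2[of _ \<infinity>] by blast
  have "\<forall>\<^sub>F n in sequentially. ereal c' < ereal (lambda_min (gram_mat X n) / real n)"
    "\<forall>\<^sub>F n in sequentially. ereal (lambda_max (gram_mat X n) / real n) < ereal C'"
    using less_LiminfD[OF c'(2)] Limsup_lessD[OF C'] by auto
  \<comment> \<open>The maximum with 1 supplies a positive upper constant, as the choice of
    \<open>C'\<close> above does not record its sign.\<close>
  then have "\<forall>\<^sub>F n in sequentially. \<forall>h. c' * real n * (h \<bullet> h) \<le> h \<bullet> (gram_mat X n *v h) \<and>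
       h \<bullet> (gram_mat X n *v h) \<le> max C' 1 * real n * (h \<bullet> h)"
    using eventually_gt_at_top[of 0]
  proof eventually_elim
    case (elim n)
    have l: "c' * real n \<le> lambda_min (gram_mat X n)" "lambda_max (gram_mat X n) \<le> C' * real n"
      using elim by (simp_all add: field_simps)
    have "C' * real n \<le> max C' 1 * real n"
      by (intro mult_right_mono) auto
    then have u: "lambda_max (gram_mat X n) \<le> max C' 1 * real n"
      using l(2) by linarith
    show ?case
    proof (intro allI conjI)
      fix h :: "real ^ 'r"
      have "c' * real n * (h \<bullet> h) \<le> lambda_min (gram_mat X n) * (h \<bullet> h)"
        using l(1) by (intro mult_right_mono) auto
      also have "\<dots> \<le> h \<bullet> (gram_mat X n *v h)"
        by (rule lambda_min_bound[OF transpose_gram_mat])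
      finally show "c' * real n * (h \<bullet> h) \<le> h \<bullet> (gram_mat X n *v h)" .
      have "h \<bullet> (gram_mat X n *v h) \<le> lambda_max (gram_mat X n) * (h \<bullet> h)"
        by (rule lambda_max_bound[OF transpose_gram_mat])
      also have "\<dots> \<le> max C' 1 * real n * (h \<bullet> h)"
        using u by (intro mult_right_mono) auto
      finally show "h \<bullet> (gram_mat X n *v h) \<le> max C' 1 * real n * (h \<bullet> h)" .
    qed
  qed
  then show thesis
    using that[of c' "max C' 1"] c'(1) by auto
qed

section \<open>Fourier frequencies and uniform bounds for the spectral densities\<close>

lemma fourier_freq_in_half_period:
  assumes "m \<in> {1..n}"
  shows "fourier_freq n (m div 2) \<in> {0..pi}"
proof -
  have "real (2 * (m div 2)) \<le> real n" using assms by (subst of_nat_le_iff) auto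
  then show ?thesis
    using assms by (auto simp: fourier_freq_def field_simps)
qed

text \<open>The integer part \<open>m div 2\<close> grows by at most 1 per row, so consecutive rows
  belong to equal or neighbouring frequencies. A Lipschitz spectral density therefore varies slowly
  in the row index.\<close>

lemma fourier_freq_step:
  assumes "n > 0"
  shows "\<bar>fourier_freq n (Suc m div 2) - fourier_freq n (m div 2)\<bar> \<le> 2 * pi / real n"
proof -
  have "real (Suc m div 2) - real (m div 2) \<in> {0..1}"
    by (cases "even m") auto
  then have "2 * pi / real n * \<bar>real (Suc m div 2) - real (m div 2)\<bar> \<le> 2 * pi / real n * 1"
    by (intro mult_left_mono) auto
  moreover have "fourier_freq n (Suc m div 2) - fourier_freq n (m div 2) =
      2 * pi / real n * (real (Suc m div 2) - real (m div 2))"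
    by (simp add: fourier_freq_def diff_divide_distrib[symmetric] right_diff_distrib)
  ultimately show ?thesis
    by (simp add: abs_mult)
qed

lemma C1_functions_continuous:
  assumes "f \<in> C1_functions"
  shows "continuous_on {0..pi} f"
proof -
  obtain f' where "\<forall>x\<in>{0..pi}. (f has_real_derivative f' x) (at x within {0..pi})"
    using assms by (auto simp: C1_functions_def)
  then show ?thesis
    by (intro DERIV_continuous_on) auto
qed

lemma continuous_on_compact_abs_bound:
  fixes f :: "real \<Rightarrow> real"
  assumes "continuous_on S f" "compact S"
  obtains B where "\<And>x. x \<in> S \<Longrightarrow> \<bar>f x\<bar> \<le> B"
proof -
  have "bounded (f ` S)"
    using compact_continuous_image[OF assms] compact_imp_bounded by blast
  then obtain B where "\<forall>y\<in>f ` S. \<bar>y\<bar> \<le> B"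
    unfolding bounded_iff by auto
  then show thesis using that by blast
qed

text \<open>Some finite \<open>B\<close> is enough here: it shows that the supremum in
  \<open>lip_norm\<close> is taken over a bounded set.\<close>

lemma C1_functions_lipschitz:
  assumes "f \<in> C1_functions"
  obtains B where "\<And>x y. x \<in> {0..pi} \<Longrightarrow> y \<in> {0..pi} \<Longrightarrow> \<bar>f x - f y\<bar> \<le> B * \<bar>x - y\<bar>"
proof -
  obtain f' where f': "continuous_on {0..pi} f'"
      "\<And>x. x \<in> {0..pi} \<Longrightarrow> (f has_real_derivative f' x) (at x within {0..pi})"
    using assms by (auto simp: C1_functions_def)
  obtain B where B: "\<And>x. x \<in> {0..pi} \<Longrightarrow> \<bar>f' x\<bar> \<le> B"
    using continuous_on_compact_abs_bound[OF f'(1) compact_Icc] by blast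
  show thesis
  proof (rule that[of B])
    fix x y assume "x \<in> {0..pi}" "y \<in> {0..pi}"
    then show "\<bar>f x - f y\<bar> \<le> B * \<bar>x - y\<bar>"
      using field_differentiable_bound[of "{0..pi}" f f' B x y] f'(2) B
      by (auto simp: convex_real_interval)
  qed
qed

text \<open>The bound \<open>B\<close> enters because a real \<open>SUP\<close> is a guaranteed
  upper bound only for sets that are bounded above.\<close>

lemma bounded_le_sup_norm:
  assumes "\<And>x. x \<in> {0..pi} \<Longrightarrow> \<bar>f x\<bar> \<le> B" "x \<in> {0..pi}"
  shows "\<bar>f x\<bar> \<le> sup_norm f"
  unfolding sup_norm_def using assms by (intro cSUP_upper bdd_aboveI[where M = B]) auto

lemma C_class_lower_bound:
  assumes f: "f \<in> C_class \<tau>0 \<tau>1" and "\<tau>0 > 0" and x: "x \<in> {0..pi}"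
  shows "\<tau>0 \<le> f x"
proof -
  have pos: "f y > 0" if "y \<in> {0..pi}" for y
    using f that by (auto simp: C_class_def)
  have "continuous_on {0..pi} (\<lambda>y. 1 / f y)"
    using C1_functions_continuous[of f] f pos by (intro continuous_intros) (force simp: C_class_def)+
  then obtain B where "\<And>y. y \<in> {0..pi} \<Longrightarrow> \<bar>1 / f y\<bar> \<le> B"
    using continuous_on_compact_abs_bound[OF _ compact_Icc] by blast
  then have "\<bar>1 / f x\<bar> \<le> sup_norm (\<lambda>y. 1 / f y)"
    using x by (intro bounded_le_sup_norm) auto
  also have "\<dots> \<le> 1 / \<tau>0"
    using f by (simp add: C_class_def)
  finally show ?thesis
    using pos[OF x] assms(2) by (simp add: field_simps)
qed

text \<open>The Lipschitz seminorm is one summand of \<open>lip_norm\<close>, and the other one, the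
  sup norm, is nonnegative.\<close>

lemma C_class_lipschitz:
  assumes f: "f \<in> C_class \<tau>0 \<tau>1" and x: "x \<in> {0..pi}" and y: "y \<in> {0..pi}"
  shows "\<bar>f x - f y\<bar> \<le> \<tau>1 * \<bar>x - y\<bar>"
proof (cases "x = y")
  case False
  have C1: "f \<in> C1_functions" using f by (simp add: C_class_def)
  obtain B where B: "\<And>x y. x \<in> {0..pi} \<Longrightarrow> y \<in> {0..pi} \<Longrightarrow> \<bar>f x - f y\<bar> \<le> B * \<bar>x - y\<bar>"
    using C1_functions_lipschitz[OF C1] by blast
  let ?P = "{(x, y). x \<in> {0..pi} \<and> y \<in> {0..pi} \<and> x \<noteq> y}"
  let ?L = "SUP (x, y)\<in>?P. \<bar>f x - f y\<bar> / \<bar>x - y\<bar>"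
  have "(case (x, y) of (x, y) \<Rightarrow> \<bar>f x - f y\<bar> / \<bar>x - y\<bar>) \<le> ?L"
    using x y False B by (intro cSUP_upper bdd_aboveI[where M = B]) (auto simp: divide_le_eq)
  moreover have "0 \<le> sup_norm f"
  proof -
    obtain B' where "\<And>y. y \<in> {0..pi} \<Longrightarrow> \<bar>f y\<bar> \<le> B'"
      using continuous_on_compact_abs_bound[OF C1_functions_continuous[OF C1] compact_Icc] by blast
    then have "\<bar>f x\<bar> \<le> sup_norm f"
      using x by (intro bounded_le_sup_norm)
    then show ?thesis by linarith
  qed
  moreover have "sup_norm f + ?L \<le> \<tau>1"
    using f by (simp add: C_class_def lip_norm_def)
  ultimately have "\<bar>f x - f y\<bar> / \<bar>x - y\<bar> \<le> \<tau>1" by simp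
  then show ?thesis using False by (simp add: divide_le_eq)
qed simp

lemma H_set_bound:
  assumes f: "f \<in> H_set \<tau>0 \<tau>1 f0 n" and f0: "\<And>x. x \<in> {0..pi} \<Longrightarrow> \<bar>f0 x\<bar> \<le> B" and x: "x \<in> {0..pi}"
  shows "\<bar>f x - f0 x\<bar> \<le> 1 / ln (real n)"
proof -
  have "f \<in> C1_functions" using f by (simp add: H_set_def C_class_def)
  then obtain B' where B': "\<And>y. y \<in> {0..pi} \<Longrightarrow> \<bar>f y\<bar> \<le> B'"
    using continuous_on_compact_abs_bound[OF C1_functions_continuous compact_Icc] by blast
  have "\<bar>f y - f0 y\<bar> \<le> B' + B" if "y \<in> {0..pi}" for y
    using B'[OF that] f0[OF that] by linarith
  then have "\<bar>f x - f0 x\<bar> \<le> sup_norm (\<lambda>x. f x - f0 x)"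
    using x by (intro bounded_le_sup_norm)
  then show ?thesis using f by (simp add: H_set_def)
qed

text \<open>The autocovariances determine \<open>f\<^sub>0\<close> only almost everywhere, so \<open>f\<^sub>0\<close> need not be
  Lipschitz; but then \<open>H_set\<close> is empty for large \<open>n\<close>.\<close>

lemma eventually_H_set_lipschitz:
  assumes f0: "\<And>x. x \<in> {0..pi} \<Longrightarrow> \<bar>f0 x\<bar> \<le> B"
  shows "\<forall>\<^sub>F n in sequentially. H_set \<tau>0 \<tau>1 f0 n \<noteq> {} \<longrightarrow>
    (\<forall>x\<in>{0..pi}. \<forall>y\<in>{0..pi}. \<bar>f0 x - f0 y\<bar> \<le> \<tau>1 * \<bar>x - y\<bar>)"
proof (cases "\<forall>x\<in>{0..pi}. \<forall>y\<in>{0..pi}. \<bar>f0 x - f0 y\<bar> \<le> \<tau>1 * \<bar>x - y\<bar>")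
  case False
  then obtain x y where xy: "x \<in> {0..pi}" "y \<in> {0..pi}" "\<bar>f0 x - f0 y\<bar> > \<tau>1 * \<bar>x - y\<bar>"
    by force
  \<comment> \<open>Replacing \<open>f\<close> by \<open>f0\<close> costs at most
    \<open>1 / ln (real n)\<close> at each of the two points, and twice this amount eventually falls
    below the excess at the pair \<open>x\<close>, \<open>y\<close>.\<close>
  have "(\<lambda>n. 2 * (1 / ln (real n))) \<longlonglongrightarrow> 0"
    by real_asymp
  then have "\<forall>\<^sub>F n in sequentially. 2 * (1 / ln (real n)) < \<bar>f0 x - f0 y\<bar> - \<tau>1 * \<bar>x - y\<bar>"
    using xy(3) by (intro order_tendstoD) auto
  then show ?thesis
  proof eventually_elim
    case (elim n)
    have "f \<notin> H_set \<tau>0 \<tau>1 f0 n" for f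
    proof
      assume f: "f \<in> H_set \<tau>0 \<tau>1 f0 n"
      then have "\<bar>f x - f y\<bar> \<le> \<tau>1 * \<bar>x - y\<bar>"
        using xy by (intro C_class_lipschitz) (auto simp: H_set_def)
      moreover have "\<bar>f x - f0 x\<bar> \<le> 1 / ln (real n)" "\<bar>f y - f0 y\<bar> \<le> 1 / ln (real n)"
        using H_set_bound[OF f f0] xy by auto
      ultimately show False using elim by linarith
    qed
    then show ?case by blast
  qed
qed simp

section \<open>Summation by parts in blocks\<close>

text \<open>Blocks are the index sets with constant \<open>m div L\<close>. Inside its block,
  \<open>g m\<close> is the value at the start of the block plus the increments up to
  \<open>m\<close>. The first part multiplies whole block sums; after exchanging summations each
  increment multiplies a tail sum of its block.\<close>

lemma norm_sum_blocks:
  fixes u :: "nat \<Rightarrow> 'v :: real_normed_vector" and g :: "nat \<Rightarrow> real"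
  assumes L: "L > 0" and A: "\<And>m. m < n \<Longrightarrow> \<bar>g m\<bar> \<le> A"
    and \<Delta>: "\<And>m. Suc m < n \<Longrightarrow> \<bar>g (Suc m) - g m\<bar> \<le> \<Delta>"
  shows "norm (\<Sum>m<n. g m *\<^sub>R u m) \<le>
    A * (\<Sum>b\<le>n div L. norm (\<Sum>m | m < n \<and> m div L = b. u m)) +
    \<Delta> * (\<Sum>l<n. norm (\<Sum>m | m < n \<and> l < m \<and> l div L = m div L. u m))"
proof -
  let ?U = "\<lambda>b. \<Sum>m | m < n \<and> m div L = b. u m"
  let ?T = "\<lambda>l. \<Sum>m | m < n \<and> l < m \<and> l div L = m div L. u m"
  have rel: "(m div L) * L \<le> l \<and> l < m \<longleftrightarrow> l < m \<and> l div L = m div L" for l m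
  proof
    assume a: "(m div L) * L \<le> l \<and> l < m"
    then have "m div L \<le> l div L"
      using L by (simp add: less_eq_div_iff_mult_less_eq)
    moreover have "l div L \<le> m div L"
      using a by (intro div_le_mono) auto
    ultimately show "l < m \<and> l div L = m div L" using a by auto
  next
    assume "l < m \<and> l div L = m div L"
    then show "(m div L) * L \<le> l \<and> l < m"
      by (metis div_times_less_eq_dividend)
  qed
  have tele: "g m = g ((m div L) * L) + (\<Sum>l | l < n \<and> l < m \<and> l div L = m div L. g (Suc l) - g l)" if "m < n" for m
  proof -
    have "(\<Sum>l\<in>{(m div L) * L..<m}. g (Suc l) - g l) = g m - g ((m div L) * L)"
      by (rule sum_Suc_diff') simp
    moreover have "{(m div L) * L..<m} = {l. l < n \<and> l < m \<and> l div L = m div L}"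
      using that rel[of m] by (simp add: set_eq_iff) (meson less_trans)
    ultimately show ?thesis by simp
  qed
  have "(\<Sum>m<n. g m *\<^sub>R u m) = (\<Sum>m<n. g ((m div L) * L) *\<^sub>R u m) +
      (\<Sum>m<n. \<Sum>l\<in>{l\<in>{..<n}. l < m \<and> l div L = m div L}. (g (Suc l) - g l) *\<^sub>R u m)"
  proof -
    have "(\<Sum>m<n. g m *\<^sub>R u m) = (\<Sum>m<n. g ((m div L) * L) *\<^sub>R u m +
      (\<Sum>l\<in>{l\<in>{..<n}. l < m \<and> l div L = m div L}. (g (Suc l) - g l) *\<^sub>R u m))"
    proof (rule sum.cong[OF refl])
      fix m assume "m \<in> {..<n}"
      then show "g m *\<^sub>R u m = g ((m div L) * L) *\<^sub>R u m +
          (\<Sum>l\<in>{l\<in>{..<n}. l < m \<and> l div L = m div L}. (g (Suc l) - g l) *\<^sub>R u m)"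
        by (subst tele) (auto simp: scaleR_left_distrib scaleR_sum_left)
    qed
    then show ?thesis by (simp add: sum.distrib)
  qed
  also have "(\<Sum>m<n. g ((m div L) * L) *\<^sub>R u m) = (\<Sum>b\<le>n div L. g (b * L) *\<^sub>R ?U b)"
  proof -
    have "(\<Sum>m<n. g ((m div L) * L) *\<^sub>R u m) =
       (\<Sum>b\<le>n div L. \<Sum>m\<in>{m\<in>{..<n}. m div L = b}. g ((m div L) * L) *\<^sub>R u m)"
      by (rule sum.group[symmetric]) (auto intro: div_le_mono)
    also have "\<dots> = (\<Sum>b\<le>n div L. g (b * L) *\<^sub>R ?U b)"
      unfolding scaleR_sum_right by (intro sum.cong refl) auto
    finally show ?thesis .
  qed
  also have "(\<Sum>m<n. \<Sum>l\<in>{l\<in>{..<n}. l < m \<and> l div L = m div L}. (g (Suc l) - g l) *\<^sub>R u m) =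
      (\<Sum>l<n. \<Sum>m\<in>{m\<in>{..<n}. l < m \<and> l div L = m div L}. (g (Suc l) - g l) *\<^sub>R u m)"
    by (rule sum.swap_restrict) simp_all
  also have "\<dots> = (\<Sum>l<n. (g (Suc l) - g l) *\<^sub>R ?T l)"
    unfolding scaleR_sum_right by (intro sum.cong refl) auto
  finally have eq: "(\<Sum>m<n. g m *\<^sub>R u m) = (\<Sum>b\<le>n div L. g (b * L) *\<^sub>R ?U b) + (\<Sum>l<n. (g (Suc l) - g l) *\<^sub>R ?T l)" .
  have "norm (\<Sum>b\<le>n div L. g (b * L) *\<^sub>R ?U b) \<le> (\<Sum>b\<le>n div L. A * norm (?U b))"
  proof (rule sum_norm_le)
    fix b
    show "norm (g (b * L) *\<^sub>R ?U b) \<le> A * norm (?U b)"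
    \<comment> \<open>When \<open>L\<close> divides \<open>n\<close> the last block is empty and
      \<open>g (b * L)\<close> lies outside the range where \<open>A\<close> applies, but then the
      block sum is 0.\<close>
    proof (cases "{m. m < n \<and> m div L = b} = {}")
      case False
      then obtain m where "m < n" "m div L = b" by auto
      then have "b * L < n" using div_times_less_eq_dividend[of m L] by (metis le_less_trans)
      then show ?thesis by (simp add: mult_right_mono A)
    qed (simp only: sum.empty, simp)
  qed
  moreover have "norm (\<Sum>l<n. (g (Suc l) - g l) *\<^sub>R ?T l) \<le> (\<Sum>l<n. \<Delta> * norm (?T l))"
  proof (rule sum_norm_le)
    fix l
    show "norm ((g (Suc l) - g l) *\<^sub>R ?T l) \<le> \<Delta> * norm (?T l)"
    \<comment> \<open>For \<open>l = n - 1\<close> the increment leaves the range controlled by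
      \<open>\<Delta>\<close>, but there the tail sum is empty.\<close>
    proof (cases "{m. m < n \<and> l < m \<and> l div L = m div L} = {}")
      case False
      then obtain m where "m < n" "l < m" by auto
      then show ?thesis by (simp add: mult_right_mono \<Delta>)
    qed (simp only: sum.empty, simp)
  qed
  ultimately show ?thesis
    unfolding eq sum_distrib_left by (intro order.trans[OF norm_triangle_ineq] add_mono)
qed

text \<open>Cauchy-Schwarz trades sums of norms for sums of squared norms, whose expectations can be
  computed, at the price of the number of terms: \<open>n div L + 1\<close> blocks and
  \<open>n\<close> tails.\<close>

lemma norm_sum_blocks_squared:
  fixes u :: "nat \<Rightarrow> 'v :: real_normed_vector" and g :: "nat \<Rightarrow> real"
  assumes "L > 0" "\<And>m. m < n \<Longrightarrow> \<bar>g m\<bar> \<le> A" "\<And>m. Suc m < n \<Longrightarrow> \<bar>g (Suc m) - g m\<bar> \<le> \<Delta>"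
  shows "(norm (\<Sum>m<n. g m *\<^sub>R u m))\<^sup>2 \<le>
    2 * A\<^sup>2 * real (n div L + 1) * (\<Sum>b\<le>n div L. (norm (\<Sum>m | m < n \<and> m div L = b. u m))\<^sup>2) +
    2 * \<Delta>\<^sup>2 * real n * (\<Sum>l<n. (norm (\<Sum>m | m < n \<and> l < m \<and> l div L = m div L. u m))\<^sup>2)"
proof -
  define U where "U = (\<lambda>b. norm (\<Sum>m | m < n \<and> m div L = b. u m))"
  define T where "T = (\<lambda>l. norm (\<Sum>m | m < n \<and> l < m \<and> l div L = m div L. u m))"
  have "norm (\<Sum>m<n. g m *\<^sub>R u m) \<le> A * (\<Sum>b\<le>n div L. U b) + \<Delta> * (\<Sum>l<n. T l)"
    unfolding U_def T_def using assms by (rule norm_sum_blocks)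
  then have "(norm (\<Sum>m<n. g m *\<^sub>R u m))\<^sup>2 \<le> (A * (\<Sum>b\<le>n div L. U b) + \<Delta> * (\<Sum>l<n. T l))\<^sup>2"
    by (intro power_mono) auto
  also have "\<dots> \<le> 2 * (A * (\<Sum>b\<le>n div L. U b))\<^sup>2 + 2 * (\<Delta> * (\<Sum>l<n. T l))\<^sup>2"
  proof -
    have "(x + y)\<^sup>2 \<le> 2 * x\<^sup>2 + 2 * y\<^sup>2" for x y :: real
      using zero_le_power2[of "x - y"] by (simp add: power2_sum power2_diff)
    then show ?thesis .
  qed
  also have "\<dots> \<le> 2 * A\<^sup>2 * ((\<Sum>b\<le>n div L. (U b)\<^sup>2) * real (n div L + 1)) + 2 * \<Delta>\<^sup>2 * ((\<Sum>l<n. (T l)\<^sup>2) * real n)"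
  proof -
    have "(\<Sum>b\<le>n div L. U b)\<^sup>2 \<le> (\<Sum>b\<le>n div L. (U b)\<^sup>2) * real (n div L + 1)"
      using sum_squared_le_sum_of_squares[of U "{..n div L}"] by (simp add: add.commute)
    moreover have "(\<Sum>l<n. T l)\<^sup>2 \<le> (\<Sum>l<n. (T l)\<^sup>2) * real n"
      using sum_squared_le_sum_of_squares[of T "{..<n}"] by simp
    ultimately show ?thesis
      unfolding power_mult_distrib mult.assoc by (intro add_mono mult_left_mono) auto
  qed
  finally show ?thesis
    unfolding U_def T_def by (simp add: mult_ac)
qed

text \<open>Bounds in how many tail sums a given index \<open>m\<close> occurs.\<close>

lemma card_block_initial:
  fixes L :: nat
  assumes "L > 0"
  shows "card {l. l < n \<and> l < m \<and> l div L = m div L} \<le> L"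
proof -
  have "{l. l < n \<and> l < m \<and> l div L = m div L} \<subseteq> {m div L * L..<m div L * L + L}"
    using div_times_less_eq_dividend[of _ L] mod_less_divisor[OF assms]
    by (auto simp: div_mult_mod_eq) (metis div_times_less_eq_dividend, metis div_mult_mod_eq nat_add_left_cancel_less)
  then show ?thesis
    using card_mono[of "{m div L * L..<m div L * L + L}"] by fastforce
qed

section \<open>Moments of the block sums\<close>

lemma whittle_second_moment_Suc:
  fixes b :: "nat \<Rightarrow> 'v :: euclidean_space"
  assumes D: "\<forall>m\<in>{1..n}. D_entry n f m > 0" and A: "A \<subseteq> {..<n}"
  shows "has_bochner_integral (whittle_measure X n \<theta> f)
    (\<lambda>z. (norm (\<Sum>m\<in>A. centered_data X n \<theta> z (Suc m) *\<^sub>R b m))\<^sup>2) (\<Sum>m\<in>A. D_entry n f (Suc m) * (norm (b m))\<^sup>2)"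
proof -
  \<comment> \<open>Blocks \<open>m div L\<close> are counted from 0 while Fourier rows are counted
    from 1, hence the shift.\<close>
  have "Suc ` A \<subseteq> {1..n}" using A by auto
  from whittle_second_moment[OF D this, of X \<theta> "\<lambda>m. b (m - 1)"] show ?thesis
    by (simp add: sum.reindex)
qed

text \<open>The right-hand side of \<open>norm_sum_blocks_squared\<close> with \<open>u m\<close>
  the centred datum times the design row at \<open>Suc m\<close>. The weights enter only through
  their bounds \<open>A\<close> and \<open>\<Delta>\<close>, so the statistic does not depend on the
  competing spectral density.\<close>

definition block_statistic ::
    "(nat \<Rightarrow> nat \<Rightarrow> real ^ 'r) \<Rightarrow> nat \<Rightarrow> real ^ 'r \<Rightarrow> nat \<Rightarrow> real \<Rightarrow> real \<Rightarrow> (nat \<Rightarrow> real) \<Rightarrow> real" where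
  "block_statistic X n \<theta> L A \<Delta> z =
    2 * A\<^sup>2 * real (n div L + 1) * (\<Sum>b\<le>n div L. (norm (\<Sum>m | m < n \<and> m div L = b.
        centered_data X n \<theta> z (Suc m) *\<^sub>R fourier_design X n (Suc m)))\<^sup>2) +
    2 * \<Delta>\<^sup>2 * real n * (\<Sum>l<n. (norm (\<Sum>m | m < n \<and> l < m \<and> l div L = m div L.
        centered_data X n \<theta> z (Suc m) *\<^sub>R fourier_design X n (Suc m)))\<^sup>2)"

lemma block_statistic_nonneg: "0 \<le> block_statistic X n \<theta> L A \<Delta> z"
  unfolding block_statistic_def by (intro add_nonneg_nonneg mult_nonneg_nonneg sum_nonneg) auto

text \<open>The blocks partition the indices, so their second moments add up to the full sum; in the
  tail sums every index is counted at most \<open>L\<close> times.\<close>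

lemma block_statistic_expectation:
  assumes D: "\<forall>m\<in>{1..n}. D_entry n f m > 0" and L: "L > 0"
  shows "integrable (whittle_measure X n \<theta> f) (block_statistic X n \<theta> L A \<Delta>)"
    and "(LINT z|whittle_measure X n \<theta> f. block_statistic X n \<theta> L A \<Delta> z) \<le>
      (2 * A\<^sup>2 * real (n div L + 1) + 2 * \<Delta>\<^sup>2 * real n * real L) *
      (\<Sum>m=1..n. D_entry n f m * (norm (fourier_design X n m))\<^sup>2)"
proof -
  let ?P = "whittle_measure X n \<theta> f"
  let ?u = "\<lambda>z m. centered_data X n \<theta> z (Suc m) *\<^sub>R fourier_design X n (Suc m)"
  define v where "v m = D_entry n f (Suc m) * (norm (fourier_design X n (Suc m)))\<^sup>2" for m
  have v: "v m \<ge> 0" if "m < n" for m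
    using D that by (auto simp: v_def less_imp_le)
  have V: "(\<Sum>m=1..n. D_entry n f m * (norm (fourier_design X n m))\<^sup>2) = (\<Sum>m<n. v m)"
    unfolding One_nat_def sum.atLeast1_atMost_eq v_def ..
  have U: "has_bochner_integral ?P (\<lambda>z. \<Sum>b\<le>n div L. (norm (\<Sum>m | m < n \<and> m div L = b. ?u z m))\<^sup>2)
      (\<Sum>b\<le>n div L. \<Sum>m | m < n \<and> m div L = b. v m)"
    unfolding v_def by (intro has_bochner_integral_sum whittle_second_moment_Suc[OF D]) auto
  have U_sum: "(\<Sum>b\<le>n div L. \<Sum>m | m < n \<and> m div L = b. v m) = (\<Sum>m<n. v m)"
  proof -
    have "(\<lambda>m. m div L) ` {..<n} \<subseteq> {..n div L}"
      by (auto intro!: div_le_mono)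
    then show ?thesis
      using sum.group[of "{..<n}" "{..n div L}" "\<lambda>m. m div L" v] by simp
  qed
  have T: "has_bochner_integral ?P (\<lambda>z. \<Sum>l<n. (norm (\<Sum>m | m < n \<and> l < m \<and> l div L = m div L. ?u z m))\<^sup>2)
      (\<Sum>l<n. \<Sum>m | m < n \<and> l < m \<and> l div L = m div L. v m)"
    unfolding v_def by (intro has_bochner_integral_sum whittle_second_moment_Suc[OF D]) auto
  have "(\<Sum>l<n. \<Sum>m\<in>{m\<in>{..<n}. l < m \<and> l div L = m div L}. v m) =
      (\<Sum>m<n. \<Sum>l\<in>{l\<in>{..<n}. l < m \<and> l div L = m div L}. v m)"
    by (rule sum.swap_restrict) simp_all
  also have "\<dots> \<le> (\<Sum>m<n. real L * v m)"
    using v card_block_initial[OF L, of n] by (intro sum_mono) (simp add: mult_right_mono)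
  finally have T_sum: "(\<Sum>l<n. \<Sum>m | m < n \<and> l < m \<and> l div L = m div L. v m) \<le> real L * (\<Sum>m<n. v m)"
    by (simp add: sum_distrib_left)
  have B: "has_bochner_integral ?P (block_statistic X n \<theta> L A \<Delta>)
     (2 * A\<^sup>2 * real (n div L + 1) * (\<Sum>m<n. v m) +
      2 * \<Delta>\<^sup>2 * real n * (\<Sum>l<n. \<Sum>m | m < n \<and> l < m \<and> l div L = m div L. v m))"
    unfolding block_statistic_def[abs_def]
    by (intro has_bochner_integral_add has_bochner_integral_mult_right U[unfolded U_sum] T)
  then show "integrable ?P (block_statistic X n \<theta> L A \<Delta>)"
    by (rule integrable.intros)
  have "2 * \<Delta>\<^sup>2 * real n * (\<Sum>l<n. \<Sum>m | m < n \<and> l < m \<and> l div L = m div L. v m) \<le>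
      2 * \<Delta>\<^sup>2 * real n * (real L * (\<Sum>m<n. v m))"
    using T_sum by (intro mult_left_mono) auto
  then show "(LINT z|?P. block_statistic X n \<theta> L A \<Delta> z) \<le>
      (2 * A\<^sup>2 * real (n div L + 1) + 2 * \<Delta>\<^sup>2 * real n * real L) *
      (\<Sum>m=1..n. D_entry n f m * (norm (fourier_design X n m))\<^sup>2)"
    unfolding has_bochner_integral_integral_eq[OF B] V by (simp add: algebra_simps)
qed

section \<open>The log likelihood ratio, the score and measurability of suprema\<close>

lemma log_whittle_ratio:
  assumes D: "\<forall>m\<in>{1..n}. D_entry n f m > 0"
  shows "ln (whittle_density X n \<theta> f z / whittle_density X n \<theta>0 f z) =
    (\<Sum>m=1..n. centered_data X n \<theta>0 z m * (fourier_design X n m \<bullet> (\<theta> - \<theta>0)) / D_entry n f m) -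
    1 / 2 * (\<Sum>m=1..n. (fourier_design X n m \<bullet> (\<theta> - \<theta>0))\<^sup>2 / D_entry n f m)"
proof -
  let ?E = "\<lambda>\<theta>. (\<Sum>m=1..n. (fourier_data n z m - fourier_design X n m \<bullet> \<theta>)\<^sup>2 / D_entry n f m)"
  \<comment> \<open>Both densities have the same \<open>f\<close>, so the normalising constants,
    here seen to be nonzero, cancel.\<close>
  have "(2 * pi) ^ n * (\<Prod>m=1..n. D_entry n f m) > 0"
    using D by (intro mult_pos_pos prod_pos) auto
  then have "whittle_density X n \<theta> f z / whittle_density X n \<theta>0 f z = exp (- (1 / 2) * ?E \<theta>) / exp (- (1 / 2) * ?E \<theta>0)"
    using D by (force simp: whittle_density_def)
  then have "ln (whittle_density X n \<theta> f z / whittle_density X n \<theta>0 f z) = 1 / 2 * (?E \<theta>0 - ?E \<theta>)"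
    by (simp add: exp_diff[symmetric] algebra_simps)
  also have "?E \<theta>0 - ?E \<theta> = (\<Sum>m=1..n. 2 * (centered_data X n \<theta>0 z m * (fourier_design X n m \<bullet> (\<theta> - \<theta>0)) / D_entry n f m) -
      (fourier_design X n m \<bullet> (\<theta> - \<theta>0))\<^sup>2 / D_entry n f m)"
    unfolding sum_subtractf[symmetric] centered_data_def
    by (intro sum.cong refl) (simp add: diff_divide_distrib[symmetric] power2_eq_square algebra_simps)
  also have "1 / 2 * \<dots> = (\<Sum>m=1..n. centered_data X n \<theta>0 z m * (fourier_design X n m \<bullet> (\<theta> - \<theta>0)) / D_entry n f m) -
    1 / 2 * (\<Sum>m=1..n. (fourier_design X n m \<bullet> (\<theta> - \<theta>0))\<^sup>2 / D_entry n f m)"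
    unfolding sum_subtractf sum_distrib_left[symmetric] by simp
  finally show ?thesis .
qed

text \<open>A linear combination of the centred data with deterministic vectors, the form to which
  \<open>whittle_second_moment\<close> applies.\<close>

lemma G_vec_altdef:
  "G_vec X \<theta>0 f0 n z = (\<Sum>m=1..n. centered_data X n \<theta>0 z m *\<^sub>R
     ((1 / D_entry n f0 m) *\<^sub>R (matrix_inv (mat_sqrt (S_mat X f0 n)) *v fourier_design X n m)))"
proof -
  have lin: "linear (\<lambda>x. matrix_inv (mat_sqrt (S_mat X f0 n)) *v x)" by simp
  show ?thesis
    unfolding G_vec_def centered_data_def linear_sum[OF lin]
    by (simp add: matrix_vector_mult_scaleR)
qed

lemma G_vec_measurable:
  "G_vec X \<theta>0 f0 n \<in> borel_measurable (whittle_measure X n \<theta> f)"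
  unfolding whittle_measurable_cong G_vec_altdef[abs_def] by measurable

text \<open>The index set may be uncountable, so measurability of each \<open>\<phi> p\<close> alone
  would not carry over. Continuity makes the superlevel sets of the supremum unions of open sets,
  hence open in the product topology, whose Borel sets are those of the product
  sigma-algebra.\<close>

lemma SUP_continuous_measurable_PiM:
  fixes \<phi> :: "'p \<Rightarrow> (nat \<Rightarrow> real) \<Rightarrow> ennreal"
  assumes "\<And>p. p \<in> J \<Longrightarrow> continuous_on UNIV (\<phi> p)"
  shows "(\<lambda>z. SUP p\<in>J. \<phi> p z) \<in> borel_measurable (Pi\<^sub>M I (\<lambda>_. lborel))"
proof -
  have sup: "(\<lambda>z. SUP p\<in>J. \<phi> p z) \<in> borel_measurable borel"
  proof (rule borel_measurableI_greater)
    fix y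
    have "open {z. y < \<phi> p z}" if "p \<in> J" for p
      using assms[OF that] by (intro open_Collect_less) auto
    then have "open (\<Union>p\<in>J. {z. y < \<phi> p z})" by blast
    moreover have "{z \<in> space borel. y < (SUP p\<in>J. \<phi> p z)} = (\<Union>p\<in>J. {z. y < \<phi> p z})"
      by (auto simp: less_SUP_iff)
    ultimately show "{z \<in> space borel. y < (SUP p\<in>J. \<phi> p z)} \<in> sets borel" by simp
  qed
  have "(\<lambda>z. z) \<in> measurable (Pi\<^sub>M I (\<lambda>_. lborel)) (Pi\<^sub>M UNIV (\<lambda>_. borel :: real measure))"
  proof (rule measurable_PiM_single')
    fix i :: nat
    show "(\<lambda>z. z i) \<in> borel_measurable (Pi\<^sub>M I (\<lambda>_. lborel :: real measure))"
    proof (cases "i \<in> I")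
      \<comment> \<open>Points of the product space take the constant value \<open>undefined\<close>
        outside \<open>I\<close>.\<close>
      case False
      then have "z i = undefined" if "z \<in> space (Pi\<^sub>M I (\<lambda>_. lborel :: real measure))" for z
        using that by (auto simp: space_PiM PiE_def extensional_def)
      then show ?thesis
        by (subst measurable_cong[where g = "\<lambda>_. undefined"]) simp_all
    qed simp
  qed (auto simp: space_PiM)
  then have "(\<lambda>z. z) \<in> measurable (Pi\<^sub>M I (\<lambda>_. lborel)) (borel :: (nat \<Rightarrow> real) measure)"
    using measurable_cong_sets[OF refl sets_PiM_equal_borel] by blast
  from measurable_compose[OF this sup] show ?thesis .
qed

section \<open>The remainder of the log likelihood ratio\<close>

lemma D_entry_bounds:
  assumes f0: "\<And>x. x \<in> {0..pi} \<Longrightarrow> \<tau>0 \<le> f0 x \<and> f0 x \<le> \<tau>1" and m: "m \<in> {1..n}"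
  shows "2 * pi * \<tau>0 \<le> D_entry n f0 m" "D_entry n f0 m \<le> 2 * pi * \<tau>1"
  using f0[OF fourier_freq_in_half_period[OF m]] by (simp_all add: D_entry_def mult_left_mono)

lemma C_class_D_entry_pos:
  assumes "f \<in> C_class \<tau>0 \<tau>1"
  shows "\<forall>m\<in>{1..n}. D_entry n f m > 0"
  using assms fourier_freq_in_half_period by (auto simp: C_class_def D_entry_def)

text \<open>Raising every diagonal entry to its upper bound \<open>d\<close> reduces the form to the
  Gram form divided by \<open>d\<close>, by Parseval's identity.\<close>

lemma S_mat_lower_bound:
  assumes D: "\<And>m. m \<in> {1..n} \<Longrightarrow> 0 < D_entry n f0 m \<and> D_entry n f0 m \<le> d"
    and gram: "c * real n * (h \<bullet> h) \<le> h \<bullet> (gram_mat X n *v h)" and "d > 0"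
  shows "c / d * real n * (h \<bullet> h) \<le> h \<bullet> (S_mat X f0 n *v h)"
proof -
  have "c / d * real n * (h \<bullet> h) \<le> (h \<bullet> (gram_mat X n *v h)) / d"
    using gram \<open>d > 0\<close> by (simp add: field_simps)
  also have "\<dots> = (\<Sum>m=1..n. (fourier_design X n m \<bullet> h)\<^sup>2 / d)"
    by (simp add: fourier_design_parseval[symmetric] sum_divide_distrib)
  also have "\<dots> \<le> (\<Sum>m=1..n. (fourier_design X n m \<bullet> h)\<^sup>2 / D_entry n f0 m)"
    using D by (intro sum_mono divide_left_mono) (auto intro: mult_pos_pos \<open>d > 0\<close>)
  finally show ?thesis
    by (simp add: inner_S_mat power2_eq_square)
qed

lemma S_mat_sym_pos_def:
  assumes "\<And>h. s * (h \<bullet> h) \<le> h \<bullet> (S_mat X f0 n *v h)" "s > 0"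
  shows "sym_pos_def (S_mat X f0 n)"
  unfolding sym_pos_def_def
proof (intro conjI allI impI transpose_S_mat)
  fix h :: "real ^ 'a" assume "h \<noteq> 0"
  then have "0 < s * (h \<bullet> h)" using \<open>s > 0\<close> by simp
  then show "0 < h \<bullet> (S_mat X f0 n *v h)" using assms(1)[of h] by linarith
qed

text \<open>For \<open>u = A\<^sup>-\<^sup>1\<^sup>/\<^sup>2 x\<close> one has
  \<open>x \<bullet> x = u \<bullet> (A *v u)\<close>, and the lower bound on \<open>A\<close>
  applies to \<open>u\<close>.\<close>

lemma norm_inv_mat_sqrt_bound:
  fixes A :: "real ^ 'r ^ 'r"
  assumes A: "sym_pos_def A" and low: "\<And>h. s * (h \<bullet> h) \<le> h \<bullet> (A *v h)" and "s > 0"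
  shows "(norm (matrix_inv (mat_sqrt A) *v x))\<^sup>2 \<le> (norm x)\<^sup>2 / s"
proof -
  define u where "u = matrix_inv (mat_sqrt A) *v x"
  have B: "transpose (mat_sqrt A) = mat_sqrt A"
    using mat_sqrt(1)[OF A] by (simp add: sym_pos_def_def)
  have "mat_sqrt A *v u = x"
    unfolding u_def by (rule sym_pos_def_matrix_inv[OF mat_sqrt(1)[OF A]])
  then have "x \<bullet> x = u \<bullet> (mat_sqrt A *v (mat_sqrt A *v u))"
    by (simp add: symmetric_matrix_inner[OF B])
  also have "\<dots> = u \<bullet> (A *v u)"
    by (simp add: matrix_vector_mul_assoc mat_sqrt(2)[OF A])
  finally have "s * (u \<bullet> u) \<le> x \<bullet> x" using low[of u] by simp
  then show ?thesis
    using \<open>s > 0\<close> by (simp add: u_def power2_norm_eq_inner field_simps)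
qed

text \<open>Markov's inequality for the squared norm, with closed balls as compact sets. Tightness
  concerns all \<open>n\<close>, so the finitely many early moments are absorbed into a
  maximum.\<close>

lemma tight_seqI_second_moment:
  fixes Y :: "nat \<Rightarrow> 'w \<Rightarrow> 'b :: euclidean_space"
  assumes P: "\<And>n. prob_space (P n)" and Y: "\<And>n. Y n \<in> borel_measurable (P n)"
    and Q: "\<And>n. has_bochner_integral (P n) (\<lambda>w. (norm (Y n w))\<^sup>2) (Q n)"
    and bd: "\<forall>\<^sub>F n in sequentially. Q n \<le> q"
  shows "tight_seq P Y"
  unfolding tight_seq_def
proof (intro conjI allI impI)
  fix \<epsilon> :: real assume \<epsilon>: "\<epsilon> > 0"
  obtain N where N: "\<And>n. n \<ge> N \<Longrightarrow> Q n \<le> q"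
    using bd by (auto simp: eventually_sequentially)
  \<comment> \<open>The entry 1 keeps the bound, and with it the radius of the ball,
    positive.\<close>
  define q' where "q' = Max (insert 1 (insert q (Q ` {..<N})))"
  have q': "Q n \<le> q'" for n
  proof (cases "n < N")
    case True
    then show ?thesis unfolding q'_def by (intro Max_ge) auto
  next
    case False
    then have "Q n \<le> q" using N by simp
    also have "q \<le> q'" unfolding q'_def by (rule Max_ge) auto
    finally show ?thesis .
  qed
  have "1 \<le> q'" unfolding q'_def by (rule Max_ge) auto
  define \<rho> where "\<rho> = sqrt (q' / \<epsilon>)"
  have \<rho>: "\<rho>\<^sup>2 = q' / \<epsilon>" "\<rho> > 0"
    using \<epsilon> \<open>1 \<le> q'\<close> by (auto simp: \<rho>_def)
  have "measure (P n) {w \<in> space (P n). Y n w \<notin> cball 0 \<rho>} \<le> \<epsilon>" for n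
  proof -
    interpret prob_space "P n" by (rule P)
    note Y[of n, measurable]
    have "measure (P n) {w \<in> space (P n). Y n w \<notin> cball 0 \<rho>} \<le> measure (P n) {w \<in> space (P n). (norm (Y n w))\<^sup>2 \<ge> \<rho>\<^sup>2}"
      using \<rho>(2) by (intro finite_measure_mono) (auto intro!: power_mono)
    also have "\<dots> \<le> (LINT w|P n. (norm (Y n w))\<^sup>2) / \<rho>\<^sup>2"
      using Q[of n] \<rho>(2) by (intro integral_Markov_inequality_measure[where A = "{}"]) (auto intro: integrable.intros)
    also have "\<dots> = Q n / q' * \<epsilon>"
      using \<epsilon> by (simp add: has_bochner_integral_integral_eq[OF Q] \<rho>)
    also have "\<dots> \<le> 1 * \<epsilon>"
      using \<epsilon> q'[of n] \<open>1 \<le> q'\<close> by (intro mult_right_mono) auto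
    finally show ?thesis by simp
  qed
  then show "\<exists>K. compact K \<and> (\<forall>n. measure (P n) {w \<in> space (P n). Y n w \<notin> K} \<le> \<epsilon>)"
    by (intro exI[of _ "cball 0 \<rho>"]) auto
qed (use P Y in auto)

section \<open>Size and increments of the differences of inverse spectral weights\<close>

lemma abs_diff_inverse_le:
  fixes a b :: real
  assumes "t \<le> a" "t \<le> b" "t > 0"
  shows "\<bar>1 / a - 1 / b\<bar> \<le> \<bar>a - b\<bar> / t\<^sup>2"
proof -
  have "\<bar>1 / a - 1 / b\<bar> = \<bar>a - b\<bar> / (a * b)"
    using assms by (simp add: divide_simps abs_mult abs_minus_commute)
  also have "\<dots> \<le> \<bar>a - b\<bar> / t\<^sup>2"
    using assms by (intro divide_left_mono) (auto simp: power2_eq_square intro!: mult_mono)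
  finally show ?thesis .
qed

definition weight_diff :: "nat \<Rightarrow> (real \<Rightarrow> real) \<Rightarrow> (real \<Rightarrow> real) \<Rightarrow> nat \<Rightarrow> real" where
  "weight_diff n f f0 m = 1 / D_entry n f m - 1 / D_entry n f0 m"

text \<open>The absolute bound supplies \<open>A\<close> for the linear part of the remainder. The
  bound relative to \<open>1 / D_entry n f0 m\<close> compares the quadratic part with the form of
  \<open>S_mat\<close>.\<close>

lemma weight_diff_bound:
  assumes \<tau>0: "\<tau>0 > 0" and fx: "\<And>x. x \<in> {0..pi} \<Longrightarrow> \<tau>0 \<le> f x" "\<And>x. x \<in> {0..pi} \<Longrightarrow> \<tau>0 \<le> f0 x"
    and diff: "\<And>x. x \<in> {0..pi} \<Longrightarrow> \<bar>f x - f0 x\<bar> \<le> \<delta>" and m: "m \<in> {1..n}"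
  shows "\<bar>weight_diff n f f0 m\<bar> \<le> \<delta> / (2 * pi * \<tau>0\<^sup>2)"
    and "\<bar>weight_diff n f f0 m\<bar> \<le> \<delta> / \<tau>0 * (1 / D_entry n f0 m)"
proof -
  let ?x = "fourier_freq n (m div 2)"
  have x: "?x \<in> {0..pi}" by (rule fourier_freq_in_half_period[OF m])
  have eq: "weight_diff n f f0 m = (1 / f ?x - 1 / f0 ?x) / (2 * pi)"
    by (simp add: weight_diff_def D_entry_def diff_divide_distrib mult.commute)
  have "\<bar>1 / f ?x - 1 / f0 ?x\<bar> \<le> \<bar>f ?x - f0 ?x\<bar> / \<tau>0\<^sup>2"
    using fx[OF x] \<tau>0 by (intro abs_diff_inverse_le)
  also have "\<dots> \<le> \<delta> / \<tau>0\<^sup>2"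
    using diff[OF x] by (intro divide_right_mono) auto
  finally show "\<bar>weight_diff n f f0 m\<bar> \<le> \<delta> / (2 * pi * \<tau>0\<^sup>2)"
    unfolding eq by (simp add: field_simps)
  have pos: "f ?x > 0" "f0 ?x > 0" using fx[OF x] \<tau>0 by auto
  have "\<bar>1 / f ?x - 1 / f0 ?x\<bar> = \<bar>f ?x - f0 ?x\<bar> / f ?x * (1 / f0 ?x)"
    using pos by (simp add: divide_simps abs_mult abs_minus_commute)
  also have "\<dots> \<le> \<delta> / \<tau>0 * (1 / f0 ?x)"
    using fx[OF x] \<tau>0 diff[OF x] pos by (intro mult_right_mono frac_le) auto
  finally show "\<bar>weight_diff n f f0 m\<bar> \<le> \<delta> / \<tau>0 * (1 / D_entry n f0 m)"
    unfolding eq by (simp add: D_entry_def field_simps)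
qed

text \<open>The Lipschitz constant meets the frequency spacing \<open>2 * pi / n\<close>, whose
  factor \<open>2 * pi\<close> cancels against the one in \<open>D_entry\<close>.\<close>

lemma inverse_D_entry_step:
  assumes \<tau>0: "\<tau>0 > 0" and fx: "\<And>x. x \<in> {0..pi} \<Longrightarrow> \<tau>0 \<le> f x"
    and lip: "\<And>x y. x \<in> {0..pi} \<Longrightarrow> y \<in> {0..pi} \<Longrightarrow> \<bar>f x - f y\<bar> \<le> \<tau>1 * \<bar>x - y\<bar>" and "\<tau>1 \<ge> 0"
    and m: "m \<in> {1..n}" "Suc m \<in> {1..n}"
  shows "\<bar>1 / D_entry n f (Suc m) - 1 / D_entry n f m\<bar> \<le> \<tau>1 / (\<tau>0\<^sup>2 * real n)"
proof -
  let ?x = "fourier_freq n (Suc m div 2)" and ?y = "fourier_freq n (m div 2)"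
  have xy: "?x \<in> {0..pi}" "?y \<in> {0..pi}" using fourier_freq_in_half_period m by blast+
  have n: "n > 0" using m by auto
  have "\<bar>1 / f ?x - 1 / f ?y\<bar> \<le> \<bar>f ?x - f ?y\<bar> / \<tau>0\<^sup>2"
    using fx xy \<tau>0 by (intro abs_diff_inverse_le) auto
  also have "\<dots> \<le> (\<tau>1 * (2 * pi / real n)) / \<tau>0\<^sup>2"
    by (intro divide_right_mono order.trans[OF lip[OF xy]] mult_left_mono fourier_freq_step n)
      (use \<open>\<tau>1 \<ge> 0\<close> in auto)
  finally have "\<bar>1 / f ?x - 1 / f ?y\<bar> / (2 * pi) \<le> (\<tau>1 * (2 * pi / real n)) / \<tau>0\<^sup>2 / (2 * pi)"
    by (intro divide_right_mono) auto
  moreover have "1 / D_entry n f (Suc m) - 1 / D_entry n f m = (1 / f ?x - 1 / f ?y) / (2 * pi)"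
    by (simp add: D_entry_def diff_divide_distrib mult.commute)
  ultimately show ?thesis
    by (simp add: abs_divide mult_ac)
qed

text \<open>Taking the difference itself as the remainder makes the expansion an identity for every
  \<open>n\<close>, including those for which \<open>S_mat\<close> is singular.\<close>

definition whittle_remainder ::
    "(nat \<Rightarrow> nat \<Rightarrow> real ^ 'r) \<Rightarrow> real ^ 'r \<Rightarrow> (real \<Rightarrow> real) \<Rightarrow> nat \<Rightarrow> real ^ 'r \<Rightarrow> (real \<Rightarrow> real) \<Rightarrow> (nat \<Rightarrow> real) \<Rightarrow> real" where
  "whittle_remainder X \<theta>0 f0 n \<theta> f z =
     ln (whittle_density X n \<theta> f z / whittle_density X n \<theta>0 f z)
     - (\<theta> - \<theta>0) \<bullet> (mat_sqrt (S_mat X f0 n) *v G_vec X \<theta>0 f0 n z)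
     + 1 / 2 * ((\<theta> - \<theta>0) \<bullet> (S_mat X f0 n *v (\<theta> - \<theta>0)))"

text \<open>Positive definiteness lets the root of \<open>S_mat\<close> cancel its inverse inside
  \<open>G_vec\<close>. Linear and quadratic terms then have the same shape under \<open>f\<close>
  and \<open>f0\<close> and differ in the weights alone.\<close>

lemma whittle_remainder_eq:
  assumes D: "\<forall>m\<in>{1..n}. D_entry n f m > 0" and S: "sym_pos_def (S_mat X f0 n)"
  shows "whittle_remainder X \<theta>0 f0 n \<theta> f z =
    (\<theta> - \<theta>0) \<bullet> (\<Sum>m=1..n. weight_diff n f f0 m *\<^sub>R (centered_data X n \<theta>0 z m *\<^sub>R fourier_design X n m))
    - 1 / 2 * (\<Sum>m=1..n. (fourier_design X n m \<bullet> (\<theta> - \<theta>0))\<^sup>2 * weight_diff n f f0 m)"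
proof -
  define h where "h = \<theta> - \<theta>0"
  let ?y = "centered_data X n \<theta>0 z" and ?x = "fourier_design X n"
  have "mat_sqrt (S_mat X f0 n) *v G_vec X \<theta>0 f0 n z = (\<Sum>m=1..n. (?y m / D_entry n f0 m) *\<^sub>R ?x m)"
    unfolding G_vec_def centered_data_def by (rule sym_pos_def_matrix_inv[OF mat_sqrt(1)[OF S]])
  then have lin: "h \<bullet> (mat_sqrt (S_mat X f0 n) *v G_vec X \<theta>0 f0 n z) = (\<Sum>m=1..n. ?y m * (?x m \<bullet> h) / D_entry n f0 m)"
    by (simp only: inner_sum_right) (simp add: inner_commute)
  have 1: "(\<Sum>m=1..n. ?y m * (?x m \<bullet> h) / D_entry n f m) - (\<Sum>m=1..n. ?y m * (?x m \<bullet> h) / D_entry n f0 m) =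
      h \<bullet> (\<Sum>m=1..n. weight_diff n f f0 m *\<^sub>R (?y m *\<^sub>R ?x m))"
    unfolding inner_sum_right sum_subtractf[symmetric]
    by (intro sum.cong refl) (simp add: weight_diff_def inner_commute[of h] left_diff_distrib)
  have 2: "(\<Sum>m=1..n. (?x m \<bullet> h)\<^sup>2 / D_entry n f m) - (\<Sum>m=1..n. (?x m \<bullet> h)\<^sup>2 / D_entry n f0 m) =
      (\<Sum>m=1..n. (?x m \<bullet> h)\<^sup>2 * weight_diff n f f0 m)"
    unfolding sum_subtractf[symmetric]
    by (intro sum.cong refl) (simp add: weight_diff_def right_diff_distrib)
  have S_form: "h \<bullet> (S_mat X f0 n *v h) = (\<Sum>m=1..n. (?x m \<bullet> h)\<^sup>2 / D_entry n f0 m)"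
    by (simp only: inner_S_mat power2_eq_square)
  show ?thesis
    unfolding whittle_remainder_def h_def[symmetric] log_whittle_ratio[OF D] lin S_form 1[symmetric] 2[symmetric]
    by (simp only: right_diff_distrib)
qed

lemma whittle_remainder_continuous:
  assumes D: "\<forall>m\<in>{1..n}. D_entry n f m > 0"
  shows "continuous_on UNIV (whittle_remainder X \<theta>0 f0 n \<theta> f)"
proof -
  have c: "continuous_on UNIV (\<lambda>z. centered_data X n \<theta>0 z m)" for m
    unfolding centered_data_def fourier_data_def
    by (intro continuous_intros continuous_on_product_coordinates)
  have G: "continuous_on UNIV (\<lambda>z. G_vec X \<theta>0 f0 n z)"
    unfolding G_vec_altdef by (intro continuous_intros c)
  show ?thesis
    unfolding whittle_remainder_def[abs_def] log_whittle_ratio[OF D] times_divide_eq_right[symmetric]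
    by (intro continuous_intros c bounded_linear.continuous_on[OF matrix_vector_mul_bounded_linear G])
qed

text \<open>Cauchy-Schwarz handles the linear part, with \<open>norm h \<le> sqrt (q / s)\<close>
  and the block bound for \<open>v\<close>; the relative weight bound handles the quadratic part.
  The right-hand side is free of \<open>\<theta>\<close> and \<open>f\<close>, so it survives the
  supremum.\<close>

lemma whittle_remainder_bound:
  fixes X :: "nat \<Rightarrow> nat \<Rightarrow> real ^ 'r"
  assumes n: "n \<ge> 2" and \<tau>0: "\<tau>0 > 0" and \<tau>1: "\<tau>1 \<ge> 0"
    and f0: "\<And>x. x \<in> {0..pi} \<Longrightarrow> \<tau>0 \<le> f0 x \<and> f0 x \<le> \<tau>1"
    and lip: "\<And>x y. x \<in> {0..pi} \<Longrightarrow> y \<in> {0..pi} \<Longrightarrow> \<bar>f0 x - f0 y\<bar> \<le> \<tau>1 * \<bar>x - y\<bar>"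
    and s: "s > 0" "\<And>h. s * (h \<bullet> h) \<le> h \<bullet> (S_mat X f0 n *v h)"
    and L: "L > 0" and f: "f \<in> H_set \<tau>0 \<tau>1 f0 n"
  shows "\<bar>whittle_remainder X \<theta>0 f0 n \<theta> f z\<bar> / (1 + (\<theta> - \<theta>0) \<bullet> (S_mat X f0 n *v (\<theta> - \<theta>0))) \<le>
    1 / (2 * \<tau>0 * ln (real n)) +
    sqrt (block_statistic X n \<theta>0 L (1 / (2 * pi * \<tau>0\<^sup>2 * ln (real n))) (2 * \<tau>1 / (\<tau>0\<^sup>2 * real n)) z / s)"
proof -
  define h where "h = \<theta> - \<theta>0"
  define q where "q = h \<bullet> (S_mat X f0 n *v h)"
  \<comment> \<open>\<open>A\<close> is the absolute weight bound at distance
    \<open>1 / ln (real n)\<close>; the factor 2 in \<open>\<Delta>\<close> accounts for the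
    increments of both inverse densities.\<close>
  define A where "A = 1 / (2 * pi * \<tau>0\<^sup>2 * ln (real n))"
  define \<Delta> where "\<Delta> = 2 * \<tau>1 / (\<tau>0\<^sup>2 * real n)"
  define W where "W = block_statistic X n \<theta>0 L A \<Delta> z"
  define v where "v = (\<Sum>m=1..n. weight_diff n f f0 m *\<^sub>R (centered_data X n \<theta>0 z m *\<^sub>R fourier_design X n m))"
  have fC: "f \<in> C_class \<tau>0 \<tau>1" using f by (simp add: H_set_def)
  have f_low: "\<tau>0 \<le> f x" if "x \<in> {0..pi}" for x
    using C_class_lower_bound[OF fC \<tau>0 that] .
  have f0_low: "\<tau>0 \<le> f0 x" if "x \<in> {0..pi}" for x
    using f0[OF that] by simp
  have diff: "\<bar>f x - f0 x\<bar> \<le> 1 / ln (real n)" if "x \<in> {0..pi}" for x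
  proof (rule H_set_bound[OF f _ that])
    show "\<bar>f0 y\<bar> \<le> \<tau>1" if "y \<in> {0..pi}" for y using f0[OF that] \<tau>0 by auto
  qed
  have ln_pos: "ln (real n) > 0" using n by simp
  have q0: "0 \<le> q"
    using s(2)[of h] s(1) unfolding q_def by (meson inner_ge_zero mult_nonneg_nonneg less_imp_le order_trans)
  have D0: "D_entry n f0 m > 0" if "m \<in> {1..n}" for m
  proof -
    have "2 * pi * \<tau>0 \<le> D_entry n f0 m"
      using f0 that by (intro D_entry_bounds(1)[of _ _ \<tau>1])
    moreover have "2 * pi * \<tau>0 > 0" using \<tau>0 by simp
    ultimately show ?thesis by linarith
  qed
  have w: "\<bar>weight_diff n f f0 m\<bar> \<le> A" "\<bar>weight_diff n f f0 m\<bar> \<le> 1 / (\<tau>0 * ln (real n)) * (1 / D_entry n f0 m)"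
    if "m \<in> {1..n}" for m
    using weight_diff_bound[of \<tau>0 f f0 "1 / ln (real n)" m n] \<tau>0 f_low f0_low diff that
    by (simp_all add: A_def mult_ac)
  have w_step: "\<bar>weight_diff n f f0 (Suc m) - weight_diff n f f0 m\<bar> \<le> \<Delta>" if "m \<in> {1..n}" "Suc m \<in> {1..n}" for m
  proof -
    have "\<bar>1 / D_entry n f (Suc m) - 1 / D_entry n f m\<bar> \<le> \<tau>1 / (\<tau>0\<^sup>2 * real n)"
      by (rule inverse_D_entry_step[OF \<tau>0 f_low C_class_lipschitz[OF fC] \<tau>1 that])
    moreover have "\<bar>1 / D_entry n f0 (Suc m) - 1 / D_entry n f0 m\<bar> \<le> \<tau>1 / (\<tau>0\<^sup>2 * real n)"
      by (rule inverse_D_entry_step[OF \<tau>0 f0_low lip \<tau>1 that])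
    moreover have "\<Delta> = \<tau>1 / (\<tau>0\<^sup>2 * real n) + \<tau>1 / (\<tau>0\<^sup>2 * real n)" by (simp add: \<Delta>_def)
    ultimately show ?thesis unfolding weight_diff_def by linarith
  qed
  have v_eq: "v = (\<Sum>m<n. weight_diff n f f0 (Suc m) *\<^sub>R (centered_data X n \<theta>0 z (Suc m) *\<^sub>R fourier_design X n (Suc m)))"
    unfolding v_def One_nat_def sum.atLeast1_atMost_eq ..
  have "(norm v)\<^sup>2 \<le> W"
    unfolding v_eq W_def block_statistic_def
    by (rule norm_sum_blocks_squared[OF L]) (use w(1) w_step in auto)
  then have "norm v \<le> sqrt W" by (rule real_le_rsqrt)
  moreover have W0: "0 \<le> W" using \<open>(norm v)\<^sup>2 \<le> W\<close> by (meson order_trans zero_le_power2)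
  moreover have "norm h \<le> sqrt (q / s)"
    using s(2)[of h] s(1) by (intro real_le_rsqrt) (simp add: q_def power2_norm_eq_inner field_simps)
  ultimately have "norm h * norm v \<le> sqrt (q / s) * sqrt W"
    by (intro mult_mono) (use q0 s in auto)
  moreover have "\<bar>h \<bullet> v\<bar> \<le> norm h * norm v" by (rule Cauchy_Schwarz_ineq2)
  moreover have "sqrt (q / s) * sqrt W = sqrt q * sqrt (W / s)"
    by (simp add: real_sqrt_divide)
  \<comment> \<open>The denominator \<open>1 + q\<close> of the normalised remainder absorbs the
    factor \<open>sqrt q\<close>.\<close>
  moreover have "sqrt q * sqrt (W / s) \<le> (1 + q) * sqrt (W / s)"
  proof (rule mult_right_mono)
    have "q \<le> (1 + q)\<^sup>2" using q0 by (simp add: power2_eq_square algebra_simps)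
    then show "sqrt q \<le> 1 + q" using q0 by (intro real_le_lsqrt) auto
  qed (use W0 s in auto)
  ultimately have lin: "\<bar>h \<bullet> v\<bar> \<le> (1 + q) * sqrt (W / s)" by linarith
  have "\<bar>\<Sum>m=1..n. (fourier_design X n m \<bullet> h)\<^sup>2 * weight_diff n f f0 m\<bar> \<le>
      (\<Sum>m=1..n. (fourier_design X n m \<bullet> h)\<^sup>2 * (1 / (\<tau>0 * ln (real n)) * (1 / D_entry n f0 m)))"
    using w(2) by (intro order.trans[OF sum_abs] sum_mono) (simp only: abs_mult abs_power2, intro mult_left_mono, auto)
  also have "\<dots> = 1 / (\<tau>0 * ln (real n)) * q"
    unfolding q_def inner_S_mat sum_distrib_left by (intro sum.cong refl) (simp add: power2_eq_square)
  also have "\<dots> \<le> 1 / (\<tau>0 * ln (real n)) * (1 + q)"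
    using \<tau>0 ln_pos by (intro mult_left_mono) auto
  finally have quad: "\<bar>\<Sum>m=1..n. (fourier_design X n m \<bullet> h)\<^sup>2 * weight_diff n f f0 m\<bar> \<le> 1 / (\<tau>0 * ln (real n)) * (1 + q)" .
  have R: "whittle_remainder X \<theta>0 f0 n \<theta> f z = h \<bullet> v - 1 / 2 * (\<Sum>m=1..n. (fourier_design X n m \<bullet> h)\<^sup>2 * weight_diff n f f0 m)"
    unfolding h_def v_def
    by (rule whittle_remainder_eq[OF C_class_D_entry_pos[OF fC] S_mat_sym_pos_def[OF s(2,1)]])
  have "\<bar>whittle_remainder X \<theta>0 f0 n \<theta> f z\<bar> \<le> (1 + q) * sqrt (W / s) + 1 / 2 * (1 / (\<tau>0 * ln (real n)) * (1 + q))"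
    unfolding R using lin quad by linarith
  also have "\<dots> = (1 / (2 * \<tau>0 * ln (real n)) + sqrt (W / s)) * (1 + q)"
    by (simp add: algebra_simps)
  finally have "\<bar>whittle_remainder X \<theta>0 f0 n \<theta> f z\<bar> / (1 + q) \<le> 1 / (2 * \<tau>0 * ln (real n)) + sqrt (W / s)"
    using q0 by (simp add: divide_le_eq)
  then show ?thesis by (simp only: W_def A_def \<Delta>_def q_def h_def)
qed

text \<open>Blocks of length about \<open>n / ln n\<close> balance the two parts of the block
  statistic: with \<open>A\<close> of order \<open>1 / ln n\<close> and \<open>\<Delta>\<close> of
  order \<open>1 / n\<close>, both have expectation of order \<open>n / ln n\<close>.\<close>

lemma block_length_bounds:
  assumes "n \<ge> 3"
  defines "L \<equiv> nat \<lceil>real n / ln (real n)\<rceil>"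
  shows "L > 0" "real (n div L + 1) \<le> ln (real n) + 1" "real L \<le> real n / ln (real n) + 1"
proof -
  have ln: "ln (real n) > 0" using assms(1) by simp
  have low: "real n / ln (real n) \<le> real L"
    unfolding L_def by (rule real_nat_ceiling_ge)
  have "real n / ln (real n) > 0" using ln assms(1) by simp
  then have "real L > 0" using low by linarith
  then show "L > 0" by simp
  have "real (n div L) \<le> real n / real L" by (rule of_nat_div_le_of_nat)
  also have "\<dots> \<le> ln (real n)"
    using low ln \<open>real L > 0\<close> by (simp add: field_simps)
  finally show "real (n div L + 1) \<le> ln (real n) + 1" by simp
  have "real L = of_int \<lceil>real n / ln (real n)\<rceil>"
    using \<open>real n / ln (real n) > 0\<close> by (simp add: L_def)
  also have "\<dots> \<le> real n / ln (real n) + 1" by (rule of_int_ceiling_le_add_one)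
  finally show "real L \<le> real n / ln (real n) + 1" .
qed

theorem theorem4:
  fixes X :: "nat \<Rightarrow> nat \<Rightarrow> real ^ 'r"
    and \<theta>0 :: "real ^ 'r"
    and f0 \<alpha> \<beta> :: "real \<Rightarrow> real"
    and \<tau>0 \<tau>1 :: real
    and M :: "'w measure" and e :: "int \<Rightarrow> 'w \<Rightarrow> real" and Z :: "nat \<Rightarrow> 'w \<Rightarrow> nat \<Rightarrow> real"
    and Mp :: "'v measure" and \<Phi> :: "'v \<Rightarrow> real measure" and p :: "nat pmf"
    and P\<theta> :: "(real ^ 'r) measure"
    and prior :: "((real ^ 'r) \<times> (real \<Rightarrow> real)) measure"
  assumes design: "assumption_D X"
    and errors: "stationary_gaussian_series M e f0"
    and spec: "assumption_F f0"
    and model: "\<And>n w t. t \<in> {1..n} \<Longrightarrow> Z n w t = X n t \<bullet> \<theta>0 + e (int t) w"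
    and tau: "0 < \<tau>0" "\<tau>0 < (INF \<omega>\<in>{0..2*pi}. f0 \<omega>)" "(SUP \<omega>\<in>{0..2*pi}. f0 \<omega>) < \<tau>1"
    and gp: "gamma_process Mp \<Phi> \<alpha> \<beta>"
    and p0: "pmf p 0 = 0"
    and prior: "prior = P\<theta> \<Otimes>\<^sub>M truncated_prior Mp \<Phi> p \<tau>0 \<tau>1"
    and P: "assumption_P P\<theta> \<theta>0"
    and G: "assumption_G \<alpha> \<beta>"
    and K: "assumption_K p"
  shows "\<exists>R :: nat \<Rightarrow> real ^ 'r \<Rightarrow> (real \<Rightarrow> real) \<Rightarrow> (nat \<Rightarrow> real) \<Rightarrow> real.
    (\<forall>n \<theta> z. \<forall>f\<in>C_class \<tau>0 \<tau>1.
       ln (whittle_density X n \<theta> f z / whittle_density X n \<theta>0 f z) =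
         (\<theta> - \<theta>0) \<bullet> (mat_sqrt (S_mat X f0 n) *v G_vec X \<theta>0 f0 n z)
         - 1 / 2 * ((\<theta> - \<theta>0) \<bullet> (S_mat X f0 n *v (\<theta> - \<theta>0))) + R n \<theta> f z) \<and>
    tight_seq (\<lambda>n. whittle_measure X n \<theta>0 f0) (G_vec X \<theta>0 f0) \<and>
    tends_to_zero_in_prob (\<lambda>n. whittle_measure X n \<theta>0 f0)
      (\<lambda>n z. SUP (\<theta>, f)\<in>Theta_set X \<theta>0 f0 n \<times> H_set \<tau>0 \<tau>1 f0 n.
         ennreal (\<bar>R n \<theta> f z\<bar> / (1 + (\<theta> - \<theta>0) \<bullet> (S_mat X f0 n *v (\<theta> - \<theta>0)))))"
proof -

  \<comment> \<open>Uniform bounds on \<open>f0\<close>, \<open>S_mat\<close> and the transformed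
    design\<close>
  define Pn where "Pn n = whittle_measure X n \<theta>0 f0" for n
  define R where "R = whittle_remainder X \<theta>0 f0"
  \<comment> \<open>Boundedness from Assumption F makes the infimum and supremum in the hypotheses
    genuine bounds for \<open>f0\<close>.\<close>
  have bdd: "bdd_below (f0 ` {0..2*pi})" "bdd_above (f0 ` {0..2*pi})"
  proof -
    obtain l u where "\<forall>\<omega>\<in>{0..2*pi}. l \<le> f0 \<omega> \<and> f0 \<omega> \<le> u"
      using spec unfolding assumption_F_def by blast
    then show "bdd_below (f0 ` {0..2*pi})" "bdd_above (f0 ` {0..2*pi})"
      by (auto intro!: bdd_belowI[of _ l] bdd_aboveI[of _ u])
  qed
  have f0: "\<tau>0 \<le> f0 x \<and> f0 x \<le> \<tau>1" if "x \<in> {0..pi}" for x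
  proof -
    have x: "x \<in> {0..2*pi}" using that by auto
    show ?thesis
      using cINF_lower[OF bdd(1) x] cSUP_upper[OF x bdd(2)] tau by linarith
  qed
  have \<tau>1: "\<tau>1 > 0" using f0[of 0] tau(1) by auto
  have D: "2 * pi * \<tau>0 \<le> D_entry n f0 m" "D_entry n f0 m \<le> 2 * pi * \<tau>1" if "m \<in> {1..n}" for n m
    using that f0 by (intro D_entry_bounds[of \<tau>0 f0 \<tau>1]; simp)+
  have D_pos: "\<forall>m\<in>{1..n}. D_entry n f0 m > 0" for n
  proof
    fix m assume m: "m \<in> {1..n}"
    have "2 * pi * \<tau>0 > 0" using tau(1) by simp
    with D(1)[OF m] show "D_entry n f0 m > 0" by linarith
  qed
  obtain c C where c: "c > 0" and C: "C > 0" and gram: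
    "\<forall>\<^sub>F n in sequentially. \<forall>h. c * real n * (h \<bullet> h) \<le> h \<bullet> (gram_mat X n *v h) \<and>
       h \<bullet> (gram_mat X n *v h) \<le> C * real n * (h \<bullet> h)"
    using assumption_D_bounds[OF design] by blast
  define s where "s = c / (2 * pi * \<tau>1)"
  have s: "s > 0" using c \<tau>1 by (simp add: s_def)
  have S_low: "\<forall>\<^sub>F n in sequentially. \<forall>h. s * real n * (h \<bullet> h) \<le> h \<bullet> (S_mat X f0 n *v h)"
    using gram
  proof eventually_elim
    case (elim n)
    show ?case
      unfolding s_def using elim D_pos D(2) \<tau>1 by (intro allI S_mat_lower_bound) auto
  qed
  \<comment> \<open>The trace of the Gram matrix is a sum of \<open>CARD('r)\<close> diagonal terms,
    each eventually at most \<open>C * n\<close>.\<close>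
  define K0 where "K0 = real CARD('r) * C"
  have X2: "\<forall>\<^sub>F n in sequentially. (\<Sum>m=1..n. (norm (fourier_design X n m))\<^sup>2) \<le> K0 * real n"
    using gram
  proof eventually_elim
    case (elim n)
    have "(\<Sum>m=1..n. (norm (fourier_design X n m))\<^sup>2) \<le> (\<Sum>b\<in>(Basis :: (real ^ 'r) set). C * real n * (b \<bullet> b))"
      unfolding sum_norm_fourier_design using elim by (intro sum_mono) blast
    also have "\<dots> = K0 * real n"
      by (simp add: K0_def inner_same_Basis)
    finally show ?case .
  qed
  have prob: "prob_space (Pn n)" for n
    unfolding Pn_def by (rule prob_space_whittle_measure[OF D_pos])

  \<comment> \<open>Tightness of the score\<close>
  have "tight_seq Pn (G_vec X \<theta>0 f0)"
  proof (rule tight_seqI_second_moment[OF prob])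
    let ?Mi = "\<lambda>n. matrix_inv (mat_sqrt (S_mat X f0 n))"
    let ?b = "\<lambda>n m. (1 / D_entry n f0 m) *\<^sub>R (?Mi n *v fourier_design X n m)"
    let ?Q = "\<lambda>n. \<Sum>m=1..n. D_entry n f0 m * (norm (?b n m))\<^sup>2"
    show "G_vec X \<theta>0 f0 n \<in> borel_measurable (Pn n)" for n
      unfolding Pn_def by (rule G_vec_measurable)
    show "has_bochner_integral (Pn n) (\<lambda>z. (norm (G_vec X \<theta>0 f0 n z))\<^sup>2) (?Q n)" for n
      unfolding Pn_def G_vec_altdef by (rule whittle_second_moment[OF D_pos subset_refl])
    \<comment> \<open>The inverse root contributes \<open>1 / (s * n)\<close>, the inverse weight at
      most \<open>1 / (2 * pi * \<tau>0)\<close>, and the squared design norms add up to at most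
      \<open>K0 * n\<close>, so \<open>n\<close> cancels.\<close>
    show "\<forall>\<^sub>F n in sequentially. ?Q n \<le> K0 / (s * (2 * pi * \<tau>0))"
      using S_low X2 eventually_gt_at_top[of 0]
    proof eventually_elim
      case (elim n)
      have sn: "s * real n > 0" using s elim by simp
      have spd: "sym_pos_def (S_mat X f0 n)"
        using elim sn by (intro S_mat_sym_pos_def[of "s * real n"]) auto
      have "?Q n \<le> (\<Sum>m=1..n. (norm (fourier_design X n m))\<^sup>2 / (s * real n) / (2 * pi * \<tau>0))"
      proof (rule sum_mono)
        fix m assume m: "m \<in> {1..n}"
        have Dm: "D_entry n f0 m > 0" using D_pos m by blast
        have "D_entry n f0 m * (norm (?b n m))\<^sup>2 = (norm (?Mi n *v fourier_design X n m))\<^sup>2 / D_entry n f0 m"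
          using Dm by (simp add: power_mult_distrib power_divide power2_eq_square)
        also have "\<dots> \<le> (norm (?Mi n *v fourier_design X n m))\<^sup>2 / (2 * pi * \<tau>0)"
          using D(1)[OF m] tau(1) Dm by (intro divide_left_mono mult_pos_pos) auto
        also have "\<dots> \<le> (norm (fourier_design X n m))\<^sup>2 / (s * real n) / (2 * pi * \<tau>0)"
          using elim sn tau(1) by (intro divide_right_mono norm_inv_mat_sqrt_bound[OF spd]) auto
        finally show "D_entry n f0 m * (norm (?b n m))\<^sup>2 \<le> (norm (fourier_design X n m))\<^sup>2 / (s * real n) / (2 * pi * \<tau>0)" .
      qed
      also have "\<dots> = (\<Sum>m=1..n. (norm (fourier_design X n m))\<^sup>2) / (s * real n) / (2 * pi * \<tau>0)"
        by (simp only: sum_divide_distrib)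
      also have "\<dots> \<le> K0 * real n / (s * real n) / (2 * pi * \<tau>0)"
        using elim sn tau(1) by (intro divide_right_mono) auto
      also have "\<dots> = K0 / (s * (2 * pi * \<tau>0))"
        using elim by simp
      finally show ?case .
    qed
  qed

  \<comment> \<open>Uniform convergence of the normalised remainder\<close>
  moreover have "tends_to_zero_in_prob Pn
      (\<lambda>n z. SUP (\<theta>, f)\<in>Theta_set X \<theta>0 f0 n \<times> H_set \<tau>0 \<tau>1 f0 n.
         ennreal (\<bar>R n \<theta> f z\<bar> / (1 + (\<theta> - \<theta>0) \<bullet> (S_mat X f0 n *v (\<theta> - \<theta>0)))))"
    (is "tends_to_zero_in_prob Pn ?Y")
  proof -
    define L where "L n = nat \<lceil>real n / ln (real n)\<rceil>" for n :: nat
    define A where "A n = 1 / (2 * pi * \<tau>0\<^sup>2 * ln (real n))" for n :: nat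
    define \<Delta> where "\<Delta> n = 2 * \<tau>1 / (\<tau>0\<^sup>2 * real n)" for n :: nat
    define W where "W n = block_statistic X n \<theta>0 (L n) (A n) (\<Delta> n)" for n
    define a1 where "a1 = 2 * (1 / (2 * pi * \<tau>0\<^sup>2))\<^sup>2"
    define a2 where "a2 = 2 * (2 * \<tau>1 / \<tau>0\<^sup>2)\<^sup>2"
    define b where "b = 2 * pi * \<tau>1 * K0 / s"
    \<comment> \<open>\<open>\<eta> n\<close> will bound the expectation of
      \<open>W n / (s * n)\<close>: \<open>a1\<close> and \<open>a2\<close> collect the constants of
      \<open>A\<^sup>2\<close> and \<open>\<Delta>\<^sup>2\<close>, and \<open>b\<close> those of
      the design and of the lower bound on \<open>S_mat\<close>. Both rates are of order
      \<open>1 / ln n\<close>.\<close>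
    define \<eta> where "\<eta> n = (a1 * ((ln (real n) + 1) / (ln (real n))\<^sup>2) + a2 * (1 / real n * (real n / ln (real n) + 1))) * b" for n :: nat
    have \<eta>: "\<eta> \<longlonglongrightarrow> 0"
    proof -
      have "(\<lambda>n. (ln (real n) + 1) / (ln (real n))\<^sup>2) \<longlonglongrightarrow> 0" by real_asymp
      moreover have "(\<lambda>n. 1 / real n * (real n / ln (real n) + 1)) \<longlonglongrightarrow> 0" by real_asymp
      ultimately have "\<eta> \<longlonglongrightarrow> (a1 * 0 + a2 * 0) * b"
        unfolding \<eta>_def[abs_def] by (intro tendsto_intros)
      then show ?thesis by simp
    qed
    have expect: "\<forall>\<^sub>F n in sequentially. (LINT z|Pn n. W n z / (s * real n)) \<le> \<eta> n"
      using X2 eventually_ge_at_top[of 3]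
    proof eventually_elim
      case (elim n)
      note Lb = block_length_bounds[OF \<open>n \<ge> 3\<close>, folded L_def]
      have n: "real n > 0" "ln (real n) > 0" using elim by auto
      have "(LINT z|Pn n. W n z) \<le> (2 * (A n)\<^sup>2 * real (n div L n + 1) + 2 * (\<Delta> n)\<^sup>2 * real n * real (L n)) *
          (\<Sum>m=1..n. D_entry n f0 m * (norm (fourier_design X n m))\<^sup>2)"
        unfolding Pn_def W_def by (rule block_statistic_expectation(2)[OF D_pos Lb(1)])
      also have "\<dots> \<le> (a1 * ((ln (real n) + 1) / (ln (real n))\<^sup>2) + a2 * (1 / real n * (real n / ln (real n) + 1))) *
          (2 * pi * \<tau>1 * (K0 * real n))"
      proof (rule mult_mono)
        have "2 * (A n)\<^sup>2 * real (n div L n + 1) \<le> 2 * (A n)\<^sup>2 * (ln (real n) + 1)"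
          using Lb(2) by (intro mult_left_mono) auto
        also have "\<dots> = a1 * ((ln (real n) + 1) / (ln (real n))\<^sup>2)"
          by (simp add: A_def a1_def power_mult_distrib power_divide)
        finally have 1: "2 * (A n)\<^sup>2 * real (n div L n + 1) \<le> a1 * ((ln (real n) + 1) / (ln (real n))\<^sup>2)" .
        have "2 * (\<Delta> n)\<^sup>2 * real n * real (L n) \<le> 2 * (\<Delta> n)\<^sup>2 * real n * (real n / ln (real n) + 1)"
          using Lb(3) by (intro mult_left_mono) auto
        also have "\<dots> = a2 * (1 / real n * (real n / ln (real n) + 1))"
          using n by (simp add: \<Delta>_def a2_def power_mult_distrib power_divide power2_eq_square)
        finally show "2 * (A n)\<^sup>2 * real (n div L n + 1) + 2 * (\<Delta> n)\<^sup>2 * real n * real (L n) \<le>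
            a1 * ((ln (real n) + 1) / (ln (real n))\<^sup>2) + a2 * (1 / real n * (real n / ln (real n) + 1))"
          using 1 by linarith
        have "(\<Sum>m=1..n. D_entry n f0 m * (norm (fourier_design X n m))\<^sup>2) \<le>
            (\<Sum>m=1..n. 2 * pi * \<tau>1 * (norm (fourier_design X n m))\<^sup>2)"
          using D(2) by (intro sum_mono mult_right_mono) auto
        also have "\<dots> \<le> 2 * pi * \<tau>1 * (K0 * real n)"
          unfolding sum_distrib_left[symmetric] using elim \<tau>1 by (intro mult_left_mono) auto
        finally show "(\<Sum>m=1..n. D_entry n f0 m * (norm (fourier_design X n m))\<^sup>2) \<le> 2 * pi * \<tau>1 * (K0 * real n)" .
        show "0 \<le> (\<Sum>m=1..n. D_entry n f0 m * (norm (fourier_design X n m))\<^sup>2)"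
          using D_pos by (intro sum_nonneg mult_nonneg_nonneg) (auto simp: less_imp_le)
        show "0 \<le> a1 * ((ln (real n) + 1) / (ln (real n))\<^sup>2) + a2 * (1 / real n * (real n / ln (real n) + 1))"
          using n by (intro add_nonneg_nonneg mult_nonneg_nonneg) (auto simp: a1_def a2_def)
      qed
      also have "\<dots> = \<eta> n * (s * real n)"
        using s by (simp add: \<eta>_def b_def)
      finally show ?case
        using s n by (simp add: divide_le_eq)
    qed
    have bound: "\<forall>\<^sub>F n in sequentially. \<forall>\<theta>. \<forall>f\<in>H_set \<tau>0 \<tau>1 f0 n. \<forall>z.
        \<bar>R n \<theta> f z\<bar> / (1 + (\<theta> - \<theta>0) \<bullet> (S_mat X f0 n *v (\<theta> - \<theta>0))) \<le>
        1 / (2 * \<tau>0 * ln (real n)) + sqrt (W n z / (s * real n))"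
    proof -
      \<comment> \<open>The Lipschitz bound on \<open>f0\<close> is available as soon as some
        \<open>f\<close> lies in \<open>H_set\<close>, and the estimate is only claimed for such
        \<open>f\<close>.\<close>
      have "\<forall>\<^sub>F n in sequentially. H_set \<tau>0 \<tau>1 f0 n \<noteq> {} \<longrightarrow>
          (\<forall>x\<in>{0..pi}. \<forall>y\<in>{0..pi}. \<bar>f0 x - f0 y\<bar> \<le> \<tau>1 * \<bar>x - y\<bar>)"
        using f0 tau(1) by (intro eventually_H_set_lipschitz[of f0 \<tau>1]) force
      then show ?thesis
        using S_low eventually_ge_at_top[of 3]
      proof eventually_elim
        case (elim n)
        show ?case
        proof (intro allI ballI)
          fix \<theta> f z assume f: "f \<in> H_set \<tau>0 \<tau>1 f0 n"
          show "\<bar>R n \<theta> f z\<bar> / (1 + (\<theta> - \<theta>0) \<bullet> (S_mat X f0 n *v (\<theta> - \<theta>0))) \<le>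
              1 / (2 * \<tau>0 * ln (real n)) + sqrt (W n z / (s * real n))"
            unfolding R_def W_def A_def \<Delta>_def
          proof (rule whittle_remainder_bound[OF _ tau(1) _ f0 _ _ _ _ f])
            show "0 < L n"
              unfolding L_def using elim by (intro block_length_bounds) auto
          qed (use elim f s \<tau>1 in auto)
        qed
      qed
    qed
    show ?thesis
      unfolding tends_to_zero_in_prob_def
    proof (intro conjI allI impI)
      fix n
      show "prob_space (Pn n)" by (rule prob)
      show "?Y n \<in> borel_measurable (Pn n)"
        unfolding Pn_def whittle_measurable_cong
      proof (rule SUP_continuous_measurable_PiM)
        fix x assume x: "x \<in> Theta_set X \<theta>0 f0 n \<times> H_set \<tau>0 \<tau>1 f0 n"
        obtain \<theta> f where [simp]: "x = (\<theta>, f)" by (cases x)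
        have "f \<in> C_class \<tau>0 \<tau>1" using x by (simp add: H_set_def)
        then have "continuous_on UNIV (R n \<theta> f)"
          unfolding R_def by (intro whittle_remainder_continuous C_class_D_entry_pos)
        then show "continuous_on UNIV (\<lambda>z. case x of (\<theta>, f) \<Rightarrow>
            ennreal (\<bar>R n \<theta> f z\<bar> / (1 + (\<theta> - \<theta>0) \<bullet> (S_mat X f0 n *v (\<theta> - \<theta>0)))))"
          by (simp only: \<open>x = (\<theta>, f)\<close> case_prod_conv divide_inverse)
            (intro continuous_on_ennreal continuous_intros)
      qed
    next
      fix \<epsilon> :: real assume \<epsilon>: "\<epsilon> > 0"
      \<comment> \<open>The deterministic term eventually takes less than half of
        \<open>\<epsilon>\<close>; exceeding \<open>\<epsilon>\<close> then forces
        \<open>W n z / (s * n) \<ge> (\<epsilon> / 2)\<^sup>2\<close>, an event controlled by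
        Markov's inequality.\<close>
      have "(\<lambda>n. 1 / (2 * \<tau>0) * (1 / ln (real n))) \<longlonglongrightarrow> 1 / (2 * \<tau>0) * 0"
        by (intro tendsto_mult tendsto_const) real_asymp
      then have small: "\<forall>\<^sub>F n in sequentially. 1 / (2 * \<tau>0) * (1 / ln (real n)) < \<epsilon> / 2"
        using \<epsilon> by (intro order_tendstoD) auto
      have up: "\<forall>\<^sub>F n in sequentially. measure (Pn n) {z \<in> space (Pn n). ?Y n z > ennreal \<epsilon>} \<le> \<eta> n / (\<epsilon> / 2)\<^sup>2"
        using small bound expect eventually_ge_at_top[of 3]
      proof eventually_elim
        case (elim n)
        interpret prob_space "Pn n" by (rule prob)
        have int: "integrable (Pn n) (\<lambda>z. W n z / (s * real n))"
          unfolding Pn_def W_def L_def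
          by (intro integrable_divide_zero block_statistic_expectation(1)[OF D_pos]
              block_length_bounds(1)[OF \<open>n \<ge> 3\<close>])
        have "{z \<in> space (Pn n). ?Y n z > ennreal \<epsilon>} \<subseteq> {z \<in> space (Pn n). W n z / (s * real n) \<ge> (\<epsilon> / 2)\<^sup>2}"
        proof safe
          fix z assume "?Y n z > ennreal \<epsilon>"
          then obtain \<theta> f where f: "f \<in> H_set \<tau>0 \<tau>1 f0 n"
            and gt: "ennreal \<epsilon> < ennreal (\<bar>R n \<theta> f z\<bar> / (1 + (\<theta> - \<theta>0) \<bullet> (S_mat X f0 n *v (\<theta> - \<theta>0))))"
            unfolding less_SUP_iff by auto
          have "\<epsilon> < \<bar>R n \<theta> f z\<bar> / (1 + (\<theta> - \<theta>0) \<bullet> (S_mat X f0 n *v (\<theta> - \<theta>0)))"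
            using gt \<epsilon> by (simp add: ennreal_less_iff)
          also have "\<dots> \<le> 1 / (2 * \<tau>0 * ln (real n)) + sqrt (W n z / (s * real n))"
            using elim f by blast
          finally have "\<epsilon> / 2 \<le> sqrt (W n z / (s * real n))"
            using elim by simp
          moreover have "0 \<le> W n z / (s * real n)"
            using s unfolding W_def by (intro divide_nonneg_nonneg block_statistic_nonneg) auto
          ultimately show "(\<epsilon> / 2)\<^sup>2 \<le> W n z / (s * real n)"
            using \<epsilon> by (metis half_gt_zero less_imp_le power_mono real_sqrt_pow2)
        qed
        then have "measure (Pn n) {z \<in> space (Pn n). ?Y n z > ennreal \<epsilon>} \<le>
            measure (Pn n) {z \<in> space (Pn n). W n z / (s * real n) \<ge> (\<epsilon> / 2)\<^sup>2}"
          using int by (intro finite_measure_mono) auto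
        also have "\<dots> \<le> (LINT z|Pn n. W n z / (s * real n)) / (\<epsilon> / 2)\<^sup>2"
          using s \<epsilon> by (intro integral_Markov_inequality_measure[OF int, where A = "{}"])
            (auto simp: W_def intro!: AE_I2 divide_nonneg_nonneg block_statistic_nonneg)
        also have "\<dots> \<le> \<eta> n / (\<epsilon> / 2)\<^sup>2"
          using elim by (intro divide_right_mono) auto
        finally show ?case .
      qed
      have lim: "(\<lambda>n. \<eta> n / (\<epsilon> / 2)\<^sup>2) \<longlonglongrightarrow> 0"
        using tendsto_divide[OF \<eta> tendsto_const, of "(\<epsilon> / 2)\<^sup>2"] \<epsilon> by simp
      show "(\<lambda>n. measure (Pn n) {z \<in> space (Pn n). ?Y n z > ennreal \<epsilon>}) \<longlonglongrightarrow> 0"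
        by (rule tendsto_sandwich[OF _ up tendsto_const lim]) simp
    qed
  qed

  ultimately show ?thesis
    unfolding Pn_def by (intro exI[of _ R]) (auto simp: R_def whittle_remainder_def)
qed

end
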